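(* Fix $r\ge 2$ and $M>0$. Suppose $H_n\sim\mathsf{H}_{[r]}(n,\boldsymbol B)$ is a sample from the $r$-layered hypergraph $\boldsymbol\beta$-model with $\boldsymbol B=(\boldsymbol\beta_2,\ldots,\boldsymbol\beta_r)$ and $\|\boldsymbol\beta_s\|_\infty\le M$ for all $2\le s\le r$. Fix any integers $a_2,\ldots,a_r\ge 1$ and any subsets of nodes $J_2,\ldots,J_r\subseteq[n]$ with cardinalities $a_2,\ldots,a_r$, respectively. Then as $n\to\infty$, $$\begin{pmatrix}[\boldsymbol D_2(\hat{\boldsymbol\beta}_2-\boldsymbol\beta_2)]_{J_2}\\ [\boldsymbol D_3(\hat{\boldsymbol\beta}_3-\boldsymbol\beta_3)]_{J_3}\\ \vdots\\ [\boldsymbol D_r(\hat{\boldsymbol\beta}_r-\boldsymbol\beta_r)]_{J_r}\end{pmatrix}\xrightarrow{D}\mathcal N_{\sum_{s=2}^r a_s}(\boldsymbol 0,\boldsymbol I),$$ where $\boldsymbol D_s=\mathrm{diag}(\sigma_s(v))_{v\in[n]}$ for $2\le s\le r$, and $[\boldsymbol x]_{J_s}=(x_v)_{v\in J_s}^\top$ for any $\boldsymbol x\in\mathbb R^n$.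
   Context: $[n]=\{1,\ldots,n\}$ and $\binom{A}{k}$ is the collection of $k$-element subsets of $A$. The $r$-layered hypergraph $\boldsymbol\beta$-model $\mathsf{H}_{[r]}(n,\boldsymbol B)$, with $\boldsymbol\beta_s=(\beta_{s,v})_{v\in[n]}\in\mathbb R^n$, is the random hypergraph on $[n]$ in which, for every $2\le s\le r$, each hyperedge $\{v_1,\ldots,v_s\}\in\binom{[n]}{s}$ is present independently with probability $\frac{e^{\beta_{s,v_1}+\cdots+\beta_{s,v_s}}}{1+e^{\beta_{s,v_1}+\cdots+\beta_{s,v_s}}}$. The $s$-degree $d_s(v)$ is the number of hyperedges of size $s$ in $H_n$ containing $v$, and $$\sigma_s(v)^2=\mathrm{Var}[d_s(v)]=\sum_{\{v_2,\ldots,v_s\}\in\binom{[n]\setminus\{v\}}{s-1}}\frac{e^{\beta_{s,v}+\beta_{s,v_2}+\cdots+\beta_{s,v_s}}}{(1+e^{\beta_{s,v}+\beta_{s,v_2}+\cdots+\beta_{s,v_s}})^2},\quad \sigma_s(v)>0 .$$ The maximum likelihood (ML) estimate $\hat{\boldsymbol\beta}_s$ is the minimizer over $\boldsymbol\beta\in\mathbb R^n$ of the negative log-likelihood $\ell_{n,s}(\boldsymbol\beta)=\sum_{\{v_1,\ldots,v_s\}\in\binom{[n]}{s}}\log(1+e^{\beta_{v_1}+\cdots+\beta_{v_s}})-\sum_{v=1}^n\beta_v d_s(v)$; it exists and is unique with probability $1-o(1)$ (define it arbitrarily otherwise). The parameters may depend on $n$; $r$, $M$ and the $a_s$ are fixed.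 $\xrightarrow{D}$ is convergence in distribution. *)

theory Defs
  imports "HOL-Probability.Probability" "HOL-Probability.Product_PMF"
begin

definition hyperedges :: "nat \<Rightarrow> nat \<Rightarrow> nat set set" where
  "hyperedges n s = {e. e \<subseteq> {1..n} \<and> card e = s}"

definition layered_hyperedges :: "nat \<Rightarrow> nat \<Rightarrow> nat set set" where
  "layered_hyperedges n r = (\<Union>s\<in>{2..r}. hyperedges n s)"

text \<open>
  The parameter \<open>B s v\<close> stands for \<open>\<beta>\<close> with subscripts \<open>s, v\<close>; only its values at
  \<open>2 \<le> s \<le> r\<close> and \<open>1 \<le> v \<le> n\<close> matter.
\<close>

definition edge_prob :: "(nat \<Rightarrow> nat \<Rightarrow> real) \<Rightarrow> nat set \<Rightarrow> real" where
  "edge_prob B e = exp (\<Sum>v\<in>e. B (card e) v) / (1 + exp (\<Sum>v\<in>e. B (card e) v))"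

text \<open>
  A hypergraph is represented by its set of hyperedges; \<open>Pi_pmf\<close> makes the indicators of the
  hyperedges of all layers jointly independent.
\<close>

definition hypergraph_beta_model ::
    "nat \<Rightarrow> nat \<Rightarrow> (nat \<Rightarrow> nat \<Rightarrow> real) \<Rightarrow> nat set set pmf" where
  "hypergraph_beta_model n r B =
     map_pmf (\<lambda>x. {e \<in> layered_hyperedges n r. x e})
       (Pi_pmf (layered_hyperedges n r) False (\<lambda>e. bernoulli_pmf (edge_prob B e)))"

definition s_degree :: "nat \<Rightarrow> nat set set \<Rightarrow> nat \<Rightarrow> nat" where
  "s_degree s H v = card {e \<in> H. card e = s \<and> v \<in> e}"

definition degree_sd :: "nat \<Rightarrow> nat \<Rightarrow> (nat \<Rightarrow> nat \<Rightarrow> real) \<Rightarrow> nat \<Rightarrow> nat \<Rightarrow> real" where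
  "degree_sd n r B s v =
     sqrt (measure_pmf.variance (hypergraph_beta_model n r B) (\<lambda>H. real (s_degree s H v)))"

definition neg_log_likelihood ::
    "nat \<Rightarrow> nat \<Rightarrow> nat set set \<Rightarrow> (nat \<Rightarrow> real) \<Rightarrow> real" where
  "neg_log_likelihood n s H b =
     (\<Sum>e\<in>hyperedges n s. ln (1 + exp (\<Sum>v\<in>e. b v))) - (\<Sum>v=1..n. b v * real (s_degree s H v))"

text \<open>
  Vectors in \<open>n\<close>-dimensional space are the extensional functions on \<open>{1..n}\<close>, so that
  uniqueness of the minimizer has its usual meaning.
\<close>

definition is_ml_estimate :: "nat \<Rightarrow> nat \<Rightarrow> nat set set \<Rightarrow> (nat \<Rightarrow> real) \<Rightarrow> bool" where
  "is_ml_estimate n s H b \<longleftrightarrow>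
     is_arg_min (neg_log_likelihood n s H) (\<lambda>x. x \<in> {1..n} \<rightarrow>\<^sub>E (UNIV :: real set)) b"

text \<open>
  An ML estimator returns the minimizer whenever there is exactly one; its value on all other
  hypergraphs is unconstrained.
\<close>

definition ml_estimator ::
    "nat \<Rightarrow> nat \<Rightarrow> nat \<Rightarrow> (nat set set \<Rightarrow> nat \<Rightarrow> real) \<Rightarrow> bool" where
  "ml_estimator n r s est \<longleftrightarrow>
     (\<forall>H. H \<subseteq> layered_hyperedges n r \<longrightarrow> (\<exists>!b. is_ml_estimate n s H b) \<longrightarrow>
        is_ml_estimate n s H (est H))"

text \<open>
  The coordinate \<open>(s, i)\<close> of the stacked vector is the one belonging to the \<open>i\<close>-th smallest
  element (counting from 0) of \<open>J s\<close>.
\<close>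

definition stack_index :: "nat \<Rightarrow> (nat \<Rightarrow> nat) \<Rightarrow> (nat \<times> nat) set" where
  "stack_index r a = (SIGMA s:{2..r}. {..<a s})"

definition stacked_restriction ::
    "nat \<Rightarrow> (nat \<Rightarrow> nat) \<Rightarrow> (nat \<Rightarrow> nat set) \<Rightarrow> (nat \<Rightarrow> nat \<Rightarrow> real) \<Rightarrow> nat \<times> nat \<Rightarrow> real" where
  "stacked_restriction r a J x =
     (\<lambda>(s, i)\<in>stack_index r a. x s (sorted_list_of_set (J s) ! i))"

text \<open>The law \<open>N(0, I)\<close>: independent standard normal coordinates indexed by the finite set \<open>K\<close>.\<close>

definition std_normal_vector :: "'i set \<Rightarrow> ('i \<Rightarrow> real) measure" where
  "std_normal_vector K = (\<Pi>\<^sub>M k\<in>K. density lborel (\<lambda>x. ennreal (std_normal_density x)))"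

text \<open>
  Weak convergence of Borel laws on the topological space \<open>T\<close> (the library's
  \<open>weak_conv_m\<close> covers the real line only).
\<close>

definition weakly_converges ::
    "'b topology \<Rightarrow> (nat \<Rightarrow> 'b measure) \<Rightarrow> 'b measure \<Rightarrow> bool" where
  "weakly_converges T \<mu> \<nu> \<longleftrightarrow>
     (\<forall>f::'b \<Rightarrow> real. continuous_map T euclideanreal f \<and> bounded (f ` topspace T) \<longrightarrow>
        (\<lambda>n. \<integral>x. f x \<partial>\<mu> n) \<longlonglongrightarrow> (\<integral>x. f x \<partial>\<nu>))"

text \<open>
  Convergence in distribution of random vectors \<open>X n\<close>, defined on possibly different
  probability spaces and indexed by the finite set \<open>K\<close>, to a law \<open>\<nu>\<close>.
\<close>

definition converges_in_distribution ::
    "'i set \<Rightarrow> (nat \<Rightarrow> 'w measure) \<Rightarrow> (nat \<Rightarrow> 'w \<Rightarrow> 'i \<Rightarrow> real) \<Rightarrow> ('i \<Rightarrow> real) measure \<Rightarrow> bool" where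
  "converges_in_distribution K P X \<nu> \<longleftrightarrow>
     weakly_converges (product_topology (\<lambda>_. euclideanreal) K)
       (\<lambda>n. distr (P n) (\<Pi>\<^sub>M k\<in>K. borel) (X n)) \<nu>"

end

theory Submission
  imports Defs "HOL-Real_Asymp.Real_Asymp"
begin

text \<open>
  Write \<open>x\<close> for the estimation error in layer \<open>s\<close>, \<open>g\<close> for the centered degrees and \<open>\<Sigma>\<close> for the Hessian of
  the negative log-likelihood at the true parameter, whose diagonal consists of the degree variances.
  The score equations read \<open>\<Sigma> x = g - R\<close> with \<open>R\<close> quadratic in \<open>x\<close>.  By Hoeffding's inequality all
  \<open>g v\<close> are small compared with \<open>n ^ (s - 1)\<close> with high probability; then the equations have a
  solution close to \<open>0\<close>, which by strict convexity is the unique estimate.  Off the diagonal \<open>\<Sigma>\<close> is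
  smaller by a factor \<open>n\<close>, and testing the equations against a column of the inverse of \<open>\<Sigma>\<close> shows that
  \<open>\<sigma> v * x v\<close> differs from \<open>g v / \<sigma> v\<close> by a quantity whose expectation is of order \<open>n ^ (-1/2)\<close>.

  Finitely many of the normalized centered degrees are asymptotically independent, because two
  vertices share a negligible fraction of their hyperedges, and each of them is asymptotically
  normal by a central limit theorem for triangular arrays of bounded variables.
\<close>

section \<open>Score equations on balanced hypergraphs\<close>

text \<open>Orders of magnitude, with \<open>N = n\<close> and \<open>Q = n ^ (s - 2)\<close>: the
  squared \<sigma> v is of order N Q, an error coordinate x v of order (N Q) ^ (-1/2), the remainder
  R v of order 1, and the cross terms are of order Q ^ (1/2) once they are tested against the
  inverse column. Division by \<sigma> v leaves N ^ (-1/2). Testing is effective because the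
  off-diagonal entries of an inverse column are smaller than the diagonal one by a factor N, so the
  fluctuations of the n degrees average out instead of adding up in absolute value. The bound on the
  g v puts a critical point into the unit box around the true parameter. Convexity then identifies
  it as the global minimizer, so consistency is a by-product. The parameters may vary with n without
  converging, so no step passes to a limiting model: all constants depend only on s, M and the
  number of selected vertices. M enters through the lower bound on the variance of an edge
  indicator.\<close>

lemma box_attains_min:
  fixes F :: "('v \<Rightarrow> real) \<Rightarrow> real"
  assumes "K \<ge> 0" and "continuous_on UNIV F"
  shows "\<exists>x. (\<forall>v. \<bar>x v\<bar> \<le> K) \<and> (\<forall>v. v \<notin> V \<longrightarrow> x v = 0) \<and>
           (\<forall>y. (\<forall>v. \<bar>y v\<bar> \<le> K) \<longrightarrow> (\<forall>v. v \<notin> V \<longrightarrow> y v = 0) \<longrightarrow> F x \<le> F y)"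
proof -
  \<comment> \<open>Vectors are functions on the whole vertex type. Pinning the coordinates outside
    \<open>V\<close> to 0 makes the box a product of compact sets, so Tychonoff's theorem applies in
    the topology that \<open>continuous_on\<close> refers to.\<close>
  define S :: "'v \<Rightarrow> real set" where "S v = (if v \<in> V then {-K..K} else {0})" for v
  have "compactin (product_topology (\<lambda>_. euclideanreal) UNIV) (PiE UNIV S)"
    by (subst compactin_PiE) (auto simp: S_def)
  hence "compact (PiE UNIV S)"
    by (simp add: euclidean_product_topology)
  moreover have "(\<lambda>_. 0) \<in> PiE UNIV S"
    using assms by (auto simp: S_def)
  ultimately obtain x where x: "x \<in> PiE UNIV S" "\<forall>y\<in>PiE UNIV S. F x \<le> F y"
    using continuous_attains_inf[of "PiE UNIV S" F] continuous_on_subset[OF assms(2)] by blast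
  have iff: "y \<in> PiE UNIV S \<longleftrightarrow> (\<forall>v. \<bar>y v\<bar> \<le> K) \<and> (\<forall>v. v \<notin> V \<longrightarrow> y v = 0)" for y
  proof -
    have "y \<in> PiE UNIV S \<longleftrightarrow> (\<forall>v. y v \<in> S v)" by (auto simp: PiE_UNIV_domain)
    also have "\<dots> \<longleftrightarrow> (\<forall>v. \<bar>y v\<bar> \<le> K \<and> (v \<notin> V \<longrightarrow> y v = 0))"
      using assms(1) by (intro all_cong1) (auto simp: S_def abs_le_iff)
    finally show ?thesis by blast
  qed
  show ?thesis
    by (rule exI[of _ x]) (use x in \<open>simp add: iff\<close>)
qed

text \<open>Collects the losses in \<open>edge_system_expansion\<close>: the first two summands
  bound \<open>N * Q * (x v)\<^sup>2\<close>, the degree part of the remainder at \<open>v\<close>;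
  the third bounds \<open>Q * (\<Sum>u\<in>V. (x u)\<^sup>2)\<close>, which arises once from the
  codegrees at \<open>v\<close> and once from pairing the remainder with \<open>y\<close>.\<close>

definition expansion_constant :: "nat \<Rightarrow> real \<Rightarrow> real \<Rightarrow> real \<Rightarrow> real" where
  "expansion_constant s l c1 \<eta> =
     real s * (2 / l\<^sup>2) + real s * (2 * c1\<^sup>2 / l^4) + (real s + \<eta> * (real s)\<^sup>2) / l\<^sup>2"

text \<open>
  In the application \<open>Q\<close> is \<open>N ^ (s - 2)\<close>, so that degrees are of order \<open>N * Q\<close> while codegrees are
  smaller by a factor \<open>N\<close>.  The weighted adjacency operator need not be diagonally dominant; positive
  definiteness with the right order of magnitude is what \<open>quadratic_form_ge\<close> provides.
\<close>

locale balanced_hypergraph =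
  fixes V :: "'v set" and E :: "'v set set" and s :: nat and N Q \<kappa> :: real
  assumes finite_V: "finite V" and N_def: "N = real (card V)" and N_pos: "N > 0"
    and edge: "\<And>e. e \<in> E \<Longrightarrow> e \<subseteq> V \<and> card e = s"
    and kappa_pos: "\<kappa> > 0" and Q_pos: "Q > 0"
    and degree_le: "\<And>v. v \<in> V \<Longrightarrow> real (card {e\<in>E. v \<in> e}) \<le> N * Q"
    and codegree_le: "\<And>u v. u \<in> V \<Longrightarrow> v \<in> V \<Longrightarrow> u \<noteq> v \<Longrightarrow> real (card {e\<in>E. u \<in> e \<and> v \<in> e}) \<le> Q"
    and quadratic_form_ge: "\<And>x. \<kappa> * N * Q * (\<Sum>v\<in>V. (x v)\<^sup>2) \<le> (\<Sum>e\<in>E. (sum x e)\<^sup>2)"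
begin

lemma finite_E: "finite E"
  by (rule finite_subset[of _ "Pow V"]) (use edge finite_V in auto)

lemma finite_edge: "e \<in> E \<Longrightarrow> finite e"
  using edge finite_V finite_subset by metis

text \<open>Double counting of incidences: collecting edge weights at vertices is adjoint to summing
  a vector over edges. Score equations tested against a vector thereby become a sum over
  edges.\<close>

lemma sum_incidence:
  fixes f :: "'v set \<Rightarrow> real"
  shows "(\<Sum>v\<in>V. y v * (\<Sum>e | e \<in> E \<and> v \<in> e. f e)) = (\<Sum>e\<in>E. f e * sum y e)"
proof -
  have "(\<Sum>v\<in>V. y v * (\<Sum>e | e \<in> E \<and> v \<in> e. f e)) = (\<Sum>v\<in>V. \<Sum>e\<in>E. if v \<in> e then f e * y v else 0)"
    by (intro sum.cong refl) (auto simp: sum_distrib_left sum.inter_filter[OF finite_E] intro!: sum.cong)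
  also have "\<dots> = (\<Sum>e\<in>E. \<Sum>v\<in>V. if v \<in> e then f e * y v else 0)"
    by (rule sum.swap)
  also have "\<dots> = (\<Sum>e\<in>E. f e * sum y e)"
  proof (intro sum.cong refl)
    fix e assume "e \<in> E"
    hence "{v\<in>V. v \<in> e} = e" using edge by auto
    thus "(\<Sum>v\<in>V. if v \<in> e then f e * y v else 0) = f e * sum y e"
      by (simp flip: sum.inter_filter[OF finite_V] add: sum_distrib_left)
  qed
  finally show ?thesis .
qed

text \<open>Row \<open>v\<close> of the symmetric matrix whose entry at \<open>u\<close>,
  \<open>v\<close> is the total weight of the edges through both, split at the diagonal: degrees
  govern the first part, codegrees the second.\<close>

lemma sum_link:
  assumes v: "v \<in> V"
  shows "(\<Sum>e | e \<in> E \<and> v \<in> e. w e * sum x e) =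
    (\<Sum>e | e \<in> E \<and> v \<in> e. w e) * x v +
    (\<Sum>u\<in>V-{v}. x u * (\<Sum>e | e \<in> E \<and> u \<in> e \<and> v \<in> e. (w e :: real)))"
proof -
  have "(\<Sum>e | e \<in> E \<and> v \<in> e. w e * sum x e) = (\<Sum>e\<in>E. (if v \<in> e then w e else 0) * sum x e)"
    unfolding sum.inter_filter[OF finite_E] by (auto intro!: sum.cong)
  also have "\<dots> = (\<Sum>u\<in>V. x u * (\<Sum>e | e \<in> E \<and> u \<in> e. if v \<in> e then w e else 0))"
    by (rule sum_incidence[symmetric])
  also have "\<dots> = (\<Sum>u\<in>V. x u * (\<Sum>e | e \<in> E \<and> u \<in> e \<and> v \<in> e. w e))"
  proof (rule sum.cong[OF refl], rule arg_cong[where f="(*) _"])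
    fix u
    have "finite {e\<in>E. u \<in> e}" using finite_E by auto
    from sum.inter_filter[OF this, of w "\<lambda>e. v \<in> e"]
    show "(\<Sum>e | e \<in> E \<and> u \<in> e. if v \<in> e then w e else 0) = (\<Sum>e | e \<in> E \<and> u \<in> e \<and> v \<in> e. w e)"
      by (simp add: conj_assoc)
  qed
  also have "\<dots> = x v * (\<Sum>e | e \<in> E \<and> v \<in> e \<and> v \<in> e. w e) +
      (\<Sum>u\<in>V-{v}. x u * (\<Sum>e | e \<in> E \<and> u \<in> e \<and> v \<in> e. w e))"
    by (rule sum.remove[OF finite_V v])
  finally show ?thesis by (simp add: mult.commute)
qed

text \<open>Test the quadratic form on the indicator vector of \<open>v\<close>: exactly the edges
  through \<open>v\<close> contribute, each with 1.\<close>

lemma degree_ge: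
  assumes v: "v \<in> V"
  shows "\<kappa> * N * Q \<le> real (card {e\<in>E. v \<in> e})"
proof -
  have "(\<Sum>u\<in>V. (of_bool (u = v) :: real)\<^sup>2) = 1"
    using v finite_V by (simp add: of_bool_def if_distrib[of "\<lambda>x. x\<^sup>2"] cong: if_cong)
  moreover have "(\<Sum>e\<in>E. (\<Sum>u\<in>e. of_bool (u = v) :: real)\<^sup>2) = (\<Sum>e\<in>E. if v \<in> e then 1 else 0)"
    using finite_edge by (intro sum.cong refl) (auto simp: of_bool_def)
  moreover have "\<dots> = real (card {e\<in>E. v \<in> e})"
    by (simp flip: sum.inter_filter[OF finite_E])
  ultimately show ?thesis
    using quadratic_form_ge[of "\<lambda>u. of_bool (u = v)"] by simp
qed

lemma edge_square_le:
  fixes x :: "'v \<Rightarrow> real"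
  assumes "e \<in> E"
  shows "(sum x e)\<^sup>2 \<le> real s * (\<Sum>v\<in>e. (x v)\<^sup>2)"
  using Cauchy_Schwarz_ineq_sum[of "\<lambda>_. 1" x e] edge[OF assms] by (simp add: mult.commute)

lemma sum_edge_squares_le:
  "(\<Sum>e\<in>E. (sum x e)\<^sup>2) \<le> real s * N * Q * (\<Sum>v\<in>V. (x v)\<^sup>2)"
proof -
  have "(\<Sum>e\<in>E. (sum x e)\<^sup>2) \<le> (\<Sum>e\<in>E. real s * (\<Sum>v\<in>e. (x v)\<^sup>2))"
    by (intro sum_mono edge_square_le)
  also have "\<dots> = (\<Sum>v\<in>V. (x v)\<^sup>2 * (\<Sum>e | e \<in> E \<and> v \<in> e. real s))"
    by (rule sum_incidence[symmetric])
  also have "\<dots> \<le> (\<Sum>v\<in>V. (x v)\<^sup>2 * (N * Q * real s))"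
    using degree_le by (intro sum_mono mult_left_mono) (auto intro!: mult_right_mono)
  finally show ?thesis
    by (simp add: sum_distrib_left mult_ac)
qed

text \<open>Localized form of \<open>sum_edge_squares_le\<close>: the weight \<open>N * Q\<close>
  falls on \<open>v\<close> alone and all other vertices carry the codegree bound \<open>Q\<close>.
  The factor \<open>N\<close> gained there keeps the remainder in row \<open>v\<close>
  bounded.\<close>

lemma sum_link_squares_le:
  assumes v: "v \<in> V"
  shows "(\<Sum>e | e \<in> E \<and> v \<in> e. (sum x e)\<^sup>2) \<le> real s * (N * Q * (x v)\<^sup>2 + Q * (\<Sum>u\<in>V. (x u)\<^sup>2))"
proof -
  have "(\<Sum>e | e \<in> E \<and> v \<in> e. (sum x e)\<^sup>2) \<le> (\<Sum>e | e \<in> E \<and> v \<in> e. real s * (\<Sum>v\<in>e. (x v)\<^sup>2))"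
    by (intro sum_mono edge_square_le) auto
  also have "\<dots> = (\<Sum>e | e \<in> E \<and> v \<in> e. real s) * (x v)\<^sup>2 +
      (\<Sum>u\<in>V-{v}. (x u)\<^sup>2 * (\<Sum>e | e \<in> E \<and> u \<in> e \<and> v \<in> e. real s))"
    by (rule sum_link[OF v])
  also have "\<dots> \<le> (N * Q * real s) * (x v)\<^sup>2 + (\<Sum>u\<in>V-{v}. (x u)\<^sup>2 * (Q * real s))"
    using degree_le[OF v] codegree_le[OF _ v]
    by (intro add_mono mult_right_mono sum_mono mult_left_mono) (auto intro!: mult_right_mono)
  also have "(\<Sum>u\<in>V-{v}. (x u)\<^sup>2 * (Q * real s)) \<le> (\<Sum>u\<in>V. (x u)\<^sup>2 * (Q * real s))"
    using finite_V Q_pos by (intro sum_mono2) auto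
  finally show ?thesis
    by (simp add: sum_distrib_left sum_distrib_right algebra_simps)
qed

lemma root_mean_square_le:
  assumes "\<And>v. v \<in> V \<Longrightarrow> \<bar>g v\<bar> \<le> \<gamma>" and "\<gamma> \<ge> 0"
  shows "sqrt ((\<Sum>v\<in>V. (g v)\<^sup>2) / N) \<le> \<gamma>"
proof -
  have "(\<Sum>v\<in>V. (g v)\<^sup>2) \<le> (\<Sum>v\<in>V. \<gamma>\<^sup>2)"
    using assms by (intro sum_mono) (simp add: abs_le_square_iff[symmetric])
  hence "(\<Sum>v\<in>V. (g v)\<^sup>2) / N \<le> \<gamma>\<^sup>2"
    using N_pos by (simp add: N_def field_simps)
  thus ?thesis
    using assms(2) by (rule real_le_lsqrt[rotated])
qed

text \<open>
  A solution is a critical point of the convex potential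
  \<open>x \<mapsto> \<Sum>e\<in>E. H e (sum x e) - (\<Sum>v\<in>V. x v * g v)\<close>.  Its minimizer over the box of half-width \<open>K\<close>
  satisfies one-sided optimality conditions, which already give the two bounds on \<open>x\<close>; these bounds
  keep the minimizer off the boundary.
\<close>

lemma solve_edge_system:
  fixes h H :: "'v set \<Rightarrow> real \<Rightarrow> real"
  assumes c0: "0 < c0" and K: "K > 0"
    and deriv: "\<And>e t. e \<in> E \<Longrightarrow> (H e has_real_derivative h e t) (at t)"
    and lower: "\<And>e t. e \<in> E \<Longrightarrow> \<bar>t\<bar> \<le> real s * K \<Longrightarrow> c0 * t\<^sup>2 \<le> h e t * t"
    and upper: "\<And>e t. e \<in> E \<Longrightarrow> \<bar>t\<bar> \<le> real s * K \<Longrightarrow> \<bar>h e t\<bar> \<le> c1 * \<bar>t\<bar>"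
    and g: "\<And>v. v \<in> V \<Longrightarrow> \<bar>g v\<bar> \<le> \<gamma>"
    and small: "\<gamma> * (1 + c1 / (c0 * \<kappa>)) < c0 * \<kappa> * N * Q * K"
  shows "\<exists>x. (\<forall>v. v \<notin> V \<longrightarrow> x v = 0) \<and> (\<forall>v. \<bar>x v\<bar> \<le> K) \<and>
     (\<forall>v\<in>V. (\<Sum>e | e \<in> E \<and> v \<in> e. h e (sum x e)) = g v) \<and>
     (c0 * \<kappa> * N * Q)\<^sup>2 * (\<Sum>v\<in>V. (x v)\<^sup>2) \<le> (\<Sum>v\<in>V. (g v)\<^sup>2) \<and>
     (\<forall>v\<in>V. c0 * \<kappa> * N * Q * \<bar>x v\<bar> \<le> \<bar>g v\<bar> + c1 / (c0 * \<kappa>) * sqrt ((\<Sum>v\<in>V. (g v)\<^sup>2) / N))"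
proof -
  define F where "F x = (\<Sum>e\<in>E. H e (sum x e)) - (\<Sum>v\<in>V. x v * g v)" for x
  define L where "L = c0 * \<kappa> * N * Q"
  have L: "L > 0" using c0 kappa_pos N_pos Q_pos by (simp add: L_def)
  have "continuous_on UNIV (H e)" if "e \<in> E" for e
    by (intro continuous_at_imp_continuous_on ballI DERIV_isCont) (rule deriv[OF that])
  hence "continuous_on UNIV (\<lambda>x. H e (sum x e))" if "e \<in> E" for e
    using that
    by (rule_tac continuous_on_compose2[where g="H e" and t=UNIV])
       (auto intro!: continuous_on_sum continuous_on_product_coordinates)
  hence "continuous_on UNIV F"
    unfolding F_def
    by (intro continuous_on_diff continuous_on_sum continuous_on_mult_right continuous_on_product_coordinates) auto
  from box_attains_min[OF _ this, of K V] K obtain x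
    where xK: "\<And>v. \<bar>x v\<bar> \<le> K" and x0: "\<And>v. v \<notin> V \<Longrightarrow> x v = 0"
      and xmin: "\<And>y. (\<And>v. \<bar>y v\<bar> \<le> K) \<Longrightarrow> (\<And>v. v \<notin> V \<Longrightarrow> y v = 0) \<Longrightarrow> F x \<le> F y"
    by auto
  define D where "D v = (\<Sum>e | e \<in> E \<and> v \<in> e. h e (sum x e)) - g v" for v
  have F_deriv: "((\<lambda>t. F (x(v := t))) has_real_derivative D v) (at (x v))" if v: "v \<in> V" for v
  proof -
    have 1: "((\<lambda>t. H e (sum (x(v := t)) e)) has_real_derivative (if v \<in> e then h e (sum x e) else 0)) (at (x v))"
      if e: "e \<in> E" for e
    proof (cases "v \<in> e")
      case True
      have eq: "sum (x(v := t)) e = t + sum x (e - {v})" for t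
        using sum.remove[OF finite_edge[OF e] True, of "x(v := t)"] by simp
      have "sum x e = x v + sum x (e - {v})"
        using eq[of "x v"] by simp
      hence "((\<lambda>t. H e (t + sum x (e - {v}))) has_real_derivative h e (sum x e) * 1) (at (x v))"
        by (intro DERIV_chain2[where f="H e"]) (auto intro!: deriv[OF e] derivative_eq_intros)
      with True show ?thesis unfolding eq by simp
    next
      case False
      hence "sum (x(v := t)) e = sum x e" for t
        by (intro sum.cong) auto
      with False show ?thesis by simp
    qed
    have 2: "((\<lambda>t. (\<Sum>u\<in>V. (x(v := t)) u * g u)) has_real_derivative g v) (at (x v))"
      unfolding sum.remove[OF finite_V v] by (auto intro!: derivative_eq_intros)
    have "((\<lambda>t. F (x(v := t))) has_real_derivative (\<Sum>e\<in>E. if v \<in> e then h e (sum x e) else 0) - g v) (at (x v))"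
      unfolding F_def by (intro DERIV_diff DERIV_sum 1 2)
    thus ?thesis by (simp add: D_def sum.inter_filter[OF finite_E])
  qed
  have min1: "F (x(v := x v)) \<le> F (x(v := t))" if "v \<in> V" "\<bar>t\<bar> \<le> K" for v t
    using that xK x0 by (auto intro!: xmin)
  have D_le: "D v \<le> 0" if v: "v \<in> V" and "x v > - K" for v
  proof (rule ccontr)
    assume "\<not> D v \<le> 0"
    then obtain d where d: "d > 0" "\<And>h. 0 < h \<Longrightarrow> h < d \<Longrightarrow> F (x(v := x v - h)) < F (x(v := x v))"
      using DERIV_pos_inc_left[OF F_deriv[OF v]] by auto
    define h where "h = min (d/2) (x v + K)"
    have h: "0 < h" "h < d" "h \<le> x v + K" using d(1) that by (auto simp: h_def)
    hence "\<bar>x v - h\<bar> \<le> K" using xK[of v] by linarith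
    from min1[OF v this] d(2)[OF h(1,2)] show False by simp
  qed
  have D_ge: "D v \<ge> 0" if v: "v \<in> V" and "x v < K" for v
  proof (rule ccontr)
    assume "\<not> D v \<ge> 0"
    then obtain d where d: "d > 0" "\<And>h. 0 < h \<Longrightarrow> h < d \<Longrightarrow> F (x(v := x v + h)) < F (x(v := x v))"
      using DERIV_neg_dec_right[OF F_deriv[OF v]] by auto
    define h where "h = min (d/2) (K - x v)"
    have h: "0 < h" "h < d" "h \<le> K - x v" using d(1) that by (auto simp: h_def)
    hence "\<bar>x v + h\<bar> \<le> K" using xK[of v] by linarith
    from min1[OF v this] d(2)[OF h(1,2)] show False by simp
  qed
  \<comment> \<open>On the face \<open>x v = K\<close> only \<open>D v \<le> 0\<close> is known, on
    \<open>x v = - K\<close> only \<open>D v \<ge> 0\<close>, and in between both hold, so the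
    product has a sign in every case. The two bounds on \<open>x\<close> use the optimality
    conditions only through this sign.\<close>
  have xD: "x v * D v \<le> 0" if v: "v \<in> V" for v
    using D_le[OF v] D_ge[OF v] K by (cases "x v > 0"; cases "x v < 0") (auto simp: mult_le_0_iff)
  have esum: "\<bar>sum x e\<bar> \<le> real s * K" if "e \<in> E" for e
    using order.trans[OF sum_abs sum_bounded_above[of e "\<lambda>v. \<bar>x v\<bar>" K]] xK edge[OF that] by auto
  define G2 X2 where "G2 = (\<Sum>v\<in>V. (g v)\<^sup>2)" and "X2 = (\<Sum>v\<in>V. (x v)\<^sup>2)"
  have X2: "X2 \<ge> 0" and G2: "G2 \<ge> 0" by (auto simp: X2_def G2_def sum_nonneg)
  \<comment> \<open>Energy estimate: the system is tested against \<open>x\<close> itself, with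
    ellipticity on one side and Cauchy-Schwarz on the other.\<close>
  have "L * X2 \<le> c0 * (\<Sum>e\<in>E. (sum x e)\<^sup>2)"
    using quadratic_form_ge[of x] c0 by (simp add: L_def X2_def mult.assoc)
  also have "\<dots> \<le> (\<Sum>e\<in>E. h e (sum x e) * sum x e)"
    by (subst sum_distrib_left) (intro sum_mono lower esum)
  also have "\<dots> = (\<Sum>v\<in>V. x v * (D v + g v))"
    by (simp add: D_def sum_incidence)
  also have "\<dots> \<le> (\<Sum>v\<in>V. x v * g v)"
    using xD by (intro sum_mono) (simp add: algebra_simps)
  finally have LX: "L * X2 \<le> (\<Sum>v\<in>V. x v * g v)" .
  have "(L * X2)\<^sup>2 \<le> (\<Sum>v\<in>V. x v * g v)\<^sup>2"
    using LX L X2 by (intro power_mono) auto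
  also have "\<dots> \<le> X2 * G2"
    unfolding X2_def G2_def by (rule Cauchy_Schwarz_ineq_sum)
  finally have "X2 * (L\<^sup>2 * X2) \<le> X2 * G2"
    by (simp add: power2_eq_square mult_ac)
  hence L2: "L\<^sup>2 * X2 \<le> G2"
    using X2 G2 by (cases "X2 = 0") (auto simp: mult_le_cancel_left)
  \<comment> \<open>Compare both growth bounds at the end point \<open>t = real s * K\<close> on
    some edge, which exists because degrees are positive.\<close>
  have c1: "c1 \<ge> c0"
  proof -
    obtain v where "v \<in> V" using N_pos N_def by fastforce
    hence "card {e\<in>E. v \<in> e} > 0" using degree_ge[of v] kappa_pos N_pos Q_pos
      by (metis le_numeral_extra(3) mult_pos_pos not_le of_nat_0 of_nat_0_less_iff order_less_le_trans)
    then obtain e where e: "e \<in> E" "v \<in> e" by (metis (no_types, lifting) card_gt_0_iff ex_in_conv mem_Collect_eq)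
    hence "s > 0" using edge[OF e(1)] finite_edge[OF e(1)] card_gt_0_iff by blast
    hence t: "real s * K > 0" using K by auto
    have "c0 * (real s * K)\<^sup>2 \<le> c1 * (real s * K)\<^sup>2"
    proof -
      have "c0 * (real s * K)\<^sup>2 \<le> h e (real s * K) * (real s * K)"
        using t by (intro lower[OF e(1)]) auto
      also have "\<dots> \<le> c1 * (real s * K) * (real s * K)"
        using t upper[OF e(1), of "real s * K"] by (intro mult_right_mono) auto
      finally show ?thesis by (simp add: power2_eq_square mult.assoc)
    qed
    moreover have "(real s * K)\<^sup>2 > 0" using t by (rule zero_less_power)
    ultimately show ?thesis by (rule mult_right_le_imp_le)
  qed
  have S1: "(\<Sum>u\<in>V. \<bar>x u\<bar>) \<le> sqrt (N * X2)"
    using Cauchy_Schwarz_ineq_sum[of "\<lambda>_. 1" "\<lambda>u. \<bar>x u\<bar>" V]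
    by (intro real_le_rsqrt) (simp add: N_def X2_def)
  have "L * sqrt (N * X2) = N * sqrt (L\<^sup>2 * X2 / N)"
    using L N_pos by (simp add: real_sqrt_mult real_sqrt_divide field_simps)
  also have "\<dots> \<le> N * sqrt (G2 / N)"
    using N_pos L2 by (intro mult_left_mono real_sqrt_le_mono divide_right_mono) auto
  finally have S2: "L * (\<Sum>u\<in>V. \<bar>x u\<bar>) \<le> N * sqrt (G2 / N)"
    using S1 L by (smt (verit, best) mult_left_mono)
  have S3: "c1 * Q * (\<Sum>u\<in>V. \<bar>x u\<bar>) \<le> c1 / (c0 * \<kappa>) * sqrt (G2 / N)"
  proof -
    have "c1 / (c0 * \<kappa>) * (L * (\<Sum>u\<in>V. \<bar>x u\<bar>)) \<le> c1 / (c0 * \<kappa>) * (N * sqrt (G2 / N))"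
      using c1 c0 kappa_pos by (intro mult_left_mono S2) auto
    thus ?thesis using c0 kappa_pos N_pos by (simp add: L_def field_simps)
  qed
  have pt: "L * \<bar>x v\<bar> \<le> \<bar>g v\<bar> + c1 / (c0 * \<kappa>) * sqrt (G2 / N)" if v: "v \<in> V" for v
  proof -
    \<comment> \<open>Secant slopes turn the nonlinear system into a linear one with weights between
      \<open>c0\<close> and \<open>c1\<close>. The default \<open>c0\<close> for
      \<open>sum x e = 0\<close> respects this range and is consistent because
      \<open>h e 0 = 0\<close>.\<close>
    define w where "w e = (if sum x e = 0 then c0 else h e (sum x e) / sum x e)" for e
    have h0: "h e 0 = 0" if "e \<in> E" for e
      using upper[OF that, of 0] K by simp
    have hw: "h e (sum x e) = w e * sum x e" if "e \<in> E" for e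
      using h0[OF that] by (auto simp: w_def)
    have w0: "c0 \<le> w e" and w1: "w e \<le> c1" if e: "e \<in> E" for e
    proof -
      show "c0 \<le> w e"
      proof (cases "sum x e = 0")
        case False
        have "c0 * (sum x e)\<^sup>2 \<le> w e * (sum x e)\<^sup>2"
          using lower[OF e esum[OF e]] unfolding hw[OF e] by (simp add: power2_eq_square mult.assoc)
        thus ?thesis using False by (simp only: mult_le_cancel_right) auto
      qed (simp add: w_def)
      show "w e \<le> c1"
      proof (cases "sum x e = 0")
        case False
        have "w e * \<bar>sum x e\<bar> \<le> \<bar>h e (sum x e)\<bar>"
          unfolding hw[OF e] abs_mult by (intro mult_right_mono) auto
        also have "\<dots> \<le> c1 * \<bar>sum x e\<bar>"
          by (rule upper[OF e esum[OF e]])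
        finally show ?thesis using False by (auto intro: mult_right_le_imp_le)
      qed (simp add: w_def c1)
    qed
    define S where "S = (\<Sum>e | e \<in> E \<and> v \<in> e. w e)"
    define T where "T = (\<Sum>u\<in>V-{v}. x u * (\<Sum>e | e \<in> E \<and> u \<in> e \<and> v \<in> e. w e))"
    have "L \<le> c0 * real (card {e\<in>E. v \<in> e})"
      using degree_ge[OF v] c0 by (simp add: L_def mult.assoc)
    also have "\<dots> \<le> S"
      using sum_mono[of "{e\<in>E. v \<in> e}" "\<lambda>_. c0" w] w0 by (simp add: S_def mult.commute)
    finally have S: "L \<le> S" .
    have "\<bar>T\<bar> \<le> (\<Sum>u\<in>V-{v}. \<bar>x u\<bar> * (c1 * Q))"
      unfolding T_def
    proof (rule order.trans[OF sum_abs], intro sum_mono)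
      fix u assume u: "u \<in> V - {v}"
      have nn: "(\<Sum>e | e \<in> E \<and> u \<in> e \<and> v \<in> e. w e) \<ge> 0"
        using w0 c0 by (intro sum_nonneg) (auto intro: order.trans[of 0 c0])
      have "(\<Sum>e | e \<in> E \<and> u \<in> e \<and> v \<in> e. w e) \<le> real (card {e\<in>E. u \<in> e \<and> v \<in> e}) * c1"
        using w1 sum_mono[of "{e\<in>E. u \<in> e \<and> v \<in> e}" w "\<lambda>_. c1"] by simp
      also have "\<dots> \<le> c1 * Q"
        using codegree_le[of u v] u v c1 c0 by (simp add: mult.commute)
      finally show "\<bar>x u * (\<Sum>e | e \<in> E \<and> u \<in> e \<and> v \<in> e. w e)\<bar> \<le> \<bar>x u\<bar> * (c1 * Q)"
        using nn by (simp add: abs_mult mult_left_mono)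
    qed
    also have "\<dots> \<le> (\<Sum>u\<in>V. \<bar>x u\<bar> * (c1 * Q))"
      using finite_V Q_pos c1 c0 by (intro sum_mono2) auto
    finally have T: "\<bar>T\<bar> \<le> c1 * Q * (\<Sum>u\<in>V. \<bar>x u\<bar>)"
      by (simp add: sum_distrib_left mult_ac)
    have "D v = S * x v + T - g v"
      using sum_link[OF v, of w x] hw by (simp add: D_def S_def T_def)
    \<comment> \<open>Multiplied by \<open>x v\<close>, the sign condition replaces the equation in
      row \<open>v\<close>; one factor \<open>\<bar>x v\<bar>\<close> is cancelled
      afterwards.\<close>
    hence "x v * (S * x v + T - g v) \<le> 0"
      using xD[OF v] by simp
    hence "S * (x v)\<^sup>2 \<le> x v * (g v - T)"
      by (simp add: algebra_simps power2_eq_square)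
    also have "\<dots> \<le> \<bar>x v\<bar> * (\<bar>g v\<bar> + \<bar>T\<bar>)"
      by (rule order.trans[OF abs_ge_self]) (simp add: abs_mult mult_left_mono abs_triangle_ineq4)
    finally have "S * \<bar>x v\<bar>\<^sup>2 \<le> \<bar>x v\<bar> * (\<bar>g v\<bar> + \<bar>T\<bar>)"
      by simp
    hence "\<bar>x v\<bar> * (S * \<bar>x v\<bar>) \<le> \<bar>x v\<bar> * (\<bar>g v\<bar> + \<bar>T\<bar>)"
      unfolding power2_eq_square by (simp only: mult_ac)
    hence "S * \<bar>x v\<bar> \<le> \<bar>g v\<bar> + \<bar>T\<bar>"
      by (cases "x v = 0") (auto simp: mult_le_cancel_left)
    moreover have "L * \<bar>x v\<bar> \<le> S * \<bar>x v\<bar>" using S by (intro mult_right_mono) auto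
    ultimately show ?thesis using T S3 by linarith
  qed
  \<comment> \<open>Since \<open>small\<close> is strict, the pointwise bound places every
    coordinate in the interior of the box, where both one-sided conditions apply.\<close>
  have "D v = 0" if v: "v \<in> V" for v
  proof -
    have "sqrt (G2 / N) \<le> \<gamma>"
      unfolding G2_def using g[OF v] by (intro root_mean_square_le g) auto
    hence "c1 / (c0 * \<kappa>) * sqrt (G2 / N) \<le> c1 / (c0 * \<kappa>) * \<gamma>"
      using c1 c0 kappa_pos by (intro mult_left_mono) auto
    with pt[OF v] g[OF v] small have "L * \<bar>x v\<bar> < L * K"
      by (simp add: L_def algebra_simps)
    hence "\<bar>x v\<bar> < K" using L by simp
    thus ?thesis using D_le[OF v] D_ge[OF v] by linarith
  qed
  thus ?thesis
    using xK x0 L2 pt unfolding D_def L_def[symmetric] X2_def G2_def by (intro exI[of _ x]) auto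
qed


text \<open>
  With \<open>\<Sigma>\<close> the Hessian, \<open>y\<close> is \<open>\<Sigma>\<close> inverse applied to the off-diagonal part of column \<open>v\<close>.  Testing
  the score equations against \<open>y\<close> turns the cross terms \<open>\<Sum>u\<noteq>v. \<Sigma> u v * x u\<close> into \<open>\<Sum>u. y u * g u\<close>,
  whose variance is of lower order; bounding the cross terms by the Euclidean norm of \<open>x\<close> would only
  give the order of \<open>g v\<close> itself.
\<close>

lemma link_solution:
  assumes c0: "0 < c0" and w: "\<And>e. e \<in> E \<Longrightarrow> c0 \<le> w e" "\<And>e. e \<in> E \<Longrightarrow> w e \<le> c1"
    and v: "v \<in> V"
  shows "\<exists>y. (\<forall>u\<in>V. (\<Sum>e | e \<in> E \<and> u \<in> e. w e * sum y e) =
               (if u = v then 0 else \<Sum>e | e \<in> E \<and> u \<in> e \<and> v \<in> e. w e)) \<and>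
             (\<forall>u\<in>V. \<bar>y u\<bar> \<le> c1 * (1 + c1 / (c0 * \<kappa>)) / (c0 * \<kappa>) / N)"
proof -
  define b where "b u = (if u = v then 0 else \<Sum>e | e \<in> E \<and> u \<in> e \<and> v \<in> e. w e)" for u
  have "{e\<in>E. v \<in> e} \<noteq> {}"
    using degree_ge[OF v] kappa_pos N_pos Q_pos mult_pos_pos[OF mult_pos_pos[OF kappa_pos N_pos] Q_pos] by force
  then obtain e where "e \<in> E" by auto
  hence c1: "c0 \<le> c1" "c1 > 0" using w[of e] c0 by auto
  have b: "\<bar>b u\<bar> \<le> c1 * Q" if u: "u \<in> V" for u
  proof (cases "u = v")
    case True
    thus ?thesis using c1 Q_pos by (simp add: b_def)
  next
    case False
    have nn: "(\<Sum>e | e \<in> E \<and> u \<in> e \<and> v \<in> e. w e) \<ge> 0"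
      using w c0 by (intro sum_nonneg) (auto intro: order.trans[of 0 c0])
    have "(\<Sum>e | e \<in> E \<and> u \<in> e \<and> v \<in> e. w e) \<le> real (card {e\<in>E. u \<in> e \<and> v \<in> e}) * c1"
      using w sum_mono[of "{e\<in>E. u \<in> e \<and> v \<in> e}" w "\<lambda>_. c1"] by simp
    also have "\<dots> \<le> c1 * Q"
      using codegree_le[OF u v False] c1 by (simp add: mult.commute)
    finally show ?thesis using False nn by (simp add: b_def)
  qed
  define L where "L = c0 * \<kappa> * N * Q"
  have L: "L > 0" using c0 kappa_pos N_pos Q_pos by (simp add: L_def)
  define \<gamma> where "\<gamma> = c1 * Q"
  \<comment> \<open>The system is linear, so the box may be as large as desired: this half-width
    meets the smallness condition of \<open>solve_edge_system\<close>, and the \<open>+ 1\<close>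
    makes it strict.\<close>
  define K where "K = \<gamma> * (1 + c1 / (c0 * \<kappa>)) / L + 1"
  have \<gamma>: "\<gamma> > 0" using c1 Q_pos by (simp add: \<gamma>_def)
  have K: "K > 0" using \<gamma> L c0 c1 kappa_pos unfolding K_def by (intro add_nonneg_pos) auto
  have "\<exists>y. (\<forall>v. v \<notin> V \<longrightarrow> y v = 0) \<and> (\<forall>v. \<bar>y v\<bar> \<le> K) \<and>
     (\<forall>u\<in>V. (\<Sum>e | e \<in> E \<and> u \<in> e. w e * sum y e) = b u) \<and>
     (c0 * \<kappa> * N * Q)\<^sup>2 * (\<Sum>v\<in>V. (y v)\<^sup>2) \<le> (\<Sum>v\<in>V. (b v)\<^sup>2) \<and>
     (\<forall>v\<in>V. c0 * \<kappa> * N * Q * \<bar>y v\<bar> \<le> \<bar>b v\<bar> + c1 / (c0 * \<kappa>) * sqrt ((\<Sum>v\<in>V. (b v)\<^sup>2) / N))"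
  proof (rule solve_edge_system[where h="\<lambda>e t. w e * t" and H="\<lambda>e t. w e * t\<^sup>2 / 2" and \<gamma>=\<gamma>])
    show "((\<lambda>t. w e * t\<^sup>2 / 2) has_real_derivative w e * t) (at t)" for e t
      by (auto intro!: derivative_eq_intros)
    show "c0 * t\<^sup>2 \<le> w e * t * t" if "e \<in> E" for e t
      using mult_right_mono[OF w(1)[OF that], of "t\<^sup>2"] by (simp add: power2_eq_square mult.assoc)
    show "\<bar>w e * t\<bar> \<le> c1 * \<bar>t\<bar>" if "e \<in> E" for e t
      using w[OF that] c0 by (simp add: abs_mult mult_right_mono)
    show "\<gamma> * (1 + c1 / (c0 * \<kappa>)) < c0 * \<kappa> * N * Q * K"
    proof -
      have "L * K = \<gamma> * (1 + c1 / (c0 * \<kappa>)) + L" using L unfolding K_def distrib_left[of L] by (simp only: times_divide_eq_right nonzero_mult_div_cancel_left)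
      thus ?thesis using L unfolding L_def[symmetric] by linarith
    qed
  qed (use c0 K b in \<open>auto simp: \<gamma>_def\<close>)
  then obtain y where y: "\<forall>u\<in>V. (\<Sum>e | e \<in> E \<and> u \<in> e. w e * sum y e) = b u"
    "\<forall>v\<in>V. L * \<bar>y v\<bar> \<le> \<bar>b v\<bar> + c1 / (c0 * \<kappa>) * sqrt ((\<Sum>v\<in>V. (b v)\<^sup>2) / N)"
    unfolding L_def by blast
  \<comment> \<open>The right-hand side has the size of a codegree and \<open>L\<close> that of a
    degree, so \<open>Q\<close> cancels and a factor \<open>1 / N\<close> remains.\<close>
  have "\<bar>y u\<bar> \<le> c1 * (1 + c1 / (c0 * \<kappa>)) / (c0 * \<kappa>) / N" if u: "u \<in> V" for u
  proof -
    have "sqrt ((\<Sum>v\<in>V. (b v)\<^sup>2) / N) \<le> \<gamma>"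
      using b \<gamma> by (intro root_mean_square_le) (auto simp: \<gamma>_def)
    hence "c1 / (c0 * \<kappa>) * sqrt ((\<Sum>v\<in>V. (b v)\<^sup>2) / N) \<le> c1 / (c0 * \<kappa>) * \<gamma>"
      using c0 c1 kappa_pos by (intro mult_left_mono) auto
    hence "L * \<bar>y u\<bar> \<le> \<gamma> + c1 / (c0 * \<kappa>) * \<gamma>"
      using y(2) b[OF u] u by (fastforce simp: \<gamma>_def)
    hence "\<bar>y u\<bar> \<le> (\<gamma> + c1 / (c0 * \<kappa>) * \<gamma>) / L"
      using L by (simp add: pos_le_divide_eq mult.commute)
    also have "\<dots> = c1 * (1 + c1 / (c0 * \<kappa>)) / (c0 * \<kappa>) / N"
      using c0 kappa_pos N_pos Q_pos by (simp add: L_def \<gamma>_def field_simps)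
    finally show ?thesis .
  qed
  thus ?thesis using y(1) unfolding b_def by blast
qed

text \<open>By symmetry of the weighted matrix the cross terms of row \<open>v\<close> equal the
  pairing of \<open>y\<close> with the residual \<open>g - R\<close>. The part with \<open>g\<close>
  is kept, to be treated in mean square. The part with \<open>R\<close>, and \<open>R v\<close>
  itself, are quadratic in \<open>x\<close> and are absorbed by the two bounds on
  \<open>x\<close>.\<close>

lemma edge_system_expansion:
  assumes l: "l > 0" and c1: "c1 > 0" and \<eta>: "\<eta> \<ge> 0" and v: "v \<in> V"
    and y: "\<And>u. u \<in> V \<Longrightarrow> (\<Sum>e | e \<in> E \<and> u \<in> e. w e * sum y e) =
               (if u = v then 0 else \<Sum>e | e \<in> E \<and> u \<in> e \<and> v \<in> e. w e)"
    and y_le: "\<And>u. u \<in> V \<Longrightarrow> \<bar>y u\<bar> \<le> \<eta> / N"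
    and h: "\<And>e. e \<in> E \<Longrightarrow> \<bar>h e (sum x e) - w e * sum x e\<bar> \<le> (sum x e)\<^sup>2"
    and x: "\<And>u. u \<in> V \<Longrightarrow> (\<Sum>e | e \<in> E \<and> u \<in> e. h e (sum x e)) = g u"
    and x2: "(l * N * Q)\<^sup>2 * (\<Sum>u\<in>V. (x u)\<^sup>2) \<le> (\<Sum>u\<in>V. (g u)\<^sup>2)"
    and xv: "l * N * Q * \<bar>x v\<bar> \<le> \<bar>g v\<bar> + c1 / l * sqrt ((\<Sum>u\<in>V. (g u)\<^sup>2) / N)"
  shows "\<bar>(\<Sum>e | e \<in> E \<and> v \<in> e. w e) * x v - g v\<bar> \<le> \<bar>\<Sum>u\<in>V. y u * g u\<bar> +
           expansion_constant s l c1 \<eta> * ((g v)\<^sup>2 / (N * Q) + (\<Sum>u\<in>V. (g u)\<^sup>2) / (N\<^sup>2 * Q))"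
proof -
  define G2 X2 where "G2 = (\<Sum>u\<in>V. (g u)\<^sup>2)" and "X2 = (\<Sum>u\<in>V. (x u)\<^sup>2)"
  have X2: "X2 \<ge> 0" and G2: "G2 \<ge> 0" by (auto simp: X2_def G2_def sum_nonneg)
  define R where "R u = (\<Sum>e | e \<in> E \<and> u \<in> e. h e (sum x e) - w e * sum x e)" for u
  have R: "\<bar>R u\<bar> \<le> (\<Sum>e | e \<in> E \<and> u \<in> e. (sum x e)\<^sup>2)" for u
    unfolding R_def using h by (intro order.trans[OF sum_abs] sum_mono) auto
  have gR: "(\<Sum>e | e \<in> E \<and> u \<in> e. w e * sum x e) = g u - R u" if "u \<in> V" for u
    using x[OF that] by (simp add: R_def sum_subtractf)
  define B where "B u = (if u = v then 0 else \<Sum>e | e \<in> E \<and> u \<in> e \<and> v \<in> e. w e)" for u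
  have "(\<Sum>u\<in>V-{v}. x u * (\<Sum>e | e \<in> E \<and> u \<in> e \<and> v \<in> e. w e)) = (\<Sum>u\<in>V. x u * B u)"
    unfolding sum.remove[OF finite_V v] by (simp add: B_def)
  also have "\<dots> = (\<Sum>u\<in>V. x u * (\<Sum>e | e \<in> E \<and> u \<in> e. w e * sum y e))"
    using y by (simp add: B_def)
  also have "\<dots> = (\<Sum>e\<in>E. (w e * sum x e) * sum y e)"
    by (simp add: sum_incidence mult_ac)
  also have "\<dots> = (\<Sum>u\<in>V. y u * (g u - R u))"
    by (subst sum_incidence[symmetric]) (simp add: gR)
  finally have cross: "(\<Sum>u\<in>V-{v}. x u * (\<Sum>e | e \<in> E \<and> u \<in> e \<and> v \<in> e. w e)) =
      (\<Sum>u\<in>V. y u * g u) - (\<Sum>u\<in>V. y u * R u)"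
    by (simp add: algebra_simps sum_subtractf)
  \<comment> \<open>Every \<open>y u\<close> gains a factor \<open>1 / N\<close>, while the
    remainders of all vertices together form a sum over all edges, of order
    \<open>N * Q * X2\<close>.\<close>
  have "\<bar>\<Sum>u\<in>V. y u * R u\<bar> \<le> (\<Sum>u\<in>V. \<eta> / N * (\<Sum>e | e \<in> E \<and> u \<in> e. (sum x e)\<^sup>2))"
    using R y_le \<eta> N_pos
    by (intro order.trans[OF sum_abs] sum_mono) (unfold abs_mult, intro mult_mono, auto)
  also have "\<dots> = (\<Sum>e\<in>E. (sum x e)\<^sup>2 * sum (\<lambda>_. \<eta> / N) e)"
    by (rule sum_incidence)
  also have "\<dots> = \<eta> * real s / N * (\<Sum>e\<in>E. (sum x e)\<^sup>2)"
    using edge by (simp add: sum_distrib_left mult_ac)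
  also have "\<dots> \<le> \<eta> * real s / N * (real s * N * Q * X2)"
    using sum_edge_squares_le[of x] \<eta> N_pos unfolding X2_def by (intro mult_left_mono) auto
  also have "\<dots> = \<eta> * (real s)\<^sup>2 * (Q * X2)"
    using N_pos by (simp add: power2_eq_square field_simps)
  finally have yR: "\<bar>\<Sum>u\<in>V. y u * R u\<bar> \<le> \<eta> * (real s)\<^sup>2 * (Q * X2)" .
  have Rv: "\<bar>R v\<bar> \<le> real s * (N * Q * (x v)\<^sup>2) + real s * (Q * X2)"
    using R[of v] sum_link_squares_le[OF v, of x] unfolding X2_def by (simp add: distrib_left)
  have QX: "Q * X2 \<le> G2 / (N\<^sup>2 * Q) / l\<^sup>2"
    using x2[folded X2_def G2_def] l N_pos Q_pos by (simp add: field_simps power2_eq_square)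
  \<comment> \<open>Squaring the pointwise bound by
    \<open>(a + b)\<^sup>2 \<le> 2 * a\<^sup>2 + 2 * b\<^sup>2\<close> is the origin of the factors
    2 in \<open>expansion_constant\<close>.\<close>
  have "(l * N * Q * \<bar>x v\<bar>)\<^sup>2 \<le> (\<bar>g v\<bar> + c1 / l * sqrt (G2 / N))\<^sup>2"
    using xv l N_pos Q_pos unfolding G2_def by (intro power_mono) auto
  also have "\<dots> \<le> 2 * \<bar>g v\<bar>\<^sup>2 + 2 * (c1 / l * sqrt (G2 / N))\<^sup>2"
    using sum_squares_bound[of "\<bar>g v\<bar>" "c1 / l * sqrt (G2 / N)"] by (simp add: power2_sum)
  also have "\<dots> = 2 * (g v)\<^sup>2 + 2 * c1\<^sup>2 / l\<^sup>2 * (G2 / N)"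
    using G2 N_pos by (simp add: power_mult_distrib power_divide mult_ac)
  finally have "(l * N * Q)\<^sup>2 * (x v)\<^sup>2 \<le> 2 * (g v)\<^sup>2 + 2 * c1\<^sup>2 / l\<^sup>2 * (G2 / N)"
    by (simp add: power_mult_distrib)
  hence "(N * Q * (x v)\<^sup>2) * (l\<^sup>2 * N * Q) \<le> 2 * (g v)\<^sup>2 + 2 * c1\<^sup>2 / l\<^sup>2 * (G2 / N)"
    by (simp add: power_mult_distrib power2_eq_square mult_ac)
  hence "N * Q * (x v)\<^sup>2 \<le> (2 * (g v)\<^sup>2 + 2 * c1\<^sup>2 / l\<^sup>2 * (G2 / N)) / (l\<^sup>2 * N * Q)"
    using l N_pos Q_pos by (subst pos_le_divide_eq) auto
  also have "\<dots> = 2 / l\<^sup>2 * ((g v)\<^sup>2 / (N * Q)) + 2 * c1\<^sup>2 / l^4 * (G2 / (N\<^sup>2 * Q))"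
    using l N_pos Q_pos by (simp add: field_simps power2_eq_square power4_eq_xxxx)
  finally have NQx: "N * Q * (x v)\<^sup>2 \<le> 2 / l\<^sup>2 * ((g v)\<^sup>2 / (N * Q)) + 2 * c1\<^sup>2 / l^4 * (G2 / (N\<^sup>2 * Q))" .
  define p q where "p = (g v)\<^sup>2 / (N * Q)" and "q = G2 / (N\<^sup>2 * Q)"
  have p: "p \<ge> 0" and q: "q \<ge> 0" using G2 N_pos Q_pos by (auto simp: p_def q_def)
  have "(\<Sum>e | e \<in> E \<and> v \<in> e. w e) * x v - g v = - R v - (\<Sum>u\<in>V. y u * g u) + (\<Sum>u\<in>V. y u * R u)"
    using sum_link[OF v, of w x] gR[OF v] cross by simp
  hence "\<bar>(\<Sum>e | e \<in> E \<and> v \<in> e. w e) * x v - g v\<bar> \<le>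
      \<bar>\<Sum>u\<in>V. y u * g u\<bar> + \<bar>R v\<bar> + \<bar>\<Sum>u\<in>V. y u * R u\<bar>" by linarith
  also have "\<dots> \<le> \<bar>\<Sum>u\<in>V. y u * g u\<bar> + (real s * (N * Q * (x v)\<^sup>2) + (real s + \<eta> * (real s)\<^sup>2) * (Q * X2))"
    using Rv yR by (simp add: algebra_simps)
  also have "\<dots> \<le> \<bar>\<Sum>u\<in>V. y u * g u\<bar> + (real s * (2 / l\<^sup>2 * p + 2 * c1\<^sup>2 / l^4 * q) +
      (real s + \<eta> * (real s)\<^sup>2) * (q / l\<^sup>2))"
    using NQx QX \<eta> unfolding p_def q_def by (intro add_left_mono add_mono mult_left_mono) auto
  also have "\<dots> \<le> \<bar>\<Sum>u\<in>V. y u * g u\<bar> + expansion_constant s l c1 \<eta> * (p + q)"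
  proof -
    define a b c where "a = 2 / l\<^sup>2" and "b = 2 * c1\<^sup>2 / l^4" and "c = (real s + \<eta> * (real s)\<^sup>2) / l\<^sup>2"
    have "0 \<le> (real s * b + c) * p + real s * a * q"
      using p q \<eta> l unfolding a_def b_def c_def by (intro add_nonneg_nonneg mult_nonneg_nonneg) auto
    hence "real s * (a * p + b * q) + c * q \<le> (real s * a + real s * b + c) * (p + q)"
      by (simp add: algebra_simps)
    thus ?thesis by (simp add: expansion_constant_def a_def b_def c_def)
  qed
  finally show ?thesis by (simp add: p_def q_def G2_def)
qed

end

section \<open>Complete uniform hypergraphs and the likelihood\<close>

lemma card_supersets_of_size:
  assumes "finite V" and "U \<subseteq> V" and "card U \<le> s"
  shows "card {e. e \<subseteq> V \<and> card e = s \<and> U \<subseteq> e} = (card V - card U) choose (s - card U)"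
proof -
  have finU: "finite U" using assms finite_subset by blast
  have fin: "finite e" if "e \<subseteq> V" for e using that assms(1) finite_subset by blast
  have "bij_betw (\<lambda>e. e \<union> U) {e. e \<subseteq> V - U \<and> card e = s - card U} {e. e \<subseteq> V \<and> card e = s \<and> U \<subseteq> e}"
  proof (rule bij_betw_byWitness[where f'="\<lambda>e. e - U"])
    show "(\<lambda>e. e \<union> U) ` {e. e \<subseteq> V - U \<and> card e = s - card U} \<subseteq> {e. e \<subseteq> V \<and> card e = s \<and> U \<subseteq> e}"
    proof safe
      fix e assume e: "e \<subseteq> V - U" "card e = s - card U"
      hence "card (e \<union> U) = card e + card U"
        using fin[of e] finU by (intro card_Un_disjoint) auto
      thus "card (e \<union> U) = s" using e assms(3) by simp
    qed (use assms(2) in auto)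
    show "(\<lambda>e. e - U) ` {e. e \<subseteq> V \<and> card e = s \<and> U \<subseteq> e} \<subseteq> {e. e \<subseteq> V - U \<and> card e = s - card U}"
      using finU by (auto simp: card_Diff_subset)
  qed auto
  hence "card {e. e \<subseteq> V \<and> card e = s \<and> U \<subseteq> e} = card {e. e \<subseteq> V - U \<and> card e = s - card U}"
    by (simp add: bij_betw_same_card)
  also have "\<dots> = card (V - U) choose (s - card U)"
    using assms(1) by (intro n_subsets) auto
  also have "card (V - U) = card V - card U"
    using assms(2) finU by (rule card_Diff_subset[rotated])
  finally show ?thesis .
qed

lemma card_hyperedges_containing:
  assumes "U \<subseteq> {1..n}" and "card U \<le> s"
  shows "card {e\<in>hyperedges n s. U \<subseteq> e} = (n - card U) choose (s - card U)"
  using card_supersets_of_size[of "{1..n}" U s] assms by (simp add: hyperedges_def conj_assoc)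

lemma finite_hyperedges: "finite (hyperedges n s)"
  by (rule finite_subset[of _ "Pow {1..n}"]) (auto simp: hyperedges_def)

text \<open>The Gram matrix of the incidence vectors has one value on the diagonal and one off it,
  so it is a multiple of the identity plus a nonnegative multiple of the all-ones matrix; Pascal's
  rule evaluates the difference of the two values. Positivity comes from this structure: the
  off-diagonal entries of a row add up to \<open>s - 1\<close> times the diagonal entry.\<close>

lemma hyperedges_quadratic_form:
  fixes x :: "nat \<Rightarrow> real"
  assumes n: "n \<ge> 2" and s: "s \<ge> 2"
  shows "(\<Sum>e\<in>hyperedges n s. (sum x e)\<^sup>2) =
    real ((n - 2) choose (s - 1)) * (\<Sum>v=1..n. (x v)\<^sup>2) + real ((n - 2) choose (s - 2)) * (\<Sum>v=1..n. x v)\<^sup>2"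
proof -
  let ?V = "{1..n}" and ?E = "hyperedges n s"
  define N1 N2 where "N1 = real ((n - 1) choose (s - 1))" and "N2 = real ((n - 2) choose (s - 2))"
  have c: "real (card {e\<in>?E. u \<in> e \<and> v \<in> e}) = N2 + (if u = v then N1 - N2 else 0)"
    if "u \<in> ?V" "v \<in> ?V" for u v
  proof (cases "u = v")
    case True
    thus ?thesis using card_hyperedges_containing[of "{v}" n s] that s by (simp add: N1_def)
  next
    case False
    thus ?thesis using card_hyperedges_containing[of "{u,v}" n s] that s by (simp add: N2_def numeral_2_eq_2)
  qed
  have "(\<Sum>e\<in>?E. (sum x e)\<^sup>2) = (\<Sum>e\<in>?E. \<Sum>u\<in>?V. \<Sum>v\<in>?V. if u \<in> e \<and> v \<in> e then x u * x v else 0)"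
  proof (intro sum.cong refl)
    fix e assume "e \<in> ?E"
    hence e: "e \<subseteq> ?V" by (simp add: hyperedges_def)
    have *: "sum x e = (\<Sum>u\<in>?V. if u \<in> e then x u else 0)"
      using e by (simp add: sum.inter_restrict[symmetric] Int_absorb1)
    show "(sum x e)\<^sup>2 = (\<Sum>u\<in>?V. \<Sum>v\<in>?V. if u \<in> e \<and> v \<in> e then x u * x v else 0)"
      unfolding * power2_eq_square sum_product by (intro sum.cong refl) auto
  qed
  also have "\<dots> = (\<Sum>u\<in>?V. \<Sum>v\<in>?V. \<Sum>e\<in>?E. if u \<in> e \<and> v \<in> e then x u * x v else 0)"
    by (subst sum.swap) (intro sum.cong refl sum.swap)
  also have "\<dots> = (\<Sum>u\<in>?V. \<Sum>v\<in>?V. x u * x v * real (card {e\<in>?E. u \<in> e \<and> v \<in> e}))"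
    by (intro sum.cong refl) (simp add: sum.inter_filter[OF finite_hyperedges, symmetric])
  also have "\<dots> = (\<Sum>u\<in>?V. \<Sum>v\<in>?V. N2 * (x u * x v) + (if u = v then (N1 - N2) * (x v)\<^sup>2 else 0))"
    by (intro sum.cong refl) (auto simp: c power2_eq_square algebra_simps)
  also have "\<dots> = N2 * (\<Sum>v=1..n. x v)\<^sup>2 + (N1 - N2) * (\<Sum>v=1..n. (x v)\<^sup>2)"
    by (simp add: sum.distrib power2_eq_square[of "sum x _"] sum_product sum_distrib_left[symmetric])
  also have "N1 - N2 = real ((n - 2) choose (s - 1))"
  proof -
    obtain n' s' where "n = Suc (Suc n')" "s = Suc (Suc s')"
      using n s by (metis add_2_eq_Suc le_Suc_ex)
    thus ?thesis by (simp add: N1_def N2_def)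
  qed
  finally show ?thesis by (simp add: N2_def)
qed

text \<open>Comes from bounding the binomial coefficient \<open>(n - 2) choose (s - 1)\<close> below
  by the power \<open>((n - 2) / (s - 1)) ^ (s - 1)\<close> and from
  \<open>n - 2 \<ge> n / 2\<close>, valid for \<open>n \<ge> 4\<close>.\<close>

definition balance_constant :: "nat \<Rightarrow> real" where
  "balance_constant s = (1 / (2 * real (s - 1))) ^ (s - 1)"

lemma balance_constant_pos: "s \<ge> 2 \<Longrightarrow> balance_constant s > 0"
  by (simp add: balance_constant_def)

lemma binomial_le_power: "n choose k \<le> n ^ k"
  by (cases "k \<le> n") (auto intro: binomial_le_pow simp: binomial_eq_0)

lemma balanced_hyperedges:
  assumes s: "s \<ge> 2" and n: "n \<ge> s + 2"
  shows "balanced_hypergraph {1..n} (hyperedges n s) s (real n) (real n ^ (s - 2)) (balance_constant s)"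
proof
  have pow: "real n * real n ^ (s - 2) = real n ^ (s - 1)"
    using s by (simp flip: power_Suc add: Suc_diff_le[symmetric] Suc_diff_Suc numeral_2_eq_2)
  show "real (card {e\<in>hyperedges n s. v \<in> e}) \<le> real n * real n ^ (s - 2)" if "v \<in> {1..n}" for v
  proof -
    have "card {e\<in>hyperedges n s. v \<in> e} = (n - 1) choose (s - 1)"
      using card_hyperedges_containing[of "{v}" n s] that s by simp
    also have "\<dots> \<le> (n - 1) ^ (s - 1)" by (rule binomial_le_power)
    also have "\<dots> \<le> n ^ (s - 1)" by (rule power_mono) auto
    finally show ?thesis unfolding pow by (simp flip: of_nat_power)
  qed
  show "real (card {e\<in>hyperedges n s. u \<in> e \<and> v \<in> e}) \<le> real n ^ (s - 2)"
    if "u \<in> {1..n}" "v \<in> {1..n}" "u \<noteq> v" for u v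
  proof -
    have "card {e\<in>hyperedges n s. u \<in> e \<and> v \<in> e} = (n - 2) choose (s - 2)"
      using card_hyperedges_containing[of "{u, v}" n s] that s by (simp add: numeral_2_eq_2)
    also have "\<dots> \<le> (n - 2) ^ (s - 2)" by (rule binomial_le_power)
    also have "\<dots> \<le> n ^ (s - 2)" by (rule power_mono) auto
    finally show ?thesis by (simp flip: of_nat_power)
  qed
  show "balance_constant s * real n * real n ^ (s - 2) * (\<Sum>v\<in>{1..n}. (x v)\<^sup>2) \<le> (\<Sum>e\<in>hyperedges n s. (sum x e)\<^sup>2)" for x
  proof -
    have "balance_constant s * real n * real n ^ (s - 2) = (real n / (2 * real (s - 1))) ^ (s - 1)"
      by (simp add: balance_constant_def mult.assoc pow power_divide)
    also have "\<dots> \<le> (real (n - 2) / real (s - 1)) ^ (s - 1)"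
    proof (rule power_mono)
      have "real n / 2 \<le> real (n - 2)" using n s by linarith
      from divide_right_mono[OF this, of "real (s - 1)"]
      show "real n / (2 * real (s - 1)) \<le> real (n - 2) / real (s - 1)" by simp
    qed simp
    also have "\<dots> \<le> real ((n - 2) choose (s - 1))"
      using n by (intro binomial_ge_n_over_k_pow_k) auto
    finally have *: "balance_constant s * real n * real n ^ (s - 2) \<le> real ((n - 2) choose (s - 1))" .
    have "balance_constant s * real n * real n ^ (s - 2) * (\<Sum>v\<in>{1..n}. (x v)\<^sup>2)
        \<le> real ((n - 2) choose (s - 1)) * (\<Sum>v\<in>{1..n}. (x v)\<^sup>2)"
      by (intro mult_right_mono * sum_nonneg) auto
    also have "\<dots> \<le> (\<Sum>e\<in>hyperedges n s. (sum x e)\<^sup>2)"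
      using hyperedges_quadratic_form[of n s x] n s by simp
    finally show ?thesis .
  qed
qed (use n s balance_constant_pos[OF s] in \<open>auto simp: hyperedges_def\<close>)

section \<open>Analysis of the logistic function\<close>

definition logistic :: "real \<Rightarrow> real" where
  "logistic t = exp t / (1 + exp t)"

definition logistic_deriv :: "real \<Rightarrow> real" where
  "logistic_deriv t = logistic t * (1 - logistic t)"

lemma logistic_pos: "logistic t > 0" and logistic_less_1: "logistic t < 1"
  by (auto simp: logistic_def add_pos_pos divide_less_eq)

lemma logistic_deriv_eq: "logistic_deriv t = exp t / (1 + exp t)\<^sup>2"
proof -
  have "1 + exp t \<noteq> 0" using exp_gt_zero[of t] by linarith
  thus ?thesis by (simp add: logistic_deriv_def logistic_def field_simps power2_eq_square)
qed

lemma has_real_derivative_softplus: "((\<lambda>t. ln (1 + exp t)) has_real_derivative logistic t) (at t)"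
  using exp_gt_zero[of t] by (auto intro!: derivative_eq_intros simp: logistic_def add_pos_pos)

lemma has_real_derivative_logistic: "(logistic has_real_derivative logistic_deriv t) (at t)"
proof -
  have "1 + exp t \<noteq> 0" using exp_gt_zero[of t] by linarith
  thus ?thesis
    unfolding logistic_def[abs_def] logistic_deriv_eq
    by (auto intro!: derivative_eq_intros simp: field_simps power2_eq_square)
qed

lemma has_real_derivative_logistic_deriv:
  "(logistic_deriv has_real_derivative logistic_deriv t * (1 - 2 * logistic t)) (at t)"
  unfolding logistic_deriv_def[abs_def]
  by (auto intro!: derivative_eq_intros has_real_derivative_logistic simp: logistic_deriv_def algebra_simps)

lemma logistic_deriv_pos: "logistic_deriv t > 0"
  using logistic_pos logistic_less_1 by (simp add: logistic_deriv_def)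

lemma logistic_deriv_le_1: "logistic_deriv t \<le> 1"
  using logistic_pos[of t] logistic_less_1[of t] mult_mono[of "logistic t" 1 "1 - logistic t" 1]
  by (simp add: logistic_deriv_def)

text \<open>The symmetric form \<open>1 / ((1 + exp t) * (1 + exp (- t)))\<close> handles both signs
  of \<open>t\<close> at once: its denominator is at most \<open>4 * exp c\<close>.\<close>

lemma logistic_deriv_ge: 
  assumes "\<bar>t\<bar> \<le> c"
  shows "exp (- c) / 4 \<le> logistic_deriv t"
proof -
  have "1 + exp t \<noteq> 0" using exp_gt_zero[of t] by linarith
  have "logistic_deriv t = 1 / ((1 + exp t) * (1 + exp (- t)))"
  proof -
    have "exp t * (1 + exp (- t)) = 1 + exp t" by (simp add: distrib_left flip: exp_add)
    hence "(1 + exp t)\<^sup>2 = exp t * ((1 + exp t) * (1 + exp (- t)))"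
      by (simp add: power2_eq_square mult_ac)
    thus ?thesis by (simp add: logistic_deriv_eq)
  qed
  moreover have "(1 + exp t) * (1 + exp (- t)) \<le> 4 * exp c"
  proof -
    have "(1 + exp t) * (1 + exp (- t)) = 2 + exp t + exp (- t)"
      by (simp add: algebra_simps flip: exp_add)
    also have "\<dots> \<le> 2 * exp c + exp c + exp c"
      using assms by (intro add_mono) auto
    finally show ?thesis by simp
  qed
  moreover have "(1 + exp t) * (1 + exp (- t)) > 0"
    by (intro mult_pos_pos add_pos_pos) auto
  ultimately have "1 / (4 * exp c) \<le> logistic_deriv t"
    by (simp add: frac_le)
  thus ?thesis by (simp add: exp_minus field_simps)
qed

text \<open>One mean-value form for both signs of \<open>t\<close>. As the intermediate point stays
  within \<open>\<bar>t\<bar>\<close> of \<open>b\<close>, bounds for the derivative near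
  \<open>b\<close> become bounds for secant slopes.\<close>

lemma logistic_increment:
  obtains \<xi> where "logistic (b + t) - logistic b = logistic_deriv \<xi> * t" and "\<bar>\<xi> - b\<bar> \<le> \<bar>t\<bar>"
proof (cases "t = 0")
  case True
  thus ?thesis using that[of b] by simp
next
  case False
  then obtain \<xi> where "min b (b+t) < \<xi>" "\<xi> < max b (b+t)"
    and *: "logistic (max b (b+t)) - logistic (min b (b+t)) = (max b (b+t) - min b (b+t)) * logistic_deriv \<xi>"
    using MVT2[of "min b (b+t)" "max b (b+t)" logistic logistic_deriv, OF _ has_real_derivative_logistic]
    by (meson add_cancel_left_right less_max_iff_disj min_less_iff_disj linorder_neqE_linordered_idom)
  show ?thesis
  proof (rule that)
    show "logistic (b + t) - logistic b = logistic_deriv \<xi> * t"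
      using * by (auto simp: min_def max_def algebra_simps split: if_splits)
    show "\<bar>\<xi> - b\<bar> \<le> \<bar>t\<bar>"
      using \<open>min b (b+t) < \<xi>\<close> \<open>\<xi> < max b (b+t)\<close> by linarith
  qed
qed

lemma logistic_deriv_lipschitz: "\<bar>logistic_deriv x - logistic_deriv y\<bar> \<le> \<bar>x - y\<bar>"
proof -
  have "norm (logistic_deriv x - logistic_deriv y) \<le> 1 * norm (x - y)"
  proof (rule field_differentiable_bound[where S=UNIV])
    fix z :: real
    have "\<bar>logistic_deriv z\<bar> * \<bar>1 - 2 * logistic z\<bar> \<le> 1 * 1"
      using logistic_deriv_pos[of z] logistic_deriv_le_1[of z] logistic_pos[of z] logistic_less_1[of z]
      by (intro mult_mono) auto
    thus "norm (logistic_deriv z * (1 - 2 * logistic z)) \<le> 1" by (simp add: abs_mult)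
  qed (auto intro: has_real_derivative_logistic_deriv)
  thus ?thesis by simp
qed

text \<open>Mean value theorem together with the Lipschitz bound for the derivative. The constant 1
  is uniform in \<open>b\<close>; this is the quadratic remainder fed into
  \<open>edge_system_expansion\<close>.\<close>

lemma logistic_taylor: "\<bar>logistic (b + t) - logistic b - logistic_deriv b * t\<bar> \<le> t\<^sup>2"
proof -
  obtain \<xi> where \<xi>: "logistic (b + t) - logistic b = logistic_deriv \<xi> * t" "\<bar>\<xi> - b\<bar> \<le> \<bar>t\<bar>"
    by (rule logistic_increment)
  have "\<bar>logistic (b + t) - logistic b - logistic_deriv b * t\<bar> = \<bar>logistic_deriv \<xi> - logistic_deriv b\<bar> * \<bar>t\<bar>"
    unfolding \<xi>(1) by (simp add: algebra_simps flip: abs_mult)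
  also have "\<dots> \<le> \<bar>t\<bar> * \<bar>t\<bar>"
    using logistic_deriv_lipschitz[of \<xi> b] \<xi>(2) by (intro mult_right_mono) auto
  finally show ?thesis by (simp add: power2_eq_square)
qed

lemma logistic_strict_mono: "x < y \<Longrightarrow> logistic x < logistic y"
  using DERIV_pos_imp_increasing[of x y logistic] has_real_derivative_logistic logistic_deriv_pos by blast

lemma softplus_above_tangent:
  "ln (1 + exp a) + logistic a * (b - a) \<le> ln (1 + exp b)"
  "a \<noteq> b \<Longrightarrow> ln (1 + exp a) + logistic a * (b - a) < ln (1 + exp b)"
proof -
  show *: "ln (1 + exp a) + logistic a * (b - a) < ln (1 + exp b)" if "a \<noteq> b" for a b :: real
  proof (cases "a < b")
    case True
    from MVT2[OF True has_real_derivative_softplus] obtain \<xi> where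
      "a < \<xi>" "ln (1 + exp b) - ln (1 + exp a) = (b - a) * logistic \<xi>" by blast
    thus ?thesis using mult_strict_left_mono[OF logistic_strict_mono[of a \<xi>], of "b - a"] True
      by (simp add: algebra_simps)
  next
    case False
    hence ba: "b < a" using that by simp
    from MVT2[OF ba has_real_derivative_softplus] obtain \<xi> where
      "\<xi> < a" "ln (1 + exp a) - ln (1 + exp b) = (a - b) * logistic \<xi>" by blast
    thus ?thesis using mult_strict_left_mono[OF logistic_strict_mono[of \<xi> a], of "a - b"] ba
      by (simp add: algebra_simps)
  qed
  show "ln (1 + exp a) + logistic a * (b - a) \<le> ln (1 + exp b)"
    using *[of a b] by (cases "a = b") auto
qed

text \<open>Add the tangent inequality of the softplus function over all edges: by the score
  equations its linear terms cancel against the degree terms, so \<open>b\<close> minimizes.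
  Uniqueness is identifiability: positivity of the quadratic form yields an edge on which a nonzero
  difference vector has nonzero sum, and there the inequality is strict.\<close>

lemma is_ml_estimate_iff:
  assumes balanced: "balanced_hypergraph {1..n} (hyperedges n s) s N Q \<kappa>"
    and b: "b \<in> {1..n} \<rightarrow>\<^sub>E UNIV"
    and score: "\<And>v. v \<in> {1..n} \<Longrightarrow> (\<Sum>e | e \<in> hyperedges n s \<and> v \<in> e. logistic (sum b e)) = real (s_degree s H v)"
  shows "is_ml_estimate n s H b' \<longleftrightarrow> b' = b"
proof -
  interpret balanced_hypergraph "{1..n}" "hyperedges n s" s N Q \<kappa> by (rule balanced)
  let ?l = "neg_log_likelihood n s H"
  have less: "?l b < ?l c" if c: "c \<in> {1..n} \<rightarrow>\<^sub>E UNIV" and neq: "c \<noteq> b" for c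
  proof -
    define x where "x v = c v - b v" for v
    obtain v where v: "v \<in> {1..n}" "x v \<noteq> 0"
      using neq b c unfolding x_def by (metis PiE_ext eq_iff_diff_eq_0)
    have "0 < (x v)\<^sup>2" using v by simp
    also have "\<dots> \<le> (\<Sum>v\<in>{1..n}. (x v)\<^sup>2)"
      using finite_V v by (intro member_le_sum) auto
    finally have "0 < (\<Sum>e\<in>hyperedges n s. (sum x e)\<^sup>2)"
      using quadratic_form_ge[of x] kappa_pos N_pos Q_pos by (smt (verit) mult_pos_pos)
    then obtain e0 where e0: "e0 \<in> hyperedges n s" "sum x e0 \<noteq> 0"
      by (metis (mono_tags, lifting) less_irrefl power_zero_numeral sum.neutral)
    have xe: "sum x e = sum c e - sum b e" for e by (simp add: x_def sum_subtractf)
    have "(\<Sum>e\<in>hyperedges n s. ln (1 + exp (sum b e)) + logistic (sum b e) * sum x e) < (\<Sum>e\<in>hyperedges n s. ln (1 + exp (sum c e)))"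
      unfolding xe using e0 xe by (intro sum_strict_mono_ex1 finite_E ballI bexI[of _ e0] softplus_above_tangent) auto
    moreover have "(\<Sum>e\<in>hyperedges n s. logistic (sum b e) * sum x e) = (\<Sum>v\<in>{1..n}. x v * real (s_degree s H v))"
      by (subst sum_incidence[symmetric]) (simp add: score)
    ultimately show ?thesis
      by (simp add: neg_log_likelihood_def x_def sum.distrib sum_subtractf left_diff_distrib)
  qed
  show ?thesis
    using less b unfolding is_ml_estimate_def is_arg_min_def by (metis less_asym less_irrefl)
qed

text \<open>Minus the gradient of the layer's negative log-likelihood at \<open>\<beta>\<close>. It
  makes sense for every \<open>H\<close>, so the expansion of the estimate can be stated without
  probability.\<close>

definition centered_degree :: "nat \<Rightarrow> nat \<Rightarrow> (nat \<Rightarrow> real) \<Rightarrow> nat set set \<Rightarrow> nat \<Rightarrow> real" where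
  "centered_degree n s \<beta> H v =
     real (s_degree s H v) - (\<Sum>e | e \<in> hyperedges n s \<and> v \<in> e. logistic (sum \<beta> e))"

definition degree_var :: "nat \<Rightarrow> nat \<Rightarrow> (nat \<Rightarrow> real) \<Rightarrow> nat \<Rightarrow> real" where
  "degree_var n s \<beta> v = (\<Sum>e | e \<in> hyperedges n s \<and> v \<in> e. logistic_deriv (sum \<beta> e))"

text \<open>The order of quantifiers matters. \<open>\<epsilon>\<close> and \<open>C\<close> depend
  on \<open>s\<close> and \<open>M\<close> only, and \<open>y\<close> is fixed before
  \<open>H\<close>: it is deterministic, so the variance of the term linear in \<open>y\<close> can
  be computed later.\<close>

lemma ml_estimate_expansion:
  assumes s: "s \<ge> 2" and M: "M > 0"
  obtains \<epsilon> C where "\<epsilon> > 0" and "C > 0" and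
    "\<And>n \<beta> v. n \<ge> s + 2 \<Longrightarrow> (\<And>u. u \<in> {1..n} \<Longrightarrow> \<bar>\<beta> u\<bar> \<le> M) \<Longrightarrow> v \<in> {1..n} \<Longrightarrow>
       \<exists>y. (\<forall>u\<in>{1..n}. \<bar>y u\<bar> \<le> C / real n) \<and>
         (\<forall>H. (\<forall>u\<in>{1..n}. \<bar>centered_degree n s \<beta> H u\<bar> \<le> \<epsilon> * (real n * real n ^ (s - 2))) \<longrightarrow>
           (\<exists>b. (\<forall>b'. is_ml_estimate n s H b' \<longleftrightarrow> b' = b) \<and>
             \<bar>degree_var n s \<beta> v * (b v - \<beta> v) - centered_degree n s \<beta> H v\<bar> \<le>
               \<bar>\<Sum>u=1..n. y u * centered_degree n s \<beta> H u\<bar> +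
               C * ((centered_degree n s \<beta> H v)\<^sup>2 / (real n * real n ^ (s - 2)) +
                    (\<Sum>u=1..n. (centered_degree n s \<beta> H u)\<^sup>2) / ((real n)\<^sup>2 * real n ^ (s - 2)))))"
proof -
  define \<kappa> where "\<kappa> = balance_constant s"
  have \<kappa>: "\<kappa> > 0" using balance_constant_pos[OF s] by (simp add: \<kappa>_def)
  \<comment> \<open>The error is sought in the box of half-width 1, so on every edge the arguments
    of the logistic function stay within \<open>real s * (M + 1)\<close>. The matching upper bound
    for its derivative is 1.\<close>
  define c0 where "c0 = exp (- (real s * (M + 1))) / 4"
  have c0: "c0 > 0" by (simp add: c0_def)
  define l where "l = c0 * \<kappa>"
  have l: "l > 0" using c0 \<kappa> by (simp add: l_def)
  \<comment> \<open>With this threshold for the centered degrees the smallness condition of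
    \<open>solve_edge_system\<close> holds with a factor 2 to spare.\<close>
  define \<epsilon> where "\<epsilon> = l / (2 * (1 + 1 / l))"
  have \<epsilon>: "\<epsilon> > 0" using l unfolding \<epsilon>_def by (intro divide_pos_pos mult_pos_pos add_pos_pos) auto
  define \<eta> where "\<eta> = 1 * (1 + 1 / (c0 * \<kappa>)) / (c0 * \<kappa>)"
  have \<eta>: "\<eta> > 0" using l unfolding \<eta>_def l_def[symmetric] by (intro divide_pos_pos mult_pos_pos add_pos_pos) auto
  define C1 where "C1 = expansion_constant s l 1 \<eta>"
  have C1: "C1 \<ge> 0" using l \<eta> unfolding C1_def expansion_constant_def by (intro add_nonneg_nonneg mult_nonneg_nonneg divide_nonneg_nonneg) auto
  define C where "C = \<eta> + C1"
  have C: "C > 0" "\<eta> \<le> C" "C1 \<le> C" using \<eta> C1 by (auto simp: C_def)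
  show ?thesis
  proof (rule that[OF \<epsilon> C(1)])
    fix n :: nat and \<beta> :: "nat \<Rightarrow> real" and v
    assume n: "n \<ge> s + 2" and \<beta>: "\<And>u. u \<in> {1..n} \<Longrightarrow> \<bar>\<beta> u\<bar> \<le> M" and v: "v \<in> {1..n}"
    let ?E = "hyperedges n s" and ?N = "real n" and ?Q = "real n ^ (s - 2)"
    interpret balanced_hypergraph "{1..n}" ?E s ?N ?Q \<kappa>
      unfolding \<kappa>_def by (rule balanced_hyperedges[OF s n])
    have NQ: "?N * ?Q > 0" using N_pos Q_pos by simp
    define w where "w e = logistic_deriv (sum \<beta> e)" for e
    have sum\<beta>: "\<bar>sum \<beta> e\<bar> \<le> real s * M" if "e \<in> ?E" for e
    proof -
      have "\<bar>sum \<beta> e\<bar> \<le> (\<Sum>v\<in>e. \<bar>\<beta> v\<bar>)" by (rule sum_abs)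
      also have "\<dots> \<le> real (card e) * M" using \<beta> edge[OF that] by (intro sum_bounded_above) auto
      finally show ?thesis using edge[OF that] by simp
    qed
    have ld: "c0 \<le> logistic_deriv \<xi>" if "e \<in> ?E" "\<bar>\<xi> - sum \<beta> e\<bar> \<le> real s" for e \<xi>
    proof -
      have "\<bar>\<xi>\<bar> \<le> real s * (M + 1)" using sum\<beta>[OF that(1)] that(2) unfolding distrib_left by linarith
      from logistic_deriv_ge[OF this] show ?thesis by (simp add: c0_def)
    qed
    have w: "c0 \<le> w e" "w e \<le> 1" if "e \<in> ?E" for e
      using ld[OF that, of "sum \<beta> e"] logistic_deriv_le_1 by (auto simp: w_def)
    obtain y where y: "\<And>u. u \<in> {1..n} \<Longrightarrow> (\<Sum>e | e \<in> ?E \<and> u \<in> e. w e * sum y e) =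
               (if u = v then 0 else \<Sum>e | e \<in> ?E \<and> u \<in> e \<and> v \<in> e. w e)"
        and y_le: "\<And>u. u \<in> {1..n} \<Longrightarrow> \<bar>y u\<bar> \<le> \<eta> / ?N"
      using link_solution[where w=w, OF c0 w v] unfolding \<eta>_def[symmetric] by blast
    show "\<exists>y. (\<forall>u\<in>{1..n}. \<bar>y u\<bar> \<le> C / real n) \<and>
         (\<forall>H. (\<forall>u\<in>{1..n}. \<bar>centered_degree n s \<beta> H u\<bar> \<le> \<epsilon> * (?N * ?Q)) \<longrightarrow>
           (\<exists>b. (\<forall>b'. is_ml_estimate n s H b' \<longleftrightarrow> b' = b) \<and>
             \<bar>degree_var n s \<beta> v * (b v - \<beta> v) - centered_degree n s \<beta> H v\<bar> \<le>
               \<bar>\<Sum>u=1..n. y u * centered_degree n s \<beta> H u\<bar> +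
               C * ((centered_degree n s \<beta> H v)\<^sup>2 / (?N * ?Q) +
                    (\<Sum>u=1..n. (centered_degree n s \<beta> H u)\<^sup>2) / (?N\<^sup>2 * ?Q))))"
    proof (rule exI[of _ y], intro conjI allI impI ballI)
      fix u assume "u \<in> {1..n}"
      from y_le[OF this] show "\<bar>y u\<bar> \<le> C / ?N"
        using C(2) N_pos by (meson divide_right_mono less_imp_le order.trans)
    next
      fix H assume small: "\<forall>u\<in>{1..n}. \<bar>centered_degree n s \<beta> H u\<bar> \<le> \<epsilon> * (?N * ?Q)"
      define g where "g = centered_degree n s \<beta> H"
      define h where "h e t = logistic (sum \<beta> e + t) - logistic (sum \<beta> e)" for e t
      \<comment> \<open>Contribution of \<open>e\<close> to the negative log-likelihood at the
        shifted parameter, with the slope at \<open>\<beta>\<close> removed so that the derivative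
        \<open>h e\<close> vanishes at 0.\<close>
      define P where "P e t = ln (1 + exp (sum \<beta> e + t)) - logistic (sum \<beta> e) * t" for e t
      have "\<exists>x. (\<forall>v. v \<notin> {1..n} \<longrightarrow> x v = 0) \<and> (\<forall>v. \<bar>x v\<bar> \<le> 1) \<and>
         (\<forall>v\<in>{1..n}. (\<Sum>e | e \<in> ?E \<and> v \<in> e. h e (sum x e)) = g v) \<and>
         (c0 * \<kappa> * ?N * ?Q)\<^sup>2 * (\<Sum>v\<in>{1..n}. (x v)\<^sup>2) \<le> (\<Sum>v\<in>{1..n}. (g v)\<^sup>2) \<and>
         (\<forall>v\<in>{1..n}. c0 * \<kappa> * ?N * ?Q * \<bar>x v\<bar> \<le> \<bar>g v\<bar> + 1 / (c0 * \<kappa>) * sqrt ((\<Sum>v\<in>{1..n}. (g v)\<^sup>2) / ?N))"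
      proof (rule solve_edge_system[where H=P and \<gamma>="\<epsilon> * (?N * ?Q)"])
        show "(P e has_real_derivative h e t) (at t)" for e t
        proof -
          have "((\<lambda>t. ln (1 + exp (sum \<beta> e + t))) has_real_derivative logistic (sum \<beta> e + t) * 1) (at t)"
            by (rule DERIV_chain2[where f="\<lambda>t. ln (1 + exp t)", OF has_real_derivative_softplus])
               (auto intro!: derivative_eq_intros)
          hence "(P e has_real_derivative logistic (sum \<beta> e + t) * 1 - logistic (sum \<beta> e) * 1) (at t)"
            unfolding P_def by (intro DERIV_diff DERIV_cmult DERIV_ident)
          thus ?thesis by (simp add: h_def)
        qed
        show "c0 * t\<^sup>2 \<le> h e t * t" if "e \<in> ?E" "\<bar>t\<bar> \<le> real s * 1" for e t
        proof -
          obtain \<xi> where \<xi>: "h e t = logistic_deriv \<xi> * t" "\<bar>\<xi> - sum \<beta> e\<bar> \<le> \<bar>t\<bar>"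
            unfolding h_def by (rule logistic_increment)
          have "c0 * t\<^sup>2 \<le> logistic_deriv \<xi> * t\<^sup>2"
            using ld[OF that(1), of \<xi>] \<xi>(2) that(2) by (intro mult_right_mono) auto
          thus ?thesis by (simp add: \<xi>(1) power2_eq_square mult.assoc)
        qed
        show "\<bar>h e t\<bar> \<le> 1 * \<bar>t\<bar>" for e t
        proof -
          obtain \<xi> where \<xi>: "h e t = logistic_deriv \<xi> * t" "\<bar>\<xi> - sum \<beta> e\<bar> \<le> \<bar>t\<bar>"
            unfolding h_def by (rule logistic_increment)
          show ?thesis unfolding \<xi>(1) abs_mult
            using logistic_deriv_pos[of \<xi>] logistic_deriv_le_1[of \<xi>] by (intro mult_right_mono) auto
        qed
        show "\<bar>g v\<bar> \<le> \<epsilon> * (?N * ?Q)" if "v \<in> {1..n}" for v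
          using small that by (simp add: g_def)
        have "\<epsilon> * (1 + 1 / l) = l / 2"
        proof -
          have "1 + 1 / l > 0" using l by (intro add_pos_pos) auto
          moreover define A where "A = 1 + 1 / l"
          ultimately show ?thesis unfolding \<epsilon>_def A_def[symmetric] by simp
        qed
        hence "\<epsilon> * (?N * ?Q) * (1 + 1 / l) = l / 2 * (?N * ?Q)" by (metis mult.assoc mult.commute)
        also have "\<dots> < l * (?N * ?Q)" using l NQ by simp
        finally show "\<epsilon> * (?N * ?Q) * (1 + 1 / (c0 * \<kappa>)) < c0 * \<kappa> * ?N * ?Q * 1"
          by (simp add: l_def mult.assoc)
      qed (use c0 in auto)
      then obtain x where x: "\<And>u. u \<in> {1..n} \<Longrightarrow> (\<Sum>e | e \<in> ?E \<and> u \<in> e. h e (sum x e)) = g u"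
        and x2: "(l * ?N * ?Q)\<^sup>2 * (\<Sum>u\<in>{1..n}. (x u)\<^sup>2) \<le> (\<Sum>u\<in>{1..n}. (g u)\<^sup>2)"
        and xv: "\<And>u. u \<in> {1..n} \<Longrightarrow> l * ?N * ?Q * \<bar>x u\<bar> \<le> \<bar>g u\<bar> + 1 / l * sqrt ((\<Sum>u\<in>{1..n}. (g u)\<^sup>2) / ?N)"
        unfolding l_def by blast
      define b where "b = (\<lambda>u\<in>{1..n}. \<beta> u + x u)"
      have be: "sum b e = sum \<beta> e + sum x e" if "e \<in> ?E" for e
        using edge[OF that] unfolding b_def sum.distrib[symmetric] by (intro sum.cong) auto
      have "is_ml_estimate n s H b' \<longleftrightarrow> b' = b" for b'
      proof (rule is_ml_estimate_iff[OF balanced_hypergraph_axioms])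
        fix u assume u: "u \<in> {1..n}"
        have "(\<Sum>e | e \<in> ?E \<and> u \<in> e. logistic (sum b e)) = (\<Sum>e | e \<in> ?E \<and> u \<in> e. h e (sum x e) + logistic (sum \<beta> e))"
          by (intro sum.cong refl) (simp add: h_def be)
        also have "\<dots> = real (s_degree s H u)"
          using x[OF u] by (simp add: sum.distrib g_def centered_degree_def)
        finally show "(\<Sum>e | e \<in> ?E \<and> u \<in> e. logistic (sum b e)) = real (s_degree s H u)" .
      qed (simp add: b_def)
      moreover have "\<bar>degree_var n s \<beta> v * (b v - \<beta> v) - g v\<bar> \<le> \<bar>\<Sum>u=1..n. y u * g u\<bar> +
               C * ((g v)\<^sup>2 / (?N * ?Q) + (\<Sum>u=1..n. (g u)\<^sup>2) / (?N\<^sup>2 * ?Q))"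
      proof -
        have "\<bar>(\<Sum>e | e \<in> ?E \<and> v \<in> e. w e) * x v - g v\<bar> \<le> \<bar>\<Sum>u=1..n. y u * g u\<bar> +
           expansion_constant s l 1 \<eta> * ((g v)\<^sup>2 / (?N * ?Q) + (\<Sum>u=1..n. (g u)\<^sup>2) / (?N\<^sup>2 * ?Q))"
        proof (rule edge_system_expansion[where h=h and w=w and x=x and g=g and y=y, OF l _ _ v y y_le _ x x2 xv[OF v]])
          show "\<bar>h e (sum x e) - w e * sum x e\<bar> \<le> (sum x e)\<^sup>2" for e
            unfolding h_def w_def by (rule logistic_taylor)
        qed (use \<eta> in auto)
        also note C1_def[symmetric]
        also have "\<bar>\<Sum>u=1..n. y u * g u\<bar> + C1 * ((g v)\<^sup>2 / (?N * ?Q) + (\<Sum>u=1..n. (g u)\<^sup>2) / (?N\<^sup>2 * ?Q))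
            \<le> \<bar>\<Sum>u=1..n. y u * g u\<bar> + C * ((g v)\<^sup>2 / (?N * ?Q) + (\<Sum>u=1..n. (g u)\<^sup>2) / (?N\<^sup>2 * ?Q))"
          using C(3) N_pos Q_pos by (intro add_left_mono mult_right_mono add_nonneg_nonneg divide_nonneg_nonneg sum_nonneg) auto
        finally show ?thesis using v by (simp add: degree_var_def w_def b_def)
      qed
      ultimately show "\<exists>b. (\<forall>b'. is_ml_estimate n s H b' \<longleftrightarrow> b' = b) \<and>
             \<bar>degree_var n s \<beta> v * (b v - \<beta> v) - centered_degree n s \<beta> H v\<bar> \<le>
               \<bar>\<Sum>u=1..n. y u * centered_degree n s \<beta> H u\<bar> +
               C * ((centered_degree n s \<beta> H v)\<^sup>2 / (?N * ?Q) +
                    (\<Sum>u=1..n. (centered_degree n s \<beta> H u)\<^sup>2) / (?N\<^sup>2 * ?Q))"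
        unfolding g_def by blast
    qed
  qed
qed

section \<open>The random hypergraph\<close>

lemma distr_map_pmf:
  assumes "g \<in> measurable (count_space UNIV) N"
  shows "distr (measure_pmf (map_pmf f p)) N g = distr (measure_pmf p) N (\<lambda>x. g (f x))"
  using assms by (simp add: map_pmf_rep_eq distr_distr o_def)

text \<open>Independence depends on the joint law only, and that law is the same whether
  \<open>f\<close> is applied to the measure or inside the variables. The product criterion is for
  nonempty index sets, hence the case split.\<close>

lemma indep_vars_map_pmf:
  assumes "prob_space.indep_vars (measure_pmf p) N (\<lambda>i x. X i (f x)) I"
    and X: "\<And>i x. i \<in> I \<Longrightarrow> X i x \<in> space (N i)"
  shows "prob_space.indep_vars (measure_pmf (map_pmf f p)) N X I"
proof (cases "I = {}")
  case True
  thus ?thesis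
    by (simp add: prob_space.indep_vars_def[OF prob_space_measure_pmf] prob_space.indep_sets_def[OF prob_space_measure_pmf])
next
  case False
  have X1: "X i \<in> measurable (measure_pmf (map_pmf f p)) (N i)" "(\<lambda>x. X i (f x)) \<in> measurable (measure_pmf p) (N i)"
    if "i \<in> I" for i using X[OF that] by auto
  have X2: "(\<lambda>x. \<lambda>i\<in>I. X i x) \<in> measurable (count_space UNIV) (PiM I N)"
    using X by (auto simp: space_PiM)
  show ?thesis
    using assms(1) False X1
    by (simp add: prob_space.indep_vars_iff_distr_eq_PiM'[OF prob_space_measure_pmf] distr_map_pmf[OF X2]
             distr_map_pmf X cong: PiM_cong)
qed

lemma (in prob_space) indep_vars_sum_second_moment:
  fixes X :: "'i \<Rightarrow> 'a \<Rightarrow> real"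
  assumes fin: "finite I" and indep: "indep_vars (\<lambda>_. borel) X I"
    and int: "\<And>i. i \<in> I \<Longrightarrow> integrable M (X i)" and int2: "\<And>i. i \<in> I \<Longrightarrow> integrable M (\<lambda>\<omega>. (X i \<omega>)\<^sup>2)"
    and mean: "\<And>i. i \<in> I \<Longrightarrow> expectation (X i) = 0"
  shows "expectation (\<lambda>\<omega>. (\<Sum>i\<in>I. X i \<omega>)\<^sup>2) = (\<Sum>i\<in>I. expectation (\<lambda>\<omega>. (X i \<omega>)\<^sup>2))"
proof -
  have prod: "integrable M (\<lambda>\<omega>. X i \<omega> * X j \<omega>) \<and>
      expectation (\<lambda>\<omega>. X i \<omega> * X j \<omega>) = (if i = j then expectation (\<lambda>\<omega>. (X i \<omega>)\<^sup>2) else 0)"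
    if ij: "i \<in> I" "j \<in> I" for i j
  proof (cases "i = j")
    case True
    thus ?thesis using int2[OF ij(2)] by (simp add: power2_eq_square)
  next
    case False
    have "indep_vars (\<lambda>_. borel) X {i, j}"
      using indep ij by (rule_tac indep_vars_subset) auto
    from indep_vars_lebesgue_integral[OF _ this] indep_vars_integrable[OF _ this] int ij False mean
    show ?thesis by auto
  qed
  have "expectation (\<lambda>\<omega>. (\<Sum>i\<in>I. X i \<omega>)\<^sup>2) = (\<Sum>i\<in>I. \<Sum>j\<in>I. expectation (\<lambda>\<omega>. X i \<omega> * X j \<omega>))"
    unfolding power2_eq_square sum_product using prod
    by (subst Bochner_Integration.integral_sum, simp, intro sum.cong refl Bochner_Integration.integral_sum) auto
  also have "\<dots> = (\<Sum>i\<in>I. expectation (\<lambda>\<omega>. (X i \<omega>)\<^sup>2))"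
    using prod fin by (intro sum.cong refl) simp
  finally show ?thesis .
qed

section \<open>Edge deviations and moments of degrees\<close>

lemma finite_layered_hyperedges: "finite (layered_hyperedges n r)"
  by (simp add: layered_hyperedges_def finite_hyperedges)

lemma hyperedges_subset_layered: "s \<in> {2..r} \<Longrightarrow> hyperedges n s \<subseteq> layered_hyperedges n r"
  by (auto simp: layered_hyperedges_def)

lemma edge_prob_eq_logistic: "edge_prob B e = logistic (sum (B (card e)) e)"
  by (simp add: edge_prob_def logistic_def)

lemma edge_prob_hyperedge: "e \<in> hyperedges n s \<Longrightarrow> edge_prob B e = logistic (sum (B s) e)"
  by (simp add: edge_prob_eq_logistic hyperedges_def)

lemma set_pmf_beta_model: "H \<in> set_pmf (hypergraph_beta_model n r B) \<Longrightarrow> H \<subseteq> layered_hyperedges n r"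
  by (auto simp: hypergraph_beta_model_def)

lemma finite_set_pmf_beta_model: "finite (set_pmf (hypergraph_beta_model n r B))"
  by (rule finite_subset[of _ "Pow (layered_hyperedges n r)"])
     (use set_pmf_beta_model finite_layered_hyperedges in blast)+

lemma integrable_beta_model [simp, intro]: "integrable (measure_pmf (hypergraph_beta_model n r B)) (f :: _ \<Rightarrow> real)"
  by (rule integrable_measure_pmf_finite[OF finite_set_pmf_beta_model])

text \<open>These centered variables are independent jointly over all layers, and every centered
  degree is a linear combination of them; moments, tails and the limit theorem are all computed from
  them.\<close>

definition edge_dev :: "(nat \<Rightarrow> nat \<Rightarrow> real) \<Rightarrow> nat set \<Rightarrow> nat set set \<Rightarrow> real" where
  "edge_dev B e H = of_bool (e \<in> H) - edge_prob B e"

lemma abs_edge_dev_le: "\<bar>edge_dev B e H\<bar> \<le> 1"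
  using logistic_pos[of "sum (B (card e)) e"] logistic_less_1[of "sum (B (card e)) e"]
  by (auto simp: edge_dev_def edge_prob_eq_logistic of_bool_def)

lemma indep_edge_dev:
  "prob_space.indep_vars (measure_pmf (hypergraph_beta_model n r B)) (\<lambda>_. borel) (edge_dev B) (layered_hyperedges n r)"
  unfolding hypergraph_beta_model_def
proof (rule indep_vars_map_pmf)
  let ?P = "Pi_pmf (layered_hyperedges n r) False (\<lambda>e. bernoulli_pmf (edge_prob B e))"
  have "prob_space.indep_vars ?P (\<lambda>_. count_space UNIV) (\<lambda>e x. x e) (layered_hyperedges n r)"
    by (rule indep_vars_Pi_pmf[OF finite_layered_hyperedges])
  hence "prob_space.indep_vars ?P (\<lambda>_. borel) (\<lambda>e x. of_bool (x e) - edge_prob B e) (layered_hyperedges n r)"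
    by (rule prob_space.indep_vars_compose2[OF prob_space_measure_pmf]) auto
  thus "prob_space.indep_vars ?P (\<lambda>_. borel) (\<lambda>e x. edge_dev B e {e \<in> layered_hyperedges n r. x e}) (layered_hyperedges n r)"
    by (subst prob_space.indep_vars_cong[OF prob_space_measure_pmf, OF refl _ refl]) (auto simp: edge_dev_def)
qed auto

lemma expectation_edge_dev:
  assumes e: "e \<in> layered_hyperedges n r"
  shows "measure_pmf.expectation (hypergraph_beta_model n r B) (edge_dev B e) = 0"
    and "measure_pmf.expectation (hypergraph_beta_model n r B) (\<lambda>H. (edge_dev B e H)\<^sup>2) =
           logistic_deriv (sum (B (card e)) e)"
proof -
  let ?p = "edge_prob B e"
  have p: "0 \<le> ?p" "?p \<le> 1"
    using logistic_pos logistic_less_1 less_imp_le unfolding edge_prob_eq_logistic by blast+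
  have *: "measure_pmf.expectation (hypergraph_beta_model n r B) (\<lambda>H. f (e \<in> H)) = f True * ?p + f False * (1 - ?p)"
    for f :: "bool \<Rightarrow> real"
  proof -
    let ?P = "Pi_pmf (layered_hyperedges n r) False (\<lambda>e. bernoulli_pmf (edge_prob B e))"
    have "measure_pmf.expectation (hypergraph_beta_model n r B) (\<lambda>H. f (e \<in> H)) =
        measure_pmf.expectation ?P (\<lambda>x. f (x e))"
      using e by (simp add: hypergraph_beta_model_def)
    also have "\<dots> = measure_pmf.expectation (map_pmf (\<lambda>x. x e) ?P) f" by simp
    also have "map_pmf (\<lambda>x. x e) ?P = bernoulli_pmf ?p"
      by (subst Pi_pmf_component) (use e finite_layered_hyperedges in auto)
    also have "measure_pmf.expectation (bernoulli_pmf ?p) f = f True * ?p + f False * (1 - ?p)"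
      using p by (subst integral_bernoulli_pmf) auto
    finally show ?thesis .
  qed
  show "measure_pmf.expectation (hypergraph_beta_model n r B) (edge_dev B e) = 0"
    using *[of "\<lambda>b. of_bool b - ?p"] by (simp add: edge_dev_def[abs_def] algebra_simps)
  show "measure_pmf.expectation (hypergraph_beta_model n r B) (\<lambda>H. (edge_dev B e H)\<^sup>2) =
           logistic_deriv (sum (B (card e)) e)"
    using *[of "\<lambda>b. (of_bool b - ?p)\<^sup>2"]
    by (simp add: edge_dev_def logistic_deriv_def edge_prob_eq_logistic[symmetric] algebra_simps power2_eq_square)
qed

text \<open>General coefficients serve the pairing of the degrees with \<open>y\<close>, where
  \<open>e\<close> receives the weight \<open>sum y e\<close>; plain degrees have all coefficients
  1.\<close>

lemma edge_dev_sum_moments: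
  assumes A: "A \<subseteq> layered_hyperedges n r"
  shows "measure_pmf.expectation (hypergraph_beta_model n r B) (\<lambda>H. \<Sum>e\<in>A. c e * edge_dev B e H) = 0"
    and "measure_pmf.expectation (hypergraph_beta_model n r B) (\<lambda>H. (\<Sum>e\<in>A. c e * edge_dev B e H)\<^sup>2) =
           (\<Sum>e\<in>A. (c e)\<^sup>2 * logistic_deriv (sum (B (card e)) e))"
proof -
  let ?M = "hypergraph_beta_model n r B"
  have fin: "finite A" using A finite_layered_hyperedges finite_subset by blast
  show "measure_pmf.expectation ?M (\<lambda>H. \<Sum>e\<in>A. c e * edge_dev B e H) = 0"
    using A by (subst Bochner_Integration.integral_sum) (auto intro!: sum.neutral simp: expectation_edge_dev subsetD)
  have "prob_space.indep_vars ?M (\<lambda>_. borel) (\<lambda>e H. c e * edge_dev B e H) A"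
    by (rule prob_space.indep_vars_compose2[OF prob_space_measure_pmf, OF prob_space.indep_vars_subset[OF prob_space_measure_pmf, OF indep_edge_dev A]]) auto
  hence "measure_pmf.expectation ?M (\<lambda>H. (\<Sum>e\<in>A. c e * edge_dev B e H)\<^sup>2) = (\<Sum>e\<in>A. measure_pmf.expectation ?M (\<lambda>H. (c e * edge_dev B e H)\<^sup>2))"
    using A by (intro measure_pmf.indep_vars_sum_second_moment fin) (auto simp: expectation_edge_dev)
  also have "\<dots> = (\<Sum>e\<in>A. (c e)\<^sup>2 * logistic_deriv (sum (B (card e)) e))"
    using A by (intro sum.cong refl) (auto simp: power_mult_distrib expectation_edge_dev)
  finally show "measure_pmf.expectation ?M (\<lambda>H. (\<Sum>e\<in>A. c e * edge_dev B e H)\<^sup>2) =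
           (\<Sum>e\<in>A. (c e)\<^sup>2 * logistic_deriv (sum (B (card e)) e))" .
qed

lemma edge_dev_sum_tail:
  assumes A: "A \<subseteq> layered_hyperedges n r" "A \<noteq> {}" and t: "t \<ge> 0"
  shows "measure_pmf.prob (hypergraph_beta_model n r B) {H. \<bar>\<Sum>e\<in>A. edge_dev B e H\<bar> \<ge> t} \<le>
           2 * exp (- 2 * t\<^sup>2 / real (card A))"
proof -
  let ?M = "hypergraph_beta_model n r B"
  have fin: "finite A" using A finite_layered_hyperedges finite_subset by blast
  interpret H: Hoeffding_ineq "measure_pmf (hypergraph_beta_model n r B)" A "edge_dev B"
    "\<lambda>e. - edge_prob B e" "\<lambda>e. 1 - edge_prob B e" "\<Sum>e\<in>A. measure_pmf.expectation ?M (edge_dev B e)"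
  proof unfold_locales
    show "prob_space.indep_vars ?M (\<lambda>_. borel) (edge_dev B) A"
      by (rule prob_space.indep_vars_subset[OF prob_space_measure_pmf, OF indep_edge_dev A(1)])
  qed (auto simp: fin edge_dev_def of_bool_def)
  have "(\<Sum>e\<in>A. measure_pmf.expectation ?M (edge_dev B e)) = 0"
    using A by (intro sum.neutral ballI expectation_edge_dev) auto
  thus ?thesis
    using H.Hoeffding_ineq_abs_ge[OF t] A fin by (simp add: card_gt_0_iff)
qed

lemma s_degree_eq_sum:
  assumes s: "s \<in> {2..r}" and H: "H \<subseteq> layered_hyperedges n r"
  shows "real (s_degree s H v) = (\<Sum>e | e \<in> hyperedges n s \<and> v \<in> e. of_bool (e \<in> H))"
proof -
  have "{e \<in> H. card e = s \<and> v \<in> e} = {e \<in> {e. e \<in> hyperedges n s \<and> v \<in> e}. e \<in> H}"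
    using H by (auto simp: layered_hyperedges_def hyperedges_def)
  moreover have "finite {e. e \<in> hyperedges n s \<and> v \<in> e}"
    using finite_hyperedges by simp
  ultimately show ?thesis
    unfolding s_degree_def of_bool_def by (simp add: sum.inter_filter[symmetric])
qed

lemma centered_degree_eq_sum:
  assumes s: "s \<in> {2..r}" and H: "H \<subseteq> layered_hyperedges n r"
  shows "centered_degree n s (B s) H v = (\<Sum>e | e \<in> hyperedges n s \<and> v \<in> e. edge_dev B e H)"
  unfolding centered_degree_def s_degree_eq_sum[OF s H] edge_dev_def sum_subtractf[symmetric]
  by (intro sum.cong refl) (auto simp: edge_prob_hyperedge)

text \<open>\<open>s_degree\<close> counts every member of \<open>H\<close> of size
  \<open>s\<close>, so the edgewise formula requires \<open>H\<close> to consist of hyperedges on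
  \<open>{1..n}\<close>. The model ensures this on its support, and moments are transferred through
  this almost sure identity.\<close>

lemma AE_centered_degree:
  assumes s: "s \<in> {2..r}"
  shows "AE H in measure_pmf (hypergraph_beta_model n r B). \<forall>v.
    centered_degree n s (B s) H v = (\<Sum>e | e \<in> hyperedges n s \<and> v \<in> e. edge_dev B e H)"
  by (intro AE_pmfI allI centered_degree_eq_sum[OF s set_pmf_beta_model])

lemma sum_degree_var_eq:
  assumes "A \<subseteq> hyperedges n s"
  shows "(\<Sum>e\<in>A. c e * logistic_deriv (sum (B (card e)) e)) = (\<Sum>e\<in>A. c e * logistic_deriv (sum (B s) e))"
  using assms by (intro sum.cong refl) (auto simp: hyperedges_def)

lemma centered_degree_second_moment:
  assumes s: "s \<in> {2..r}"
  shows "measure_pmf.expectation (hypergraph_beta_model n r B) (\<lambda>H. (centered_degree n s (B s) H v)\<^sup>2) =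
           degree_var n s (B s) v"
proof -
  let ?A = "{e. e \<in> hyperedges n s \<and> v \<in> e}"
  have A: "?A \<subseteq> layered_hyperedges n r" using hyperedges_subset_layered[OF s] by auto
  have "measure_pmf.expectation (hypergraph_beta_model n r B) (\<lambda>H. (centered_degree n s (B s) H v)\<^sup>2) =
      measure_pmf.expectation (hypergraph_beta_model n r B) (\<lambda>H. (\<Sum>e\<in>?A. 1 * edge_dev B e H)\<^sup>2)"
    by (intro integral_cong_AE) (use AE_centered_degree[OF s, of n B] in \<open>auto elim!: eventually_mono\<close>)
  also have "\<dots> = (\<Sum>e\<in>?A. 1\<^sup>2 * logistic_deriv (sum (B (card e)) e))"
    by (rule edge_dev_sum_moments(2)[OF A])
  also have "\<dots> = degree_var n s (B s) v"
    unfolding degree_var_def by (subst sum_degree_var_eq[of _ n s]) auto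
  finally show ?thesis .
qed

lemma degree_sd_eq:
  assumes s: "s \<in> {2..r}"
  shows "degree_sd n r B s v = sqrt (degree_var n s (B s) v)"
proof -
  let ?M = "hypergraph_beta_model n r B"
  let ?A = "{e. e \<in> hyperedges n s \<and> v \<in> e}"
  define m where "m = (\<Sum>e\<in>?A. logistic (sum (B s) e))"
  have A: "?A \<subseteq> layered_hyperedges n r" using hyperedges_subset_layered[OF s] by auto
  have d: "real (s_degree s H v) = centered_degree n s (B s) H v + m" for H
    by (simp add: centered_degree_def m_def)
  have "measure_pmf.expectation ?M (\<lambda>H. centered_degree n s (B s) H v) =
      measure_pmf.expectation ?M (\<lambda>H. \<Sum>e\<in>?A. 1 * edge_dev B e H)"
    by (intro integral_cong_AE) (use AE_centered_degree[OF s, of n B] in \<open>auto elim!: eventually_mono\<close>)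
  also have "\<dots> = 0" by (rule edge_dev_sum_moments(1)[OF A])
  finally have "measure_pmf.expectation ?M (\<lambda>H. real (s_degree s H v)) = m"
    unfolding d by (subst Bochner_Integration.integral_add) auto
  thus ?thesis
    unfolding degree_sd_def using centered_degree_second_moment[OF s, of n B v] by (simp add: d)
qed


section \<open>Variance bounds and concentration of degrees\<close>

lemma logistic_deriv_hyperedge_ge:
  assumes e: "e \<in> hyperedges n s" and \<beta>: "\<And>u. u \<in> {1..n} \<Longrightarrow> \<bar>\<beta> u\<bar> \<le> M"
  shows "exp (- (real s * M)) / 4 \<le> logistic_deriv (sum \<beta> e)"
proof (rule logistic_deriv_ge)
  have "\<bar>sum \<beta> e\<bar> \<le> (\<Sum>v\<in>e. \<bar>\<beta> v\<bar>)" by (rule sum_abs)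
  also have "\<dots> \<le> real (card e) * M" using \<beta> e by (intro sum_bounded_above) (auto simp: hyperedges_def)
  finally show "\<bar>sum \<beta> e\<bar> \<le> real s * M" using e by (simp add: hyperedges_def)
qed

text \<open>Lower bound for the variance of one edge indicator times the lower bound for a degree in
  units of \<open>N * Q\<close>.\<close>

definition variance_constant :: "nat \<Rightarrow> real \<Rightarrow> real" where
  "variance_constant s M = exp (- (real s * M)) / 4 * balance_constant s"

lemma variance_constant_pos: "s \<ge> 2 \<Longrightarrow> variance_constant s M > 0"
  using balance_constant_pos by (simp add: variance_constant_def)

lemma degree_var_ge:
  assumes s: "s \<ge> 2" and n: "n \<ge> s + 2" and \<beta>: "\<And>u. u \<in> {1..n} \<Longrightarrow> \<bar>\<beta> u\<bar> \<le> M" and v: "v \<in> {1..n}"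
  shows "variance_constant s M * (real n * real n ^ (s - 2)) \<le> degree_var n s \<beta> v"
proof -
  interpret balanced_hypergraph "{1..n}" "hyperedges n s" s "real n" "real n ^ (s - 2)" "balance_constant s"
    by (rule balanced_hyperedges[OF s n])
  have "variance_constant s M * (real n * real n ^ (s - 2)) =
      exp (- (real s * M)) / 4 * (balance_constant s * real n * real n ^ (s - 2))"
    by (simp add: variance_constant_def)
  also have "\<dots> \<le> exp (- (real s * M)) / 4 * real (card {e\<in>hyperedges n s. v \<in> e})"
    by (intro mult_left_mono degree_ge v) auto
  also have "\<dots> = (\<Sum>e | e \<in> hyperedges n s \<and> v \<in> e. exp (- (real s * M)) / 4)" by simp
  also have "\<dots> \<le> degree_var n s \<beta> v"
    unfolding degree_var_def using \<beta> by (intro sum_mono logistic_deriv_hyperedge_ge) auto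
  finally show ?thesis .
qed

lemma degree_var_le:
  assumes s: "s \<ge> 2" and n: "n \<ge> s + 2" and v: "v \<in> {1..n}"
  shows "degree_var n s \<beta> v \<le> real n * real n ^ (s - 2)"
proof -
  interpret balanced_hypergraph "{1..n}" "hyperedges n s" s "real n" "real n ^ (s - 2)" "balance_constant s"
    by (rule balanced_hyperedges[OF s n])
  have "degree_var n s \<beta> v \<le> (\<Sum>e | e \<in> hyperedges n s \<and> v \<in> e. 1)"
    unfolding degree_var_def by (intro sum_mono logistic_deriv_le_1)
  thus ?thesis using degree_le[OF v] by simp
qed

text \<open>A degree has at most \<open>N * Q\<close> independent summands, so a deviation of
  \<open>\<epsilon> * N * Q\<close> has Hoeffding exponent at least
  \<open>2 * \<epsilon>\<^sup>2 * N * Q\<close>. Already the part with \<open>Q\<close> replaced by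
  1 beats the factor \<open>n\<close> of the union bound over vertices.\<close>

lemma prob_large_centered_degree_le:
  assumes s: "s \<in> {2..r}" and n: "n \<ge> s + 2" and \<epsilon>: "\<epsilon> \<ge> 0"
  shows "measure_pmf.prob (hypergraph_beta_model n r B)
           {H. \<exists>u\<in>{1..n}. \<bar>centered_degree n s (B s) H u\<bar> > \<epsilon> * (real n * real n ^ (s - 2))} \<le>
         2 * real n * exp (- 2 * \<epsilon>\<^sup>2 * real n)"
proof -
  let ?M = "hypergraph_beta_model n r B" and ?N = "real n" and ?Q = "real n ^ (s - 2)"
  interpret balanced_hypergraph "{1..n}" "hyperedges n s" s ?N ?Q "balance_constant s"
    by (rule balanced_hyperedges) (use s n in auto)
  have Q1: "?Q \<ge> 1" using n by simp
  define S where "S u H = (\<Sum>e | e \<in> hyperedges n s \<and> u \<in> e. edge_dev B e H)" for u H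
  have "measure_pmf.prob ?M {H. \<exists>u\<in>{1..n}. \<bar>centered_degree n s (B s) H u\<bar> > \<epsilon> * (?N * ?Q)} \<le>
      measure_pmf.prob ?M (\<Union>u\<in>{1..n}. {H. \<bar>S u H\<bar> \<ge> \<epsilon> * (?N * ?Q)})"
  proof (rule measure_pmf.finite_measure_mono_AE)
    show "AE H in ?M. H \<in> {H. \<exists>u\<in>{1..n}. \<bar>centered_degree n s (B s) H u\<bar> > \<epsilon> * (?N * ?Q)} \<longrightarrow>
        H \<in> (\<Union>u\<in>{1..n}. {H. \<bar>S u H\<bar> \<ge> \<epsilon> * (?N * ?Q)})"
      using AE_centered_degree[OF s, of n B] by eventually_elim (auto simp: S_def intro: less_imp_le)
  qed auto
  also have "\<dots> \<le> (\<Sum>u\<in>{1..n}. measure_pmf.prob ?M {H. \<bar>S u H\<bar> \<ge> \<epsilon> * (?N * ?Q)})"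
    by (rule measure_pmf.finite_measure_subadditive_finite) auto
  also have "\<dots> \<le> (\<Sum>u\<in>{1..n}. 2 * exp (- 2 * \<epsilon>\<^sup>2 * ?N))"
  proof (rule sum_mono)
    fix u assume u: "u \<in> {1..n}"
    let ?A = "{e. e \<in> hyperedges n s \<and> u \<in> e}"
    have card_pos: "real (card ?A) > 0"
      using degree_ge[OF u] kappa_pos N_pos Q_pos mult_pos_pos[OF mult_pos_pos[OF kappa_pos N_pos] Q_pos] by linarith
    have "measure_pmf.prob ?M {H. \<bar>S u H\<bar> \<ge> \<epsilon> * (?N * ?Q)} \<le> 2 * exp (- 2 * (\<epsilon> * (?N * ?Q))\<^sup>2 / real (card ?A))"
      unfolding S_def
    proof (rule edge_dev_sum_tail)
      show "?A \<subseteq> layered_hyperedges n r" using hyperedges_subset_layered[OF s] by auto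
      show "?A \<noteq> {}" using card_pos by force
    qed (use \<epsilon> N_pos Q_pos in auto)
    also have "\<dots> \<le> 2 * exp (- 2 * \<epsilon>\<^sup>2 * ?N)"
    proof -
      have "\<epsilon>\<^sup>2 * ?N * real (card ?A) \<le> \<epsilon>\<^sup>2 * ?N * (?N * ?Q)"
        using degree_le[OF u] by (intro mult_left_mono) auto
      also have "\<dots> \<le> \<epsilon>\<^sup>2 * ?N * (?N * ?Q) * ?Q"
        using mult_left_mono[OF Q1, of "\<epsilon>\<^sup>2 * ?N * (?N * ?Q)"] N_pos Q_pos by simp
      also have "\<dots> = (\<epsilon> * (?N * ?Q))\<^sup>2"
        by (simp add: power2_eq_square mult_ac)
      finally have "\<epsilon>\<^sup>2 * ?N \<le> (\<epsilon> * (?N * ?Q))\<^sup>2 / real (card ?A)"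
        using card_pos by (simp add: pos_le_divide_eq)
      thus ?thesis by simp
    qed
    finally show "measure_pmf.prob ?M {H. \<bar>S u H\<bar> \<ge> \<epsilon> * (?N * ?Q)} \<le> 2 * exp (- 2 * \<epsilon>\<^sup>2 * ?N)" .
  qed
  finally show ?thesis by simp
qed

text \<open>
  Only few hyperedges at \<open>v\<close> meet \<open>J\<close> in another vertex.  Dropping them makes the sums for different
  vertices of \<open>J\<close> run over disjoint sets of hyperedges, hence exactly independent.
\<close>

definition private_edges :: "nat \<Rightarrow> nat \<Rightarrow> nat set \<Rightarrow> nat \<Rightarrow> nat set set" where
  "private_edges n s J v = {e \<in> hyperedges n s. e \<inter> J = {v}}"

definition private_degree :: "nat \<Rightarrow> nat \<Rightarrow> (nat \<Rightarrow> nat \<Rightarrow> real) \<Rightarrow> nat set \<Rightarrow> nat \<Rightarrow> nat set set \<Rightarrow> real" where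
  "private_degree n s B J v H = (\<Sum>e\<in>private_edges n s J v. edge_dev B e H)"

text \<open>A hyperedge at \<open>v\<close> that is not private passes through a second vertex of
  \<open>J\<close>, and each such vertex accounts for at most a codegree, \<open>Q\<close>, of
  them.\<close>

lemma shared_edges_var_le:
  assumes s: "s \<ge> 2" and n: "n \<ge> s + 2" and J: "J \<subseteq> {1..n}" and v: "v \<in> J"
  shows "(\<Sum>e\<in>{e \<in> hyperedges n s. v \<in> e} - private_edges n s J v. logistic_deriv (sum \<beta> e)) \<le>
           real (card J) * real n ^ (s - 2)"
proof -
  interpret balanced_hypergraph "{1..n}" "hyperedges n s" s "real n" "real n ^ (s - 2)" "balance_constant s"
    by (rule balanced_hyperedges[OF s n])
  have finJ: "finite J" using J finite_subset by blast
  let ?D = "{e \<in> hyperedges n s. v \<in> e} - private_edges n s J v"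
  have "(\<Sum>e\<in>?D. logistic_deriv (sum \<beta> e)) \<le> (\<Sum>e\<in>?D. 1)"
    by (intro sum_mono logistic_deriv_le_1)
  also have "\<dots> = real (card ?D)" by simp
  also have "card ?D \<le> card (\<Union>u\<in>J-{v}. {e \<in> hyperedges n s. u \<in> e \<and> v \<in> e})"
    using v finite_hyperedges finJ by (intro card_mono) (auto simp: private_edges_def)
  also have "\<dots> \<le> (\<Sum>u\<in>J-{v}. card {e \<in> hyperedges n s. u \<in> e \<and> v \<in> e})"
    using finJ by (intro card_UN_le) auto
  also have "real \<dots> \<le> (\<Sum>u\<in>J-{v}. real n ^ (s - 2))"
    unfolding of_nat_sum using J v by (intro sum_mono codegree_le) auto
  also have "\<dots> \<le> (\<Sum>u\<in>J. real n ^ (s - 2))"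
    using finJ by (intro sum_mono2) auto
  finally show ?thesis by simp
qed

lemma private_edges_subset: "private_edges n s J v \<subseteq> {e \<in> hyperedges n s. v \<in> e}"
  by (auto simp: private_edges_def)

lemma shared_degree_second_moment_le:
  assumes s: "s \<in> {2..r}" and n: "n \<ge> s + 2" and J: "J \<subseteq> {1..n}" and v: "v \<in> J"
  shows "measure_pmf.expectation (hypergraph_beta_model n r B)
           (\<lambda>H. (centered_degree n s (B s) H v - private_degree n s B J v H)\<^sup>2) \<le> real (card J) * real n ^ (s - 2)"
proof -
  let ?M = "hypergraph_beta_model n r B"
  let ?D = "{e \<in> hyperedges n s. v \<in> e} - private_edges n s J v"
  have D: "?D \<subseteq> layered_hyperedges n r" using hyperedges_subset_layered[OF s] by auto
  have diff: "(\<Sum>e | e \<in> hyperedges n s \<and> v \<in> e. edge_dev B e H) - private_degree n s B J v H = (\<Sum>e\<in>?D. 1 * edge_dev B e H)" for H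
    using finite_hyperedges by (simp add: private_degree_def sum_diff private_edges_subset)
  have "measure_pmf.expectation ?M (\<lambda>H. (centered_degree n s (B s) H v - private_degree n s B J v H)\<^sup>2) =
      measure_pmf.expectation ?M (\<lambda>H. (\<Sum>e\<in>?D. 1 * edge_dev B e H)\<^sup>2)"
    unfolding diff[symmetric]
    by (intro integral_cong_AE) (use AE_centered_degree[OF s, of n B] in \<open>auto elim!: eventually_mono\<close>)
  also have "\<dots> = (\<Sum>e\<in>?D. 1\<^sup>2 * logistic_deriv (sum (B (card e)) e))"
    by (rule edge_dev_sum_moments(2)[OF D])
  also have "\<dots> = (\<Sum>e\<in>?D. logistic_deriv (sum (B s) e))"
    by (subst sum_degree_var_eq[of _ n s]) auto
  also have "\<dots> \<le> real (card J) * real n ^ (s - 2)"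
    using s by (intro shared_edges_var_le[OF _ n J v]) auto
  finally show ?thesis .
qed

text \<open>Double counting rewrites the sum with edge weights \<open>sum y e\<close> of order
  \<open>1 / n\<close>, and edge deviations are uncorrelated. The resulting second moment of order
  \<open>Q\<close> is smaller by a factor \<open>n\<close> than the variance of a single degree,
  which is what makes the cross terms negligible.\<close>

lemma weighted_degree_second_moment_le:
  assumes s: "s \<in> {2..r}" and n: "n \<ge> s + 2" and y: "\<And>u. u \<in> {1..n} \<Longrightarrow> \<bar>y u\<bar> \<le> C / real n"
  shows "measure_pmf.expectation (hypergraph_beta_model n r B)
           (\<lambda>H. (\<Sum>u=1..n. y u * centered_degree n s (B s) H u)\<^sup>2) \<le> real s * C\<^sup>2 * real n ^ (s - 2)"
proof -
  let ?M = "hypergraph_beta_model n r B" and ?N = "real n" and ?Q = "real n ^ (s - 2)"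
  interpret balanced_hypergraph "{1..n}" "hyperedges n s" s ?N ?Q "balance_constant s"
    by (rule balanced_hyperedges) (use s n in auto)
  let ?E = "hyperedges n s"
  have E: "?E \<subseteq> layered_hyperedges n r" using hyperedges_subset_layered[OF s] by auto
  have "measure_pmf.expectation ?M (\<lambda>H. (\<Sum>u=1..n. y u * centered_degree n s (B s) H u)\<^sup>2) =
      measure_pmf.expectation ?M (\<lambda>H. (\<Sum>e\<in>?E. sum y e * edge_dev B e H)\<^sup>2)"
  proof (intro integral_cong_AE)
    show "AE H in ?M. (\<Sum>u=1..n. y u * centered_degree n s (B s) H u)\<^sup>2 = (\<Sum>e\<in>?E. sum y e * edge_dev B e H)\<^sup>2"
      using AE_centered_degree[OF s, of n B]
      by eventually_elim (simp only: sum_incidence, simp only: mult.commute)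
  qed auto
  also have "\<dots> = (\<Sum>e\<in>?E. (sum y e)\<^sup>2 * logistic_deriv (sum (B (card e)) e))"
    by (rule edge_dev_sum_moments(2)[OF E])
  also have "\<dots> \<le> (\<Sum>e\<in>?E. (sum y e)\<^sup>2 * 1)"
    by (intro sum_mono mult_left_mono logistic_deriv_le_1) auto
  also have "\<dots> \<le> real s * ?N * ?Q * (\<Sum>u\<in>{1..n}. (y u)\<^sup>2)"
    using sum_edge_squares_le[of y] by simp
  also have "\<dots> \<le> real s * ?N * ?Q * (\<Sum>u\<in>{1..n}. (C / ?N)\<^sup>2)"
  proof (intro mult_left_mono sum_mono)
    fix u assume "u \<in> {1..n}"
    from power_mono[OF y[OF this] abs_ge_zero, of 2] show "(y u)\<^sup>2 \<le> (C / ?N)\<^sup>2" by simp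
  qed auto
  also have "\<dots> = real s * C\<^sup>2 * ?Q"
    using N_pos by (simp add: power2_eq_square)
  finally show ?thesis .
qed

text \<open>Used with \<open>a = sqrt Q\<close>, where it turns a second moment of order
  \<open>Q\<close> into a first moment of order \<open>sqrt Q\<close>.\<close>

lemma abs_le_square_div: 
  fixes z :: real
  assumes "a > 0"
  shows "\<bar>z\<bar> \<le> z\<^sup>2 / a + a"
proof -
  have "\<bar>z\<bar> * a \<le> z\<^sup>2 + a\<^sup>2"
  proof -
    have "2 * (\<bar>z\<bar> * a) \<le> z\<^sup>2 + a\<^sup>2"
      using sum_squares_bound[of "\<bar>z\<bar>" a] by (simp add: mult.assoc)
    moreover have "0 \<le> \<bar>z\<bar> * a" using assms by simp
    ultimately show ?thesis by linarith
  qed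
  thus ?thesis using assms by (simp add: field_simps power2_eq_square)
qed

text \<open>While all centered degrees are small, the estimator returns the unique minimizer and the
  expansion applies; the exceptional event costs the exponential term. Otherwise the error has mean
  of order \<open>sqrt Q\<close> before division by the standard deviation, which is at least of
  order \<open>sqrt (n * Q)\<close>, and Markov's inequality gives the second term. The constants
  are uniform in \<open>n\<close>, \<open>B\<close>, \<open>est\<close>, \<open>J\<close> and
  \<open>v\<close>.\<close>

lemma ml_estimate_linearization:
  assumes s: "s \<in> {2..r}" and M: "M > 0"
  obtains \<epsilon> K where "\<epsilon> > 0" and
    "\<And>n B est J v \<delta>. n \<ge> s + 2 \<Longrightarrow> (\<And>u. u \<in> {1..n} \<Longrightarrow> \<bar>B s u\<bar> \<le> M) \<Longrightarrow> ml_estimator n r s est \<Longrightarrow>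
       J \<subseteq> {1..n} \<Longrightarrow> card J \<le> a \<Longrightarrow> v \<in> J \<Longrightarrow> \<delta> > 0 \<Longrightarrow>
       measure_pmf.prob (hypergraph_beta_model n r B)
         {H. \<bar>degree_sd n r B s v * (est H v - B s v) - private_degree n s B J v H / degree_sd n r B s v\<bar> > \<delta>}
       \<le> 2 * real n * exp (- 2 * \<epsilon>\<^sup>2 * real n) + K / (\<delta> * sqrt (real n))"
proof -
  have s2: "s \<ge> 2" using s by simp
  obtain \<epsilon> C where \<epsilon>: "\<epsilon> > 0" and C: "C > 0" and expansion:
    "\<And>n \<beta> v. n \<ge> s + 2 \<Longrightarrow> (\<And>u. u \<in> {1..n} \<Longrightarrow> \<bar>\<beta> u\<bar> \<le> M) \<Longrightarrow> v \<in> {1..n} \<Longrightarrow>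
       \<exists>y. (\<forall>u\<in>{1..n}. \<bar>y u\<bar> \<le> C / real n) \<and>
         (\<forall>H. (\<forall>u\<in>{1..n}. \<bar>centered_degree n s \<beta> H u\<bar> \<le> \<epsilon> * (real n * real n ^ (s - 2))) \<longrightarrow>
           (\<exists>b. (\<forall>b'. is_ml_estimate n s H b' \<longleftrightarrow> b' = b) \<and>
             \<bar>degree_var n s \<beta> v * (b v - \<beta> v) - centered_degree n s \<beta> H v\<bar> \<le>
               \<bar>\<Sum>u=1..n. y u * centered_degree n s \<beta> H u\<bar> +
               C * ((centered_degree n s \<beta> H v)\<^sup>2 / (real n * real n ^ (s - 2)) +
                    (\<Sum>u=1..n. (centered_degree n s \<beta> H u)\<^sup>2) / ((real n)\<^sup>2 * real n ^ (s - 2)))))"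
    using ml_estimate_expansion[OF s2 M] by blast
  \<comment> \<open>One summand each for the cross terms, the quadratic terms and the shared
    hyperedges, in units of \<open>sqrt Q\<close>.\<close>
  define D where "D = (real s * C\<^sup>2 + 1) + 2 * C + (real a + 1)"
  define K where "K = D / sqrt (variance_constant s M)"
  have D: "D > 0" using C unfolding D_def by (intro add_pos_pos add_nonneg_pos) auto
  show ?thesis
  proof (rule that[OF \<epsilon>])
    fix n B est J v \<delta>
    assume n: "n \<ge> s + 2" and \<beta>: "\<And>u. u \<in> {1..n} \<Longrightarrow> \<bar>B s u\<bar> \<le> M" and est: "ml_estimator n r s est"
      and J: "J \<subseteq> {1..n}" and a: "card J \<le> a" and vJ: "v \<in> J" and \<delta>: "(\<delta>::real) > 0"
    let ?M = "hypergraph_beta_model n r B" and ?N = "real n" and ?Q = "real n ^ (s - 2)"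
    have N: "?N > 0" and Q1: "?Q \<ge> 1" using n by auto
    hence Q: "?Q > 0" by linarith
    have v: "v \<in> {1..n}" using J vJ by auto
    obtain y where y: "\<And>u. u \<in> {1..n} \<Longrightarrow> \<bar>y u\<bar> \<le> C / ?N"
      and exp: "\<And>H. (\<forall>u\<in>{1..n}. \<bar>centered_degree n s (B s) H u\<bar> \<le> \<epsilon> * (?N * ?Q)) \<Longrightarrow>
           (\<exists>b. (\<forall>b'. is_ml_estimate n s H b' \<longleftrightarrow> b' = b) \<and>
             \<bar>degree_var n s (B s) v * (b v - B s v) - centered_degree n s (B s) H v\<bar> \<le>
               \<bar>\<Sum>u=1..n. y u * centered_degree n s (B s) H u\<bar> +
               C * ((centered_degree n s (B s) H v)\<^sup>2 / (?N * ?Q) +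
                    (\<Sum>u=1..n. (centered_degree n s (B s) H u)\<^sup>2) / (?N\<^sup>2 * ?Q)))"
      using expansion[of n "B s" v, OF n \<beta> v] by blast
    define g where "g = centered_degree n s (B s)"
    define Y where "Y H = (\<Sum>u=1..n. y u * g H u)" for H
    define Z where "Z H = g H v - private_degree n s B J v H" for H
    \<comment> \<open>Off the event \<open>bad\<close> this dominates the distance of
      \<open>\<sigma> * \<sigma> * (est H v - B s v)\<close> from the private degree. It is defined
      for every \<open>H\<close>, so Markov's inequality applies without conditioning.\<close>
    define W where "W H = \<bar>Y H\<bar> + C * ((g H v)\<^sup>2 / (?N * ?Q) + (\<Sum>u=1..n. (g H u)\<^sup>2) / (?N\<^sup>2 * ?Q)) + \<bar>Z H\<bar>" for H
    have W0: "W H \<ge> 0" for H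
      using C N Q unfolding W_def by (intro add_nonneg_nonneg mult_nonneg_nonneg divide_nonneg_nonneg sum_nonneg) auto
    have abs_moment: "measure_pmf.expectation ?M (\<lambda>H. \<bar>f H\<bar>) \<le> (c + 1) * sqrt ?Q"
      if "measure_pmf.expectation ?M (\<lambda>H. (f H)\<^sup>2) \<le> c * ?Q" for f c
    proof -
      have q: "sqrt ?Q > 0" "?Q = sqrt ?Q * sqrt ?Q" using Q by auto
      have "measure_pmf.expectation ?M (\<lambda>H. \<bar>f H\<bar>) \<le> measure_pmf.expectation ?M (\<lambda>H. (f H)\<^sup>2 / sqrt ?Q + sqrt ?Q)"
        by (intro integral_mono abs_le_square_div q) auto
      also have "\<dots> = measure_pmf.expectation ?M (\<lambda>H. (f H)\<^sup>2) / sqrt ?Q + sqrt ?Q"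
        by (subst Bochner_Integration.integral_add) auto
      also have "\<dots> \<le> c * ?Q / sqrt ?Q + sqrt ?Q"
        using that q by (intro add_right_mono divide_right_mono) auto
      also have "c * ?Q / sqrt ?Q = c * sqrt ?Q"
        using q by (metis less_irrefl mult.assoc nonzero_mult_div_cancel_right)
      finally show ?thesis by (simp add: distrib_right)
    qed
    have EY: "measure_pmf.expectation ?M (\<lambda>H. \<bar>Y H\<bar>) \<le> (real s * C\<^sup>2 + 1) * sqrt ?Q"
      unfolding Y_def g_def by (intro abs_moment weighted_degree_second_moment_le[OF s n y])
    have EZ: "measure_pmf.expectation ?M (\<lambda>H. \<bar>Z H\<bar>) \<le> (real a + 1) * sqrt ?Q"
    proof -
      have "measure_pmf.expectation ?M (\<lambda>H. \<bar>Z H\<bar>) \<le> (real (card J) + 1) * sqrt ?Q"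
        unfolding Z_def g_def by (intro abs_moment shared_degree_second_moment_le[OF s n J vJ])
      also have "\<dots> \<le> (real a + 1) * sqrt ?Q" using a Q by (intro mult_right_mono) auto
      finally show ?thesis .
    qed
    have Eg: "measure_pmf.expectation ?M (\<lambda>H. (g H u)\<^sup>2) \<le> ?N * ?Q" if "u \<in> {1..n}" for u
      unfolding g_def centered_degree_second_moment[OF s] by (rule degree_var_le[OF s2 n that])
    have Eg1: "measure_pmf.expectation ?M (\<lambda>H. (g H v)\<^sup>2 / (?N * ?Q)) \<le> 1"
      using Eg[OF v] N Q by simp
    have Eg2: "measure_pmf.expectation ?M (\<lambda>H. (\<Sum>u=1..n. (g H u)\<^sup>2) / (?N\<^sup>2 * ?Q)) \<le> 1"
    proof -
      have "measure_pmf.expectation ?M (\<lambda>H. \<Sum>u=1..n. (g H u)\<^sup>2) = (\<Sum>u=1..n. measure_pmf.expectation ?M (\<lambda>H. (g H u)\<^sup>2))"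
        by (rule Bochner_Integration.integral_sum) auto
      also have "\<dots> \<le> (\<Sum>u=1..n. ?N * ?Q)" by (intro sum_mono Eg) auto
      also have "\<dots> = ?N\<^sup>2 * ?Q" by (simp add: power2_eq_square)
      finally show ?thesis using N Q by simp
    qed
    have "measure_pmf.expectation ?M W = measure_pmf.expectation ?M (\<lambda>H. \<bar>Y H\<bar>) +
        C * (measure_pmf.expectation ?M (\<lambda>H. (g H v)\<^sup>2 / (?N * ?Q)) +
             measure_pmf.expectation ?M (\<lambda>H. (\<Sum>u=1..n. (g H u)\<^sup>2) / (?N\<^sup>2 * ?Q))) +
        measure_pmf.expectation ?M (\<lambda>H. \<bar>Z H\<bar>)"
      unfolding W_def by (simp only: Bochner_Integration.integral_add integrable_beta_model integral_mult_right_zero)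
    also have "\<dots> \<le> (real s * C\<^sup>2 + 1) * sqrt ?Q + C * (1 + 1) + (real a + 1) * sqrt ?Q"
      using C by (intro add_mono mult_left_mono EY EZ Eg1 Eg2) auto
    \<comment> \<open>The quadratic terms are of order 1, and \<open>?Q \<ge> 1\<close> lets them be
      counted in the same unit as the others.\<close>
    also have "\<dots> \<le> (real s * C\<^sup>2 + 1) * sqrt ?Q + 2 * C * sqrt ?Q + (real a + 1) * sqrt ?Q"
      using C Q1 by simp
    also have "\<dots> = D * sqrt ?Q" by (simp add: D_def algebra_simps)
    finally have EW: "measure_pmf.expectation ?M W \<le> D * sqrt ?Q" .
    define \<sigma> where "\<sigma> = degree_sd n r B s v"
    have c: "variance_constant s M > 0" by (rule variance_constant_pos[OF s2])
    have var: "variance_constant s M * (?N * ?Q) \<le> degree_var n s (B s) v"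
      using degree_var_ge[OF s2 n \<beta> v] by simp
    have var_pos: "degree_var n s (B s) v > 0"
      by (rule less_le_trans[OF _ var]) (use c N Q in auto)
    have \<sigma>_eq: "\<sigma> = sqrt (degree_var n s (B s) v)" unfolding \<sigma>_def by (rule degree_sd_eq[OF s])
    have \<sigma>: "\<sigma> > 0" "\<sigma> * \<sigma> = degree_var n s (B s) v" using var_pos by (auto simp: \<sigma>_eq)
    have \<sigma>_ge: "sqrt (variance_constant s M) * sqrt ?N * sqrt ?Q \<le> \<sigma>"
      unfolding \<sigma>_eq using var by (simp flip: real_sqrt_mult add: mult.assoc)
    define bad where "bad = {H. \<exists>u\<in>{1..n}. \<bar>g H u\<bar> > \<epsilon> * (?N * ?Q)}"
    define large where "large = {H. \<bar>\<sigma> * (est H v - B s v) - private_degree n s B J v H / \<sigma>\<bar> > \<delta>}"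
    have "measure_pmf.prob ?M large \<le> measure_pmf.prob ?M (bad \<union> {H. W H \<ge> \<delta> * \<sigma>})"
    proof (rule measure_pmf.finite_measure_mono_AE)
      show "AE H in ?M. H \<in> large \<longrightarrow> H \<in> bad \<union> {H. W H \<ge> \<delta> * \<sigma>}"
      proof (rule AE_pmfI, rule impI)
        fix H assume H: "H \<in> set_pmf ?M" "H \<in> large"
        show "H \<in> bad \<union> {H. W H \<ge> \<delta> * \<sigma>}"
        proof (rule ccontr)
          assume "H \<notin> bad \<union> {H. W H \<ge> \<delta> * \<sigma>}"
          hence "H \<notin> bad" and small_W: "W H < \<delta> * \<sigma>" by auto
          have "\<forall>u\<in>{1..n}. \<bar>centered_degree n s (B s) H u\<bar> \<le> \<epsilon> * (?N * ?Q)"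
            using \<open>H \<notin> bad\<close> by (auto simp: bad_def g_def not_less)
          from exp[OF this] obtain b where b: "\<And>b'. is_ml_estimate n s H b' \<longleftrightarrow> b' = b"
            and bnd: "\<bar>\<sigma> * \<sigma> * (b v - B s v) - g H v\<bar> \<le> \<bar>Y H\<bar> +
               C * ((g H v)\<^sup>2 / (?N * ?Q) + (\<Sum>u=1..n. (g H u)\<^sup>2) / (?N\<^sup>2 * ?Q))"
            unfolding \<sigma>(2) g_def Y_def by blast
          have "\<exists>!b. is_ml_estimate n s H b" unfolding b by simp
          with est[unfolded ml_estimator_def, rule_format, OF set_pmf_beta_model[OF H(1)]]
          have "est H = b" unfolding b[symmetric] .
          have "\<bar>\<sigma> * \<sigma> * (b v - B s v) - private_degree n s B J v H\<bar> \<le> W H"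
            using bnd unfolding W_def Z_def by linarith
          hence "\<bar>\<sigma> * \<sigma> * (est H v - B s v) - private_degree n s B J v H\<bar> \<le> W H"
            unfolding \<open>est H = b\<close> .
          also have "\<sigma> * \<sigma> * (est H v - B s v) - private_degree n s B J v H =
              \<sigma> * (\<sigma> * (est H v - B s v) - private_degree n s B J v H / \<sigma>)"
            using \<sigma>(1) by (simp add: right_diff_distrib)
          finally have "\<sigma> * \<bar>\<sigma> * (est H v - B s v) - private_degree n s B J v H / \<sigma>\<bar> \<le> W H"
            using \<sigma>(1) by (simp add: abs_mult)
          moreover have "\<sigma> * \<delta> < \<sigma> * \<bar>\<sigma> * (est H v - B s v) - private_degree n s B J v H / \<sigma>\<bar>"
            using H(2) \<sigma>(1) by (simp add: large_def)
          ultimately show False using small_W by (simp add: mult.commute)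
        qed
      qed
    qed auto
    also have "\<dots> \<le> measure_pmf.prob ?M bad + measure_pmf.prob ?M {H. W H \<ge> \<delta> * \<sigma>}"
      by (rule measure_Un_le) auto
    also have "measure_pmf.prob ?M bad \<le> 2 * ?N * exp (- 2 * \<epsilon>\<^sup>2 * ?N)"
      unfolding bad_def g_def using \<epsilon> by (intro prob_large_centered_degree_le[OF s n]) auto
    also have "measure_pmf.prob ?M {H. W H \<ge> \<delta> * \<sigma>} \<le> K / (\<delta> * sqrt ?N)"
    proof -
      have "measure_pmf.prob ?M {H. W H \<ge> \<delta> * \<sigma>} \<le> measure_pmf.expectation ?M W / (\<delta> * \<sigma>)"
        using integral_Markov_inequality_measure[of "measure_pmf ?M" W "{}" "\<delta> * \<sigma>"] W0 \<delta> \<sigma>(1) by simp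
      also have "\<dots> \<le> D * sqrt ?Q / (\<delta> * \<sigma>)"
        using EW \<delta> \<sigma>(1) by (intro divide_right_mono) auto
      also have "\<dots> \<le> D * sqrt ?Q / (\<delta> * (sqrt (variance_constant s M) * sqrt ?N * sqrt ?Q))"
        using D Q \<delta> c N \<sigma>(1) by (intro divide_left_mono mult_left_mono \<sigma>_ge mult_pos_pos) auto
      also have "\<dots> = K / (\<delta> * sqrt ?N)"
        using Q by (simp add: K_def)
      finally show ?thesis .
    qed
    finally show "measure_pmf.prob ?M large \<le> 2 * ?N * exp (- 2 * \<epsilon>\<^sup>2 * ?N) + K / (\<delta> * sqrt ?N)" by simp
  qed
qed

section \<open>Weak convergence\<close>

lemma distr_PiM_componentwise:
  assumes fin: "finite I" and M: "\<And>i. i \<in> I \<Longrightarrow> prob_space (M i)"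
    and f: "\<And>i. i \<in> I \<Longrightarrow> f i \<in> measurable (M i) (N i)"
  shows "distr (PiM I M) (PiM I N) (\<lambda>\<omega>. \<lambda>i\<in>I. f i (\<omega> i)) = PiM I (\<lambda>i. distr (M i) (N i) (f i))"
proof -
  \<comment> \<open>\<open>product_prob_space\<close> asks for a probability space at every index,
    so the factors outside \<open>I\<close> are replaced by point masses.\<close>
  define M' where "M' i = (if i \<in> I then M i else return (count_space UNIV) undefined)" for i
  have M': "prob_space (M' i)" for i
    using M by (auto simp: M'_def intro: prob_space_return)
  define D where "D i = (if i \<in> I then distr (M i) (N i) (f i) else return (count_space UNIV) undefined)" for i
  have D: "prob_space (D i)" for i
    using M f by (auto simp: D_def intro: prob_space_return prob_space.prob_space_distr)
  interpret M': product_prob_space M' by (intro product_prob_spaceI M')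
  interpret D: product_prob_space D by (intro product_prob_spaceI D)
  have PM: "PiM I M = PiM I M'" and PD: "PiM I (\<lambda>i. distr (M i) (N i) (f i)) = PiM I D"
    by (auto simp: M'_def D_def intro!: PiM_cong)
  have meas: "(\<lambda>\<omega>. \<lambda>i\<in>I. f i (\<omega> i)) \<in> measurable (PiM I M') (PiM I N)"
    using f by (intro measurable_restrict) (auto simp: M'_def intro!: measurable_compose[OF measurable_component_singleton])
  have sets: "sets (distr (PiM I M') (PiM I N) (\<lambda>\<omega>. \<lambda>i\<in>I. f i (\<omega> i))) = sets (PiM I D)"
    unfolding sets_distr by (intro sets_PiM_cong) (auto simp: D_def)
  show ?thesis
    unfolding PM PD
  proof (rule D.PiM_eqI[OF fin sets])
    fix A assume A: "\<And>i. i \<in> I \<Longrightarrow> A i \<in> sets (D i)"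
    hence A': "A i \<in> sets (N i)" if "i \<in> I" for i using that by (simp add: D_def)
    define B where "B i = f i -` A i \<inter> space (M i)" for i
    have B: "B i \<in> sets (M' i)" if "i \<in> I" for i
      using measurable_sets[OF f[OF that] A'[OF that]] that by (simp add: B_def M'_def)
    have "emeasure (distr (PiM I M') (PiM I N) (\<lambda>\<omega>. \<lambda>i\<in>I. f i (\<omega> i))) (PiE I A) =
        emeasure (PiM I M') ((\<lambda>\<omega>. \<lambda>i\<in>I. f i (\<omega> i)) -` PiE I A \<inter> space (PiM I M'))"
      using A' by (intro emeasure_distr meas sets_PiM_I_finite fin)
    also have "(\<lambda>\<omega>. \<lambda>i\<in>I. f i (\<omega> i)) -` PiE I A \<inter> space (PiM I M') = PiE I B"
      by (auto simp: space_PiM PiE_iff B_def M'_def)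
    also have "emeasure (PiM I M') (PiE I B) = (\<Prod>i\<in>I. emeasure (M' i) (B i))"
      by (intro M'.emeasure_PiM fin B)
    also have "\<dots> = (\<Prod>i\<in>I. emeasure (D i) (A i))"
      using A' f by (intro prod.cong refl) (auto simp: B_def M'_def D_def emeasure_distr)
    finally show "emeasure (distr (PiM I M') (PiM I N) (\<lambda>\<omega>. \<lambda>i\<in>I. f i (\<omega> i))) (PiE I A) =
        (\<Prod>i\<in>I. emeasure (D i) (A i))" .
  qed
qed

lemma continuous_on_restrict_product:
  assumes "continuous_map (product_topology (\<lambda>_. euclideanreal) K) euclideanreal f"
  shows "continuous_on UNIV (\<lambda>x. f (restrict x K))"
proof -
  have "continuous_map (product_topology (\<lambda>_. euclideanreal) UNIV) (product_topology (\<lambda>_. euclideanreal) K)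
          (\<lambda>x. restrict x K)"
    by (subst continuous_map_componentwise) (auto intro!: continuous_map_eq[OF continuous_map_product_projection])
  from continuous_map_compose[OF this assms]
  show ?thesis by (simp add: euclidean_product_topology o_def)
qed

text \<open>Composed with restriction, \<open>f\<close> is continuous on all functions, where
  countability of the index type identifies the Borel and the product sigma-algebra; extension by 0
  brings the result back to \<open>K\<close>.\<close>

lemma borel_measurable_continuous_PiM:
  fixes K :: "'i::countable set"
  assumes "continuous_map (product_topology (\<lambda>_. euclideanreal) K) euclideanreal f"
  shows "f \<in> borel_measurable (PiM K (\<lambda>_. borel))"
proof -
  have "(\<lambda>x. f (restrict x K)) \<in> borel_measurable borel"
    by (intro borel_measurable_continuous_onI continuous_on_restrict_product assms)
  hence 1: "(\<lambda>x. f (restrict x K)) \<in> borel_measurable (PiM UNIV (\<lambda>_. borel))"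
    by (simp only: measurable_cong_sets[OF sets_PiM_equal_borel refl])
  have 2: "(\<lambda>x i. if i \<in> K then x i else 0) \<in> measurable (PiM K (\<lambda>_. borel)) (PiM UNIV (\<lambda>_. borel :: real measure))"
  proof (intro measurable_PiM_single')
    fix i :: 'i
    show "(\<lambda>\<omega>. if i \<in> K then \<omega> i else 0) \<in> borel_measurable (PiM K (\<lambda>_. borel))"
      by (cases "i \<in> K") (auto intro: measurable_component_singleton)
  qed auto
  have "(\<lambda>x. f (restrict (\<lambda>i. if i \<in> K then x i else 0) K)) \<in> borel_measurable (PiM K (\<lambda>_. borel))"
    by (rule measurable_compose[OF 2 1])
  moreover have "restrict (\<lambda>i. if i \<in> K then x i else 0) K = x" if "x \<in> space (PiM K (\<lambda>_. borel))" for x :: "'i \<Rightarrow> real"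
    using that by (auto simp: space_PiM fun_eq_iff PiE_iff extensional_def)
  ultimately show ?thesis
    by (subst measurable_cong[where g="\<lambda>x. f (restrict (\<lambda>i. if i \<in> K then x i else 0) K)"]) auto
qed

text \<open>Heine-Cantor with closeness measured coordinatewise. Arguing by sequences avoids a
  comparison with the metric of the function space; extension by 0 outside \<open>K\<close> places
  them in one compact product.\<close>

lemma uniformly_continuous_on_box:
  fixes K :: "'i::countable set"
  assumes f: "continuous_map (product_topology (\<lambda>_. euclideanreal) K) euclideanreal f"
    and \<epsilon>: "\<epsilon> > 0"
  shows "\<exists>\<delta>>0. \<forall>x\<in>PiE K (\<lambda>_. UNIV). \<forall>y\<in>PiE K (\<lambda>_. UNIV).
     (\<forall>k\<in>K. \<bar>x k\<bar> \<le> C \<and> \<bar>y k\<bar> \<le> C \<and> \<bar>x k - y k\<bar> \<le> \<delta>) \<longrightarrow> \<bar>f x - f y\<bar> < \<epsilon>"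
proof (rule ccontr)
  assume neg: "\<not> ?thesis"
  define bad where "bad m xy \<longleftrightarrow> fst xy \<in> PiE K (\<lambda>_. UNIV) \<and> snd xy \<in> PiE K (\<lambda>_. UNIV) \<and>
     (\<forall>k\<in>K. \<bar>fst xy k\<bar> \<le> C \<and> \<bar>snd xy k\<bar> \<le> C \<and> \<bar>fst xy k - snd xy k\<bar> \<le> inverse (real (Suc m))) \<and>
     \<not> \<bar>f (fst xy) - f (snd xy)\<bar> < \<epsilon>" for m xy
  have "\<exists>xy. bad m xy" for m
  proof -
    obtain x y where "x \<in> PiE K (\<lambda>_. UNIV)" "y \<in> PiE K (\<lambda>_. UNIV)"
      "\<forall>k\<in>K. \<bar>x k\<bar> \<le> C \<and> \<bar>y k\<bar> \<le> C \<and> \<bar>x k - y k\<bar> \<le> inverse (real (Suc m))"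
      "\<not> \<bar>f x - f y\<bar> < \<epsilon>"
      using neg[unfolded not_ex, THEN spec, of "inverse (real (Suc m))"] by auto
    thus ?thesis by (intro exI[of _ "(x, y)"]) (simp add: bad_def)
  qed
  then obtain xy where "\<And>m. bad m (xy m)" by metis
  moreover define x y where "x m = fst (xy m)" and "y m = snd (xy m)" for m
  ultimately have xy:  "\<And>m. x m \<in> PiE K (\<lambda>_. UNIV)" "\<And>m. y m \<in> PiE K (\<lambda>_. UNIV)"
      "\<And>m k. k \<in> K \<Longrightarrow> \<bar>x m k\<bar> \<le> C" "\<And>m k. k \<in> K \<Longrightarrow> \<bar>y m k\<bar> \<le> C"
      "\<And>m k. k \<in> K \<Longrightarrow> \<bar>x m k - y m k\<bar> \<le> inverse (real (Suc m))"
      "\<And>m. \<bar>f (x m) - f (y m)\<bar> \<ge> \<epsilon>"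
    unfolding bad_def not_less by auto
  define z where "z u k = (if k \<in> K then u k else 0)" for u :: "'i \<Rightarrow> real" and k
  have rz: "restrict (z u) K = u" if "u \<in> PiE K (\<lambda>_. UNIV)" for u
    using that by (auto simp: z_def fun_eq_iff PiE_iff extensional_def)
  define S :: "'i \<Rightarrow> real set" where "S k = (if k \<in> K then {-C..C} else {0})" for k
  have "compactin (product_topology (\<lambda>_. euclideanreal) UNIV) (PiE UNIV S)"
    by (subst compactin_PiE) (auto simp: S_def)
  hence "compact (PiE UNIV S)"
    by (simp add: euclidean_product_topology)
  hence "seq_compact (PiE UNIV S)"
    by (simp add: compact_eq_seq_compact_metric)
  moreover have "z (x m) \<in> PiE UNIV S" for m
    using xy(3)[of _ m] by (auto simp: PiE_UNIV_domain z_def S_def abs_le_iff minus_le_iff)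
  ultimately obtain l r where r: "strict_mono r" "((\<lambda>m. z (x m)) \<circ> r) \<longlonglongrightarrow> l"
    unfolding seq_compact_def by meson
  have coord: "(u \<longlongrightarrow> u0) sequentially \<longleftrightarrow> (\<forall>k. (\<lambda>m. u m k) \<longlonglongrightarrow> u0 k)" for u :: "nat \<Rightarrow> 'i \<Rightarrow> real" and u0
    using limitin_componentwise[of "\<lambda>_. euclideanreal" UNIV u u0 sequentially]
    by (simp add: euclidean_product_topology)
  have xl: "(\<lambda>m. z (x (r m)) k) \<longlonglongrightarrow> l k" for k
    using r(2) coord[of "(\<lambda>m. z (x m)) \<circ> r" l] by simp
  have "(\<lambda>m. z (x (r m)) k - z (y (r m)) k) \<longlonglongrightarrow> 0" for k
  proof (rule Lim_null_comparison)
    show "eventually (\<lambda>m. norm (z (x (r m)) k - z (y (r m)) k) \<le> inverse (real (Suc (r m)))) sequentially"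
      using xy(5)[of k] by (auto simp: z_def)
    show "(\<lambda>m. inverse (real (Suc (r m)))) \<longlonglongrightarrow> 0"
      using LIMSEQ_subseq_LIMSEQ[OF LIMSEQ_inverse_real_of_nat r(1)] by (simp add: o_def)
  qed
  hence yl: "(\<lambda>m. z (y (r m)) k) \<longlonglongrightarrow> l k" for k
    using tendsto_diff[OF xl[of k], of "\<lambda>m. z (x (r m)) k - z (y (r m)) k" 0] by simp
  have cont: "isCont (\<lambda>x. f (restrict x K)) l"
    using continuous_on_restrict_product[OF f] by (simp add: continuous_on_eq_continuous_at)
  have "(\<lambda>m. f (x (r m))) \<longlonglongrightarrow> f (restrict l K)"
    using isCont_tendsto_compose[OF cont, of "\<lambda>m. z (x (r m))"] xl coord[of "\<lambda>m. z (x (r m))" l] rz xy(1) by simp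
  moreover have "(\<lambda>m. f (y (r m))) \<longlonglongrightarrow> f (restrict l K)"
    using isCont_tendsto_compose[OF cont, of "\<lambda>m. z (y (r m))"] yl coord[of "\<lambda>m. z (y (r m))" l] rz xy(2) by simp
  ultimately have "(\<lambda>m. f (x (r m)) - f (y (r m))) \<longlonglongrightarrow> 0"
    using tendsto_diff by fastforce
  from tendstoD[OF this \<epsilon>] obtain m where "\<bar>f (x (r m)) - f (y (r m))\<bar> < \<epsilon>"
    by (auto simp: eventually_sequentially)
  with xy(6)[of "r m"] show False by simp
qed

text \<open>Skorohod's theorem realizes each coordinate by pointwise convergent variables on a space
  of its own. On the product of these spaces all coordinates converge together and have the required
  product laws, so dominated convergence applies to \<open>f\<close>.\<close>

lemma weakly_converges_PiM:
  fixes K :: "'i::countable set"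
  assumes fin: "finite K"
    and \<mu>: "\<And>n i. i \<in> K \<Longrightarrow> real_distribution (\<mu> n i)" and \<nu>: "\<And>i. i \<in> K \<Longrightarrow> real_distribution (\<nu> i)"
    and conv: "\<And>i. i \<in> K \<Longrightarrow> weak_conv_m (\<lambda>n. \<mu> n i) (\<nu> i)"
  shows "weakly_converges (product_topology (\<lambda>_. euclideanreal) K) (\<lambda>n. PiM K (\<mu> n)) (PiM K \<nu>)"
  unfolding weakly_converges_def
proof safe
  fix f :: "('i \<Rightarrow> real) \<Rightarrow> real"
  assume f: "continuous_map (product_topology (\<lambda>_. euclideanreal) K) euclideanreal f"
    and bdd: "bounded (f ` topspace (product_topology (\<lambda>_. euclideanreal) K))"
  obtain B where B: "\<And>x. x \<in> PiE K (\<lambda>_. UNIV) \<Longrightarrow> \<bar>f x\<bar> \<le> B"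
    using bdd by (auto simp: bounded_iff)
  define good where "good i T \<longleftrightarrow> (case T of (\<Omega>, Y, Y') \<Rightarrow>
      prob_space \<Omega> \<and> (\<forall>n. Y n \<in> borel_measurable \<Omega>) \<and> (\<forall>n. distr \<Omega> borel (Y n) = \<mu> n i) \<and>
      Y' \<in> borel_measurable \<Omega> \<and> distr \<Omega> borel Y' = \<nu> i \<and> (\<forall>x\<in>space \<Omega>. (\<lambda>n. Y n x) \<longlonglongrightarrow> Y' x))"
    for i :: 'i and T :: "real measure \<times> (nat \<Rightarrow> real \<Rightarrow> real) \<times> (real \<Rightarrow> real)"
  have "\<exists>T. good i T" if "i \<in> K" for i
    using Skorohod[OF \<mu>[OF that] \<nu>[OF that] conv[OF that]]
    unfolding good_def split_paired_Ex split_conv measurable_lborel1 by blast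
  then obtain T where T: "\<And>i. i \<in> K \<Longrightarrow> good i (T i)" by metis
  define \<Omega> Y Y' where "\<Omega> i = fst (T i)" and "Y i = fst (snd (T i))" and "Y' i = snd (snd (T i))" for i
  have \<Omega>: "\<And>i. i \<in> K \<Longrightarrow> prob_space (\<Omega> i)"
    and Y: "\<And>i n. i \<in> K \<Longrightarrow> Y i n \<in> borel_measurable (\<Omega> i)" "\<And>i n. i \<in> K \<Longrightarrow> distr (\<Omega> i) borel (Y i n) = \<mu> n i"
    and Y': "\<And>i. i \<in> K \<Longrightarrow> Y' i \<in> borel_measurable (\<Omega> i)" "\<And>i. i \<in> K \<Longrightarrow> distr (\<Omega> i) borel (Y' i) = \<nu> i"
    and YY': "\<And>i x. i \<in> K \<Longrightarrow> x \<in> space (\<Omega> i) \<Longrightarrow> (\<lambda>n. Y i n x) \<longlonglongrightarrow> Y' i x"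
    using T unfolding good_def \<Omega>_def Y_def Y'_def by (auto simp: case_prod_beta)
  define P where "P = PiM K \<Omega>"
  interpret P: prob_space P unfolding P_def by (intro prob_space_PiM \<Omega>)
  have meas: "(\<lambda>\<omega>. \<lambda>i\<in>K. Z i (\<omega> i)) \<in> measurable P (PiM K (\<lambda>_. borel))"
    if "\<And>i. i \<in> K \<Longrightarrow> Z i \<in> borel_measurable (\<Omega> i)" for Z :: "'i \<Rightarrow> real \<Rightarrow> real"
    using that unfolding P_def
    by (intro measurable_restrict) (auto intro!: measurable_compose[OF measurable_component_singleton])
  have fm [measurable]: "f \<in> borel_measurable (PiM K (\<lambda>_. borel))"
    by (rule borel_measurable_continuous_PiM[OF f])
  have int: "(\<integral>x. f x \<partial>PiM K (\<lambda>i. distr (\<Omega> i) borel (Z i))) = (\<integral>\<omega>. f (\<lambda>i\<in>K. Z i (\<omega> i)) \<partial>P)"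
    if Z: "\<And>i. i \<in> K \<Longrightarrow> Z i \<in> borel_measurable (\<Omega> i)" for Z :: "'i \<Rightarrow> real \<Rightarrow> real"
  proof -
    have "PiM K (\<lambda>i. distr (\<Omega> i) borel (Z i)) = distr P (PiM K (\<lambda>_. borel)) (\<lambda>\<omega>. \<lambda>i\<in>K. Z i (\<omega> i))"
      unfolding P_def by (rule distr_PiM_componentwise[symmetric, OF fin \<Omega> Z])
    thus ?thesis by (simp add: integral_distr[OF meas[OF Z] fm])
  qed
  have \<mu>_eq: "PiM K (\<mu> n) = PiM K (\<lambda>i. distr (\<Omega> i) borel (Y i n))" for n
    using Y(2) by (intro PiM_cong) auto
  have \<nu>_eq: "PiM K \<nu> = PiM K (\<lambda>i. distr (\<Omega> i) borel (Y' i))"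
    using Y'(2) by (intro PiM_cong) auto
  have "(\<lambda>n. \<integral>\<omega>. f (\<lambda>i\<in>K. Y i n (\<omega> i)) \<partial>P) \<longlonglongrightarrow> (\<integral>\<omega>. f (\<lambda>i\<in>K. Y' i (\<omega> i)) \<partial>P)"
  proof (rule integral_dominated_convergence[where w="\<lambda>_. B"])
    show "AE \<omega> in P. (\<lambda>n. f (\<lambda>i\<in>K. Y i n (\<omega> i))) \<longlonglongrightarrow> f (\<lambda>i\<in>K. Y' i (\<omega> i))"
    proof (rule AE_I2)
      fix \<omega> assume "\<omega> \<in> space P"
      hence "limitin (product_topology (\<lambda>_. euclideanreal) K) (\<lambda>n. \<lambda>i\<in>K. Y i n (\<omega> i)) (\<lambda>i\<in>K. Y' i (\<omega> i)) sequentially"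
        using YY' by (subst limitin_componentwise) (auto simp: P_def space_PiM PiE_iff)
      from continuous_map_limit[OF f this]
      show "(\<lambda>n. f (\<lambda>i\<in>K. Y i n (\<omega> i))) \<longlonglongrightarrow> f (\<lambda>i\<in>K. Y' i (\<omega> i))"
        by (simp add: o_def)
    qed
  qed (use B measurable_compose[OF meas fm] Y Y' in auto)
  thus "(\<lambda>n. \<integral>x. f x \<partial>PiM K (\<mu> n)) \<longlonglongrightarrow> (\<integral>x. f x \<partial>PiM K \<nu>)"
    unfolding \<mu>_eq \<nu>_eq using Y(1) Y'(1) by (simp add: int)
qed


lemma integral_distr_restrict:
  fixes K :: "'i::countable set"
  assumes f: "continuous_map (product_topology (\<lambda>_. euclideanreal) K) euclideanreal f"
    and X: "\<And>k. k \<in> K \<Longrightarrow> X k \<in> borel_measurable M"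
  shows "(\<integral>x. f x \<partial>distr M (PiM K (\<lambda>_. borel)) (\<lambda>\<omega>. \<lambda>k\<in>K. X k \<omega>)) = (\<integral>\<omega>. f (\<lambda>k\<in>K. X k \<omega>) \<partial>M)"
    and "(\<lambda>\<omega>. f (\<lambda>k\<in>K. X k \<omega>)) \<in> borel_measurable M"
proof -
  have m: "(\<lambda>\<omega>. \<lambda>k\<in>K. X k \<omega>) \<in> measurable M (PiM K (\<lambda>_. borel))"
    by (intro measurable_restrict X)
  note fm = borel_measurable_continuous_PiM[OF f]
  show "(\<integral>x. f x \<partial>distr M (PiM K (\<lambda>_. borel)) (\<lambda>\<omega>. \<lambda>k\<in>K. X k \<omega>)) = (\<integral>\<omega>. f (\<lambda>k\<in>K. X k \<omega>) \<partial>M)"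
    by (rule integral_distr[OF m fm])
  show "(\<lambda>\<omega>. f (\<lambda>k\<in>K. X k \<omega>)) \<in> borel_measurable M"
    by (rule measurable_compose[OF m fm])
qed

text \<open>Slutsky's lemma. A bounded continuous \<open>f\<close> is in general uniformly
  continuous on boxes only, so closeness in probability is combined with tightness of
  \<open>Z\<close>; elsewhere the two values of \<open>f\<close> differ by at most
  \<open>2 * B\<close>.\<close>

lemma converges_in_distribution_perturb:
  fixes K :: "'i::countable set"
  assumes fin: "finite K" and M: "\<And>n. prob_space (M n)"
    and X: "\<And>n k. k \<in> K \<Longrightarrow> X n k \<in> borel_measurable (M n)"
    and Z: "\<And>n k. k \<in> K \<Longrightarrow> Z n k \<in> borel_measurable (M n)"
    and conv: "converges_in_distribution K M (\<lambda>n \<omega>. \<lambda>k\<in>K. Z n k \<omega>) \<nu>"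
    and tight: "\<And>\<epsilon>. \<epsilon> > 0 \<Longrightarrow> \<exists>C. \<forall>k\<in>K. eventually (\<lambda>n. measure (M n) {\<omega>\<in>space (M n). \<bar>Z n k \<omega>\<bar> > C} \<le> \<epsilon>) sequentially"
    and close: "\<And>k \<delta>. k \<in> K \<Longrightarrow> \<delta> > 0 \<Longrightarrow>
        (\<lambda>n. measure (M n) {\<omega>\<in>space (M n). \<bar>X n k \<omega> - Z n k \<omega>\<bar> > \<delta>}) \<longlonglongrightarrow> 0"
  shows "converges_in_distribution K M (\<lambda>n \<omega>. \<lambda>k\<in>K. X n k \<omega>) \<nu>"
  unfolding converges_in_distribution_def weakly_converges_def
proof safe
  fix f :: "('i \<Rightarrow> real) \<Rightarrow> real"
  assume f: "continuous_map (product_topology (\<lambda>_. euclideanreal) K) euclideanreal f"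
    and bdd: "bounded (f ` topspace (product_topology (\<lambda>_. euclideanreal) K))"
  obtain B where B: "\<And>x. x \<in> PiE K (\<lambda>_. UNIV) \<Longrightarrow> \<bar>f x\<bar> \<le> B" and B0: "B > 0"
    using bdd by (auto simp: bounded_pos)
  define fX fZ where "fX n \<omega> = f (\<lambda>k\<in>K. X n k \<omega>)" and "fZ n \<omega> = f (\<lambda>k\<in>K. Z n k \<omega>)" for n \<omega>
  have fXm [measurable]: "fX n \<in> borel_measurable (M n)" and fZm [measurable]: "fZ n \<in> borel_measurable (M n)" for n
    unfolding fX_def fZ_def using integral_distr_restrict(2)[OF f] X Z by blast+
  have fXB: "\<bar>fX n \<omega>\<bar> \<le> B" and fZB: "\<bar>fZ n \<omega>\<bar> \<le> B" for n \<omega>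
    unfolding fX_def fZ_def by (auto intro!: B)
  have int: "integrable (M n) (fX n)" "integrable (M n) (fZ n)" for n
  proof -
    interpret prob_space "M n" by (rule M)
    show "integrable (M n) (fX n)" "integrable (M n) (fZ n)"
      using fXB fZB by (auto intro!: integrable_const_bound[where B=B])
  qed
  have Zlim: "(\<lambda>n. \<integral>\<omega>. fZ n \<omega> \<partial>M n) \<longlonglongrightarrow> (\<integral>x. f x \<partial>\<nu>)"
  proof -
    have "(\<integral>x. f x \<partial>distr (M n) (PiM K (\<lambda>_. borel)) (\<lambda>\<omega>. \<lambda>k\<in>K. Z n k \<omega>)) = (\<integral>\<omega>. fZ n \<omega> \<partial>M n)" for n
      unfolding fZ_def by (rule integral_distr_restrict(1)[OF f Z])
    thus ?thesis
      using conv f bdd unfolding converges_in_distribution_def weakly_converges_def by auto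
  qed
  have "(\<lambda>n. (\<integral>\<omega>. fX n \<omega> \<partial>M n) - (\<integral>\<omega>. fZ n \<omega> \<partial>M n)) \<longlonglongrightarrow> 0"
  proof (rule LIMSEQ_I)
    fix r :: real assume r: "r > 0"
    \<comment> \<open>Balances \<open>\<epsilon>\<close> on the good event against
      \<open>card K\<close> exceptional sets of probability at most \<open>2 * \<epsilon>\<close>,
      each costing \<open>2 * B\<close>. The 2 in place of 1 makes the final inequality
      strict.\<close>
    define \<epsilon> where "\<epsilon> = r / (2 + 4 * B * real (card K))"
    have D: "2 + 4 * B * real (card K) > 0" using B0 by (intro add_pos_nonneg) auto
    have \<epsilon>: "\<epsilon> > 0" using r D by (simp add: \<epsilon>_def)
    obtain C where C: "\<forall>k\<in>K. eventually (\<lambda>n. measure (M n) {\<omega>\<in>space (M n). \<bar>Z n k \<omega>\<bar> > C} \<le> \<epsilon>) sequentially"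
      using tight[OF \<epsilon>] by blast
    obtain \<delta>0 where "\<delta>0 > 0" and unif: "\<forall>x\<in>PiE K (\<lambda>_. UNIV). \<forall>y\<in>PiE K (\<lambda>_. UNIV).
        (\<forall>k\<in>K. \<bar>x k\<bar> \<le> C + 1 \<and> \<bar>y k\<bar> \<le> C + 1 \<and> \<bar>x k - y k\<bar> \<le> \<delta>0) \<longrightarrow> \<bar>f x - f y\<bar> < \<epsilon>"
      using uniformly_continuous_on_box[OF f \<epsilon>, of "C + 1"] by (elim exE conjE) (rule that)
    \<comment> \<open>\<open>\<delta> \<le> 1\<close> keeps \<open>X\<close> in the box of
      half-width \<open>C + 1\<close> whenever \<open>Z\<close> lies in that of half-width
      \<open>C\<close>.\<close>
    define \<delta> where "\<delta> = min \<delta>0 1"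
    have \<delta>: "\<delta> > 0" using \<open>\<delta>0 > 0\<close> by (simp add: \<delta>_def)
    have "eventually (\<lambda>n. measure (M n) {\<omega>\<in>space (M n). \<bar>X n k \<omega> - Z n k \<omega>\<bar> > \<delta>} < \<epsilon>) sequentially"
      if "k \<in> K" for k
      using order_tendstoD(2)[OF close[OF that \<delta>] \<epsilon>] .
    hence "eventually (\<lambda>n. \<forall>k\<in>K. measure (M n) {\<omega>\<in>space (M n). \<bar>Z n k \<omega>\<bar> > C} \<le> \<epsilon> \<and>
        measure (M n) {\<omega>\<in>space (M n). \<bar>X n k \<omega> - Z n k \<omega>\<bar> > \<delta>} < \<epsilon>) sequentially"
      using C fin by (simp add: eventually_ball_finite_distrib eventually_conj_iff)
    then obtain n0 where n0: "\<And>n k. n \<ge> n0 \<Longrightarrow> k \<in> K \<Longrightarrow>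
        measure (M n) {\<omega>\<in>space (M n). \<bar>Z n k \<omega>\<bar> > C} \<le> \<epsilon> \<and>
        measure (M n) {\<omega>\<in>space (M n). \<bar>X n k \<omega> - Z n k \<omega>\<bar> > \<delta>} < \<epsilon>"
      by (auto simp: eventually_sequentially)
    show "\<exists>no. \<forall>n\<ge>no. norm ((\<integral>\<omega>. fX n \<omega> \<partial>M n) - (\<integral>\<omega>. fZ n \<omega> \<partial>M n) - 0) < r"
    proof (intro exI allI impI)
      fix n assume n: "n \<ge> n0"
      interpret prob_space "M n" by (rule M)
      define S where "S k = {\<omega>\<in>space (M n). \<bar>Z n k \<omega>\<bar> > C} \<union> {\<omega>\<in>space (M n). \<bar>X n k \<omega> - Z n k \<omega>\<bar> > \<delta>}" for k
      have S [measurable]: "S k \<in> sets (M n)" if "k \<in> K" for k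
        using X[OF that, of n] Z[OF that, of n] unfolding S_def by measurable
      have Sle: "measure (M n) (S k) \<le> 2 * \<epsilon>" if k: "k \<in> K" for k
      proof -
        have "measure (M n) (S k) \<le> measure (M n) {\<omega>\<in>space (M n). \<bar>Z n k \<omega>\<bar> > C} +
            measure (M n) {\<omega>\<in>space (M n). \<bar>X n k \<omega> - Z n k \<omega>\<bar> > \<delta>}"
        proof -
          note [measurable] = X[OF k, of n] Z[OF k, of n]
          have "{\<omega>\<in>space (M n). \<bar>Z n k \<omega>\<bar> > C} \<in> sets (M n)" by measurable
          moreover have "{\<omega>\<in>space (M n). \<bar>X n k \<omega> - Z n k \<omega>\<bar> > \<delta>} \<in> sets (M n)" by measurable
          ultimately show ?thesis unfolding S_def by (rule measure_Un_le)
        qed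
        thus ?thesis using n0[OF n k] by simp
      qed
      have pt: "\<bar>fX n \<omega> - fZ n \<omega>\<bar> \<le> \<epsilon> + (\<Sum>k\<in>K. 2 * B * indicator (S k) \<omega>)" if \<omega>: "\<omega> \<in> space (M n)" for \<omega>
      proof (cases "\<exists>k\<in>K. \<omega> \<in> S k")
        case True
        then obtain k where k: "k \<in> K" "\<omega> \<in> S k" by blast
        have "\<bar>fX n \<omega> - fZ n \<omega>\<bar> \<le> 2 * B * indicator (S k) \<omega>"
          using fXB[of n \<omega>] fZB[of n \<omega>] k(2) by simp
        also have "\<dots> \<le> (\<Sum>k\<in>K. 2 * B * indicator (S k) \<omega>)"
          using B0 k(1) fin by (intro member_le_sum) auto
        finally show ?thesis using \<epsilon> by linarith
      next
        case False
        have "\<bar>fX n \<omega> - fZ n \<omega>\<bar> < \<epsilon>"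
          unfolding fX_def fZ_def
        proof (rule unif[THEN bspec, THEN bspec, THEN mp])
          show "\<forall>k\<in>K. \<bar>(\<lambda>k\<in>K. X n k \<omega>) k\<bar> \<le> C + 1 \<and> \<bar>(\<lambda>k\<in>K. Z n k \<omega>) k\<bar> \<le> C + 1 \<and>
              \<bar>(\<lambda>k\<in>K. X n k \<omega>) k - (\<lambda>k\<in>K. Z n k \<omega>) k\<bar> \<le> \<delta>0"
          proof
            fix k assume k: "k \<in> K"
            hence "\<bar>Z n k \<omega>\<bar> \<le> C" "\<bar>X n k \<omega> - Z n k \<omega>\<bar> \<le> \<delta>" using False \<omega> by (auto simp: S_def not_less)
            thus "\<bar>(\<lambda>k\<in>K. X n k \<omega>) k\<bar> \<le> C + 1 \<and> \<bar>(\<lambda>k\<in>K. Z n k \<omega>) k\<bar> \<le> C + 1 \<and>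
              \<bar>(\<lambda>k\<in>K. X n k \<omega>) k - (\<lambda>k\<in>K. Z n k \<omega>) k\<bar> \<le> \<delta>0"
              using k unfolding \<delta>_def by auto
          qed
        qed auto
        moreover have "(\<Sum>k\<in>K. 2 * B * indicator (S k) \<omega>) \<ge> 0"
          using B0 by (intro sum_nonneg) auto
        ultimately show ?thesis by linarith
      qed
      have "\<bar>(\<integral>\<omega>. fX n \<omega> \<partial>M n) - (\<integral>\<omega>. fZ n \<omega> \<partial>M n)\<bar> = \<bar>\<integral>\<omega>. fX n \<omega> - fZ n \<omega> \<partial>M n\<bar>"
        by (simp add: int)
      also have "\<dots> \<le> (\<integral>\<omega>. \<bar>fX n \<omega> - fZ n \<omega>\<bar> \<partial>M n)"
        by (rule integral_abs_bound)
      also have "\<dots> \<le> (\<integral>\<omega>. \<epsilon> + (\<Sum>k\<in>K. 2 * B * indicator (S k) \<omega>) \<partial>M n)"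
        using pt S by (intro integral_mono) (auto intro!: int Bochner_Integration.integrable_sum integrable_real_mult_indicator)
      also have "\<dots> = \<epsilon> + (\<Sum>k\<in>K. 2 * B * measure (M n) (S k))"
      proof -
        have i: "integrable (M n) (\<lambda>\<omega>. 2 * B * indicator (S k) \<omega>)" if "k \<in> K" for k
          using S[OF that] by (intro integrable_mult_right integrable_real_indicator) (auto simp: emeasure_eq_measure)
        have "(\<integral>\<omega>. (\<Sum>k\<in>K. 2 * B * indicator (S k) \<omega>) \<partial>M n) = (\<Sum>k\<in>K. \<integral>\<omega>. 2 * B * indicator (S k) \<omega> \<partial>M n)"
          by (rule Bochner_Integration.integral_sum[OF i])
        also have "\<dots> = (\<Sum>k\<in>K. 2 * B * measure (M n) (S k))"
          using S by (intro sum.cong refl) (simp add: Int_absorb2 sets.sets_into_space)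
        finally show ?thesis
          using i by (subst Bochner_Integration.integral_add) (auto simp: prob_space)
      qed
      also have "\<dots> \<le> \<epsilon> + (\<Sum>k\<in>K. 2 * B * (2 * \<epsilon>))"
        using B0 by (intro add_left_mono sum_mono mult_left_mono Sle) auto
      also have "\<dots> < (2 + 4 * B * real (card K)) * \<epsilon>"
        using \<epsilon> by (simp add: algebra_simps)
      also have "\<dots> = r" using D by (simp add: \<epsilon>_def)
      finally show "norm ((\<integral>\<omega>. fX n \<omega> \<partial>M n) - (\<integral>\<omega>. fZ n \<omega> \<partial>M n) - 0) < r" by simp
    qed
  qed
  from tendsto_add[OF this Zlim] have "(\<lambda>n. \<integral>\<omega>. fX n \<omega> \<partial>M n) \<longlonglongrightarrow> (\<integral>x. f x \<partial>\<nu>)"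
    by simp
  thus "(\<lambda>n. \<integral>x. f x \<partial>distr (M n) (PiM K (\<lambda>_. borel)) (\<lambda>\<omega>. \<lambda>k\<in>K. X n k \<omega>)) \<longlonglongrightarrow> (\<integral>x. f x \<partial>\<nu>)"
  proof -
    have "(\<integral>x. f x \<partial>distr (M n) (PiM K (\<lambda>_. borel)) (\<lambda>\<omega>. \<lambda>k\<in>K. X n k \<omega>)) = (\<integral>\<omega>. fX n \<omega> \<partial>M n)" for n
      unfolding fX_def by (rule integral_distr_restrict(1)[OF f X])
    with \<open>(\<lambda>n. \<integral>\<omega>. fX n \<omega> \<partial>M n) \<longlonglongrightarrow> _\<close> show ?thesis by simp
  qed
qed

section \<open>Central limit theorem for bounded triangular arrays\<close>

lemma norm_prod_diff_le:
  fixes z w :: "'i \<Rightarrow> complex"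
  assumes "\<And>i. i \<in> A \<Longrightarrow> norm (z i) \<le> 1" and "\<And>i. i \<in> A \<Longrightarrow> norm (w i) \<le> 1"
  shows "norm ((\<Prod>i\<in>A. z i) - (\<Prod>i\<in>A. w i)) \<le> (\<Sum>i\<in>A. norm (z i - w i))"
  using assms
proof (induction A rule: infinite_finite_induct)
  case (insert i A)
  \<comment> \<open>Telescoping: one factor is exchanged at a time, and the unit bounds keep the
    others from amplifying the difference.\<close>
  have "z i * prod z A - w i * prod w A = (z i - w i) * prod z A + w i * (prod z A - prod w A)"
    by (simp add: algebra_simps)
  also have "norm \<dots> \<le> norm (z i - w i) * norm (prod z A) + norm (w i) * norm (prod z A - prod w A)"
    by (intro norm_triangle_le) (simp add: norm_mult)
  also have "\<dots> \<le> norm (z i - w i) * 1 + 1 * (\<Sum>i\<in>A. norm (z i - w i))"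
  proof (intro add_mono mult_mono)
    show "norm (prod z A) \<le> 1"
      using insert by (auto simp: prod_norm[symmetric] intro!: prod_le_1)
  qed (use insert in auto)
  finally show ?case using insert by simp
qed auto

lemma exp_minus_approx:
  fixes u :: real
  assumes "u \<ge> 0"
  shows "\<bar>exp (- u) - (1 - u)\<bar> \<le> u\<^sup>2"
proof -
  have 1: "exp (- u) \<ge> 1 - u" using exp_ge_add_one_self[of "- u"] by simp
  have "exp (- u) * (1 + u) \<le> exp (- u) * exp u"
    using exp_ge_add_one_self[of u] by (intro mult_left_mono) auto
  hence "exp (- u) * (1 + u) \<le> 1" by (simp flip: exp_add)
  hence "exp (- u) \<le> 1 / (1 + u)" using assms by (simp add: field_simps)
  also have "\<dots> \<le> 1 - u + u\<^sup>2"
  proof -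
    have "(1 - u + u\<^sup>2) * (1 + u) = 1 + u^3"
      by (simp add: algebra_simps power2_eq_square power3_eq_cube)
    moreover have "u^3 \<ge> 0" using assms by simp
    ultimately have "1 \<le> (1 - u + u\<^sup>2) * (1 + u)" by linarith
    thus ?thesis using assms by (simp add: pos_divide_le_eq)
  qed
  finally show ?thesis using 1 by simp
qed

text \<open>As the summands are bounded by \<open>b n\<close>, absolute third moments are at most
  \<open>b n\<close> times the variances. Each characteristic function is therefore within a
  vanishing multiple of its own variance of the Gaussian one with the same variance. These errors
  add up to a null sequence because the total variance converges, and Levy's continuity theorem
  concludes.\<close>

lemma bounded_triangular_array_clt:
  fixes X :: "nat \<Rightarrow> 'i \<Rightarrow> 'a \<Rightarrow> real"
  assumes M: "\<And>n. prob_space (M n)" and fin: "\<And>n. finite (A n)"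
    and indep: "\<And>n. prob_space.indep_vars (M n) (\<lambda>_. borel) (X n) (A n)"
    and mean: "\<And>n i. i \<in> A n \<Longrightarrow> (\<integral>\<omega>. X n i \<omega> \<partial>M n) = 0"
    and bound: "\<And>n i \<omega>. i \<in> A n \<Longrightarrow> \<omega> \<in> space (M n) \<Longrightarrow> \<bar>X n i \<omega>\<bar> \<le> b n"
    and b0: "\<And>n. b n \<ge> 0" and b: "b \<longlonglongrightarrow> 0"
    and var: "(\<lambda>n. \<Sum>i\<in>A n. \<integral>\<omega>. (X n i \<omega>)\<^sup>2 \<partial>M n) \<longlonglongrightarrow> 1"
  shows "weak_conv_m (\<lambda>n. distr (M n) borel (\<lambda>\<omega>. \<Sum>i\<in>A n. X n i \<omega>)) std_normal_distribution"
proof (rule levy_continuity)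
  have rv: "X n i \<in> borel_measurable (M n)" if "i \<in> A n" for n i
    using indep[of n] that unfolding prob_space.indep_vars_def[OF M] by auto
  show "real_distribution (distr (M n) borel (\<lambda>\<omega>. \<Sum>i\<in>A n. X n i \<omega>))" for n
    by (intro prob_space.real_distribution_distr[OF M] borel_measurable_sum rv)
  show "real_distribution std_normal_distribution" by (rule real_dist_normal_dist)
  fix t :: real
  define v where "v n i = (\<integral>\<omega>. (X n i \<omega>)\<^sup>2 \<partial>M n)" for n i
  define \<phi> where "\<phi> n i = char (distr (M n) borel (X n i)) t" for n i
  have approx: "v n i \<ge> 0 \<and> norm (\<phi> n i) \<le> 1 \<and>
      norm (\<phi> n i - complex_of_real (exp (- (t\<^sup>2 * v n i / 2)))) \<le> (\<bar>t\<bar>^3 * b n + t^4 * (b n)\<^sup>2) * v n i"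
    if i: "i \<in> A n" for n i
  proof -
    interpret prob_space "M n" by (rule M)
    note rvi [measurable] = rv[OF i]
    interpret D: real_distribution "distr (M n) borel (X n i)"
      by (rule real_distribution_distr) (rule rvi)
    have sq: "(X n i \<omega>)\<^sup>2 \<le> (b n)\<^sup>2" if "\<omega> \<in> space (M n)" for \<omega>
      using bound[OF i that] b0[of n] by (simp add: abs_le_square_iff[symmetric])
    have i1: "integrable (M n) (X n i)"
      by (rule integrable_const_bound[where B="b n"]) (use bound[OF i] in auto)
    have i2: "integrable (M n) (\<lambda>\<omega>. (X n i \<omega>)\<^sup>2)"
      by (rule integrable_const_bound[where B="(b n)\<^sup>2"]) (use sq in auto)
    have v0: "v n i \<ge> 0" unfolding v_def by simp
    \<comment> \<open>The exponential approximation has an error quadratic in the variance: one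
      factor is made small by this bound, the other is kept for the summation over
      \<open>i\<close>.\<close>
    have "v n i \<le> (\<integral>\<omega>. (b n)\<^sup>2 \<partial>M n)"
      unfolding v_def using sq i2 by (intro integral_mono) auto
    hence vb: "v n i \<le> (b n)\<^sup>2" by (simp add: prob_space)
    have E3: "(\<integral>\<omega>. min (6 * (X n i \<omega>)\<^sup>2) (\<bar>t\<bar> * \<bar>X n i \<omega>\<bar>^3) \<partial>M n) \<le> (\<integral>\<omega>. \<bar>t\<bar> * b n * (X n i \<omega>)\<^sup>2 \<partial>M n)"
    proof (rule integral_mono)
      show "integrable (M n) (\<lambda>\<omega>. min (6 * (X n i \<omega>)\<^sup>2) (\<bar>t\<bar> * \<bar>X n i \<omega>\<bar>^3))"
        by (rule Bochner_Integration.integrable_bound[of _ "\<lambda>\<omega>. 6 * (X n i \<omega>)\<^sup>2"]) (use i2 in auto)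
      show "integrable (M n) (\<lambda>\<omega>. \<bar>t\<bar> * b n * (X n i \<omega>)\<^sup>2)" using i2 by simp
      fix \<omega> assume \<omega>: "\<omega> \<in> space (M n)"
      have "\<bar>X n i \<omega>\<bar>^3 = \<bar>X n i \<omega>\<bar> * (X n i \<omega>)\<^sup>2"
        by (simp add: power3_eq_cube power2_eq_square abs_mult_self_eq)
      also have "\<dots> \<le> b n * (X n i \<omega>)\<^sup>2" using bound[OF i \<omega>] by (intro mult_right_mono) auto
      finally have "\<bar>t\<bar> * \<bar>X n i \<omega>\<bar>^3 \<le> \<bar>t\<bar> * (b n * (X n i \<omega>)\<^sup>2)" by (intro mult_left_mono) auto
      thus "min (6 * (X n i \<omega>)\<^sup>2) (\<bar>t\<bar> * \<bar>X n i \<omega>\<bar>^3) \<le> \<bar>t\<bar> * b n * (X n i \<omega>)\<^sup>2" by simp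
    qed
    have "norm (\<phi> n i - (1 - t^2 * v n i / 2)) \<le>
        (t\<^sup>2 / 6) * (\<integral>\<omega>. min (6 * (X n i \<omega>)\<^sup>2) (\<bar>t\<bar> * \<bar>X n i \<omega>\<bar>^3) \<partial>M n)"
      unfolding \<phi>_def by (rule char_approx3'[OF rvi i1 i2 mean[OF i] _ refl]) (simp add: mean[OF i] v_def)
    also have "\<dots> \<le> t\<^sup>2 / 6 * (\<bar>t\<bar> * b n * v n i)"
      using E3 i2 by (intro mult_left_mono) (auto simp: v_def)
    also have "\<dots> = \<bar>t\<bar>^3 * b n * v n i / 6"
      by (simp add: power3_eq_cube power2_eq_square abs_mult_self_eq)
    also have "\<dots> \<le> \<bar>t\<bar>^3 * b n * v n i" using b0[of n] v0 by simp
    finally have e1: "norm (\<phi> n i - (1 - t^2 * v n i / 2)) \<le> \<bar>t\<bar>^3 * b n * v n i" .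
    have "\<bar>exp (- (t\<^sup>2 * v n i / 2)) - (1 - t\<^sup>2 * v n i / 2)\<bar> \<le> (t\<^sup>2 * v n i / 2)\<^sup>2"
      using v0 by (intro exp_minus_approx) auto
    also have "\<dots> = t^4 * v n i * v n i / 4" by (simp add: power2_eq_square power4_eq_xxxx)
    also have "\<dots> \<le> t^4 * v n i * v n i" using v0 by simp
    also have "\<dots> \<le> t^4 * (b n)\<^sup>2 * v n i" using v0 vb by (intro mult_right_mono mult_left_mono) auto
    finally have e2: "norm (complex_of_real (1 - t\<^sup>2 * v n i / 2) - complex_of_real (exp (- (t\<^sup>2 * v n i / 2)))) \<le> t^4 * (b n)\<^sup>2 * v n i"
      unfolding of_real_diff[symmetric] norm_of_real by linarith
    have "norm (\<phi> n i - complex_of_real (exp (- (t\<^sup>2 * v n i / 2)))) \<le> (\<bar>t\<bar>^3 * b n + t^4 * (b n)\<^sup>2) * v n i"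
      using norm_triangle_ineq[of "\<phi> n i - complex_of_real (1 - t\<^sup>2 * v n i / 2)" "complex_of_real (1 - t\<^sup>2 * v n i / 2) - complex_of_real (exp (- (t\<^sup>2 * v n i / 2)))"] e1 e2
      by (simp add: distrib_right)
    thus ?thesis using v0 D.cmod_char_le_1 unfolding \<phi>_def by simp
  qed
  have main: "norm (char (distr (M n) borel (\<lambda>\<omega>. \<Sum>i\<in>A n. X n i \<omega>)) t - complex_of_real (exp (- (t\<^sup>2 / 2) * (\<Sum>i\<in>A n. v n i))))
      \<le> (\<bar>t\<bar>^3 * b n + t^4 * (b n)\<^sup>2) * (\<Sum>i\<in>A n. v n i)" for n
  proof -
    have "char (distr (M n) borel (\<lambda>\<omega>. \<Sum>i\<in>A n. X n i \<omega>)) t = (\<Prod>i\<in>A n. \<phi> n i)"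
      unfolding \<phi>_def by (rule prob_space.char_distr_sum[OF M indep])
    moreover have "complex_of_real (exp (- (t\<^sup>2 / 2) * (\<Sum>i\<in>A n. v n i))) = (\<Prod>i\<in>A n. complex_of_real (exp (- (t\<^sup>2 * v n i / 2))))"
      by (simp add: sum_distrib_left exp_sum[OF fin] flip: of_real_prod)
    moreover have "norm ((\<Prod>i\<in>A n. \<phi> n i) - (\<Prod>i\<in>A n. complex_of_real (exp (- (t\<^sup>2 * v n i / 2)))))
        \<le> (\<Sum>i\<in>A n. norm (\<phi> n i - complex_of_real (exp (- (t\<^sup>2 * v n i / 2)))))"
      using approx by (intro norm_prod_diff_le) auto
    moreover have "\<dots> \<le> (\<Sum>i\<in>A n. (\<bar>t\<bar>^3 * b n + t^4 * (b n)\<^sup>2) * v n i)"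
      using approx by (intro sum_mono) auto
    ultimately show ?thesis by (simp add: sum_distrib_left)
  qed
  have "(\<lambda>n. (\<bar>t\<bar>^3 * b n + t^4 * (b n)\<^sup>2) * (\<Sum>i\<in>A n. v n i)) \<longlonglongrightarrow> (\<bar>t\<bar>^3 * 0 + t^4 * 0\<^sup>2) * 1"
    unfolding v_def by (intro tendsto_intros b var)
  hence "(\<lambda>n. char (distr (M n) borel (\<lambda>\<omega>. \<Sum>i\<in>A n. X n i \<omega>)) t - complex_of_real (exp (- (t\<^sup>2 / 2) * (\<Sum>i\<in>A n. v n i)))) \<longlonglongrightarrow> 0"
    by (rule_tac Lim_null_comparison[OF always_eventually[OF allI[OF main]]]) simp
  moreover have "(\<lambda>n. complex_of_real (exp (- (t\<^sup>2 / 2) * (\<Sum>i\<in>A n. v n i)))) \<longlonglongrightarrow> complex_of_real (exp (- (t\<^sup>2 / 2) * 1))"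
    unfolding v_def by (intro tendsto_intros var)
  ultimately have "(\<lambda>n. char (distr (M n) borel (\<lambda>\<omega>. \<Sum>i\<in>A n. X n i \<omega>)) t) \<longlonglongrightarrow> complex_of_real (exp (- (t\<^sup>2 / 2) * 1))"
    using tendsto_add by fastforce
  thus "(\<lambda>n. char (distr (M n) borel (\<lambda>\<omega>. \<Sum>i\<in>A n. X n i \<omega>)) t) \<longlonglongrightarrow> char std_normal_distribution t"
    by (simp add: char_std_normal_distribution)
qed

section \<open>Asymptotic normality\<close>

text \<open>Private degrees will be divided by the standard deviation of the full degree, so their
  variance is 1 only in the limit. The loss is at most \<open>card J * Q\<close> out of a variance
  of order \<open>n * Q\<close>.\<close>

lemma private_edges_var_ratio:
  assumes s: "s \<ge> 2" and n: "n \<ge> s + 2" and \<beta>: "\<And>u. u \<in> {1..n} \<Longrightarrow> \<bar>\<beta> u\<bar> \<le> M"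
    and J: "J \<subseteq> {1..n}" and v: "v \<in> J"
  shows "(\<Sum>e\<in>private_edges n s J v. logistic_deriv (sum \<beta> e)) / degree_var n s \<beta> v \<le> 1"
    and "1 - real (card J) / (variance_constant s M * real n) \<le>
           (\<Sum>e\<in>private_edges n s J v. logistic_deriv (sum \<beta> e)) / degree_var n s \<beta> v"
proof -
  let ?E = "{e \<in> hyperedges n s. v \<in> e}" and ?Q = "real n ^ (s - 2)"
  define D where "D = (\<Sum>e\<in>?E - private_edges n s J v. logistic_deriv (sum \<beta> e))"
  define S where "S = (\<Sum>e\<in>private_edges n s J v. logistic_deriv (sum \<beta> e))"
  have c: "variance_constant s M > 0" by (rule variance_constant_pos[OF s])
  have N: "real n > 0" "?Q > 0" using n by auto
  have V: "variance_constant s M * (real n * ?Q) \<le> degree_var n s \<beta> v"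
    using degree_var_ge[where v=v, OF s n \<beta>] J v by auto
  have cNQ: "variance_constant s M * (real n * ?Q) > 0" using c N by simp
  have V0: "degree_var n s \<beta> v > 0" using V cNQ by linarith
  have DS: "degree_var n s \<beta> v = D + S"
    unfolding degree_var_def D_def S_def
    using finite_hyperedges private_edges_subset by (subst sum.subset_diff[of "private_edges n s J v"]) auto
  have D0: "D \<ge> 0" unfolding D_def using logistic_deriv_pos by (intro sum_nonneg) (auto intro: less_imp_le)
  have D1: "D \<le> real (card J) * ?Q" unfolding D_def by (rule shared_edges_var_le[OF s n J v])
  show "S / degree_var n s \<beta> v \<le> 1" using DS D0 V0 by simp
  have "D / degree_var n s \<beta> v \<le> (real (card J) * ?Q) / (variance_constant s M * (real n * ?Q))"
    by (rule frac_le[OF _ D1 cNQ V]) simp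
  also have "\<dots> = real (card J) / (variance_constant s M * real n)" using N by simp
  finally show "1 - real (card J) / (variance_constant s M * real n) \<le> S / degree_var n s \<beta> v"
    using DS V0 by (simp add: field_simps)
qed

lemma private_degree_second_moment:
  assumes s: "s \<in> {2..r}"
  shows "measure_pmf.expectation (hypergraph_beta_model n r B) (\<lambda>H. (private_degree n s B J v H)\<^sup>2) =
           (\<Sum>e\<in>private_edges n s J v. logistic_deriv (sum (B s) e))"
proof -
  have A: "private_edges n s J v \<subseteq> layered_hyperedges n r"
    using hyperedges_subset_layered[OF s] by (auto simp: private_edges_def)
  show ?thesis
    using edge_dev_sum_moments(2)[OF A, of B "\<lambda>_. 1"] sum_degree_var_eq[of "private_edges n s J v" n s "\<lambda>_. 1" B]
    by (simp add: private_degree_def private_edges_def)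
qed

lemma converges_in_distribution_offset:
  assumes "converges_in_distribution K (\<lambda>n. P (n + d)) (\<lambda>n. X (n + d)) \<nu>"
  shows "converges_in_distribution K P X \<nu>"
  using assms unfolding converges_in_distribution_def weakly_converges_def
  by (blast intro: LIMSEQ_offset)

theorem theorem2p3:
  fixes r :: nat and M :: real
    and B :: "nat \<Rightarrow> nat \<Rightarrow> nat \<Rightarrow> real"
    and a :: "nat \<Rightarrow> nat"
    and J :: "nat \<Rightarrow> nat \<Rightarrow> nat set"
    and est :: "nat \<Rightarrow> nat \<Rightarrow> nat set set \<Rightarrow> nat \<Rightarrow> real"
  assumes "r \<ge> 2" and "M > 0"
    and "\<And>n s v. s \<in> {2..r} \<Longrightarrow> v \<in> {1..n} \<Longrightarrow> \<bar>B n s v\<bar> \<le> M"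
    and "\<And>s. s \<in> {2..r} \<Longrightarrow> a s \<ge> 1"
    and "eventually (\<lambda>n. \<forall>s\<in>{2..r}. J n s \<subseteq> {1..n} \<and> card (J n s) = a s) sequentially"
    and "\<And>n s. s \<in> {2..r} \<Longrightarrow> ml_estimator n r s (est n s)"
  shows "converges_in_distribution (stack_index r a)
           (\<lambda>n. measure_pmf (hypergraph_beta_model n r (B n)))
           (\<lambda>n H. stacked_restriction r a (J n)
              (\<lambda>s v. degree_sd n r (B n) s v * (est n s H v - B n s v)))
           (std_normal_vector (stack_index r a))"
proof -
  note M = assms(2) and Bb = assms(3) and a1 = assms(4) and est = assms(6)
  obtain n1 where n1: "\<And>n s. n \<ge> n1 \<Longrightarrow> s \<in> {2..r} \<Longrightarrow> J n s \<subseteq> {1..n} \<and> card (J n s) = a s"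
    using assms(5) unfolding eventually_sequentially by blast
  define n0 where "n0 = max n1 (r + 2)"
  define K where "K = stack_index r a"
  \<comment> \<open>The shift by \<open>n0\<close> makes the conditions on \<open>J\<close> and
    \<open>m n \<ge> s + 2\<close> hold at every index instead of eventually;
    \<open>converges_in_distribution_offset\<close> undoes it at the end.\<close>
  define m where "m n = n + n0" for n
  define P where "P n = measure_pmf (hypergraph_beta_model (m n) r (B (m n)))" for n
  define v where "v n k = sorted_list_of_set (J (m n) (fst k)) ! snd k" for n and k :: "nat \<times> nat"
  define A where "A n k = private_edges (m n) (fst k) (J (m n) (fst k)) (v n k)" for n k
  define \<sigma> where "\<sigma> n k = degree_sd (m n) r (B (m n)) (fst k) (v n k)" for n k
  define Z where "Z n k H = private_degree (m n) (fst k) (B (m n)) (J (m n) (fst k)) (v n k) H / \<sigma> n k" for n k H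
  define X where "X n k H = \<sigma> n k * (est (m n) (fst k) H (v n k) - B (m n) (fst k) (v n k))" for n k H
  have m: "m n \<ge> s + 2" if "s \<in> {2..r}" for n s using that by (auto simp: m_def n0_def)
  have J: "J (m n) s \<subseteq> {1..m n}" "card (J (m n) s) = a s" if "s \<in> {2..r}" for n s
    using n1[OF _ that, of "m n"] by (auto simp: m_def n0_def)
  have finJ: "finite (J (m n) s)" if "s \<in> {2..r}" for n s using J(1)[OF that] finite_subset by blast
  have K: "fst k \<in> {2..r}" "snd k < a (fst k)" if "k \<in> K" for k
    using that by (auto simp: K_def stack_index_def)
  have finK: "finite K" by (simp add: K_def stack_index_def)
  have neK: "K \<noteq> {}"
  proof -
    have "(2, 0) \<in> K" using assms(1) a1[of 2] by (auto simp: K_def stack_index_def)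
    thus ?thesis by blast
  qed
  have vJ: "v n k \<in> J (m n) (fst k)" if "k \<in> K" for n k
    using nth_mem[of "snd k" "sorted_list_of_set (J (m n) (fst k))"] K[OF that] J(2)[OF K(1)[OF that], of n] finJ[OF K(1)[OF that], of n]
    by (simp add: v_def)
  have v_inj: "snd k = snd k'" if "k \<in> K" "k' \<in> K" "fst k = fst k'" "v n k = v n k'" for n k k'
    using that K[OF that(1)] K[OF that(2)] J(2)[OF K(1)[OF that(1)], of n]
      nth_eq_iff_index_eq[of "sorted_list_of_set (J (m n) (fst k))" "snd k" "snd k'"]
    by (simp add: v_def)
  have A_sub: "A n k \<subseteq> layered_hyperedges (m n) r" if "k \<in> K" for n k
    using hyperedges_subset_layered[OF K(1)[OF that]] by (auto simp: A_def private_edges_def)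
  \<comment> \<open>A common hyperedge has one size, hence one layer, and meets that layer's
    \<open>J\<close> in one vertex, hence one position in the sorted list. This covers different
    layers and different vertices at once.\<close>
  have disj: "disjoint_family_on (A n) K" for n
    unfolding disjoint_family_on_def
  proof (intro ballI impI, rule ccontr)
    fix k k' assume kk': "k \<in> K" "k' \<in> K" "k \<noteq> k'" and "A n k \<inter> A n k' \<noteq> {}"
    then obtain e where e: "e \<in> A n k" "e \<in> A n k'" by blast
    hence "fst k = fst k'" by (simp add: A_def private_edges_def hyperedges_def)
    moreover from this e have "v n k = v n k'" by (simp add: A_def private_edges_def)
    ultimately show False using v_inj[OF kk'(1,2)] kk'(3) by (auto simp: prod_eq_iff)
  qed
  have \<sigma>2: "(\<sigma> n k)\<^sup>2 = degree_var (m n) (fst k) (B (m n) (fst k)) (v n k)"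
    and \<sigma>_ge: "\<sigma> n k \<ge> sqrt (variance_constant (fst k) M * real (m n))"
    and \<sigma>0: "\<sigma> n k > 0" if k: "k \<in> K" for n k
  proof -
    note s = K(1)[OF k]
    let ?V = "degree_var (m n) (fst k) (B (m n) (fst k)) (v n k)"
    have s2: "fst k \<ge> 2" using s by simp
    have v1: "v n k \<in> {1..m n}" using vJ[OF k, of n] J(1)[OF s, of n] by blast
    have c: "variance_constant (fst k) M > 0" by (rule variance_constant_pos[OF s2])
    have mpos: "real (m n) > 0" using m[OF s, of n] by simp
    have "variance_constant (fst k) M * real (m n) * 1 \<le> variance_constant (fst k) M * real (m n) * real (m n) ^ (fst k - 2)"
      using c mpos m[OF s, of n] by (intro mult_left_mono) auto
    also have "\<dots> \<le> ?V"
      using degree_var_ge[OF s2 m[OF s] Bb[OF s] v1] by (simp add: mult.assoc)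
    finally have V: "variance_constant (fst k) M * real (m n) \<le> ?V" by simp
    have "variance_constant (fst k) M * real (m n) > 0" using c mpos by simp
    with V have V0: "?V > 0" by linarith
    have eq: "\<sigma> n k = sqrt ?V" unfolding \<sigma>_def by (rule degree_sd_eq[OF s])
    show "(\<sigma> n k)\<^sup>2 = ?V" "\<sigma> n k > 0" "\<sigma> n k \<ge> sqrt (variance_constant (fst k) M * real (m n))"
      using V V0 by (auto simp: eq)
  qed
  have m_top: "filterlim (\<lambda>n. real (m n)) at_top sequentially"
    unfolding m_def by real_asymp
  have Z_eq: "Z n k H = (\<Sum>e\<in>A n k. edge_dev (B (m n)) e H / \<sigma> n k)" for n k H
    by (simp add: Z_def A_def private_degree_def sum_divide_distrib)
  have ZE: "(\<integral>H. (Z n k H)\<^sup>2 \<partial>P n) = (\<Sum>e\<in>A n k. logistic_deriv (sum (B (m n) (fst k)) e)) / (\<sigma> n k)\<^sup>2"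
    if k: "k \<in> K" for n k
    unfolding P_def Z_def A_def power_divide by (simp add: private_degree_second_moment[OF K(1)[OF k]])
  have ratio: "(\<integral>H. (Z n k H)\<^sup>2 \<partial>P n) \<le> 1"
     "1 - real (a (fst k)) / (variance_constant (fst k) M * real (m n)) \<le> (\<integral>H. (Z n k H)\<^sup>2 \<partial>P n)"
    if k: "k \<in> K" for n k
  proof -
    note s = K(1)[OF k]
    have s2: "fst k \<ge> 2" using s by simp
    note * = private_edges_var_ratio[OF s2 m[OF s] Bb[OF s] J(1)[OF s] vJ[OF k], of n]
    show "(\<integral>H. (Z n k H)\<^sup>2 \<partial>P n) \<le> 1"
      "1 - real (a (fst k)) / (variance_constant (fst k) M * real (m n)) \<le> (\<integral>H. (Z n k H)\<^sup>2 \<partial>P n)"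
      using * unfolding ZE[OF k] \<sigma>2[OF k] A_def J(2)[OF s] by simp_all
  qed
  have indepZ: "prob_space.indep_vars (P n) (\<lambda>_. borel) (Z n) K" for n
  proof -
    have "prob_space.indep_vars (P n) (\<lambda>k. PiM (A n k) (\<lambda>_. borel))
        (\<lambda>k H. restrict (\<lambda>e. edge_dev (B (m n)) e H) (A n k)) K"
      unfolding P_def
      by (rule prob_space.indep_vars_restrict[OF prob_space_measure_pmf indep_edge_dev A_sub disj])
    hence "prob_space.indep_vars (P n) (\<lambda>_. borel)
        (\<lambda>k H. (\<Sum>e\<in>A n k. restrict (\<lambda>e. edge_dev (B (m n)) e H) (A n k) e / \<sigma> n k)) K"
      unfolding P_def
      by (rule prob_space.indep_vars_compose2[OF prob_space_measure_pmf])
         (intro borel_measurable_sum borel_measurable_divide borel_measurable_const measurable_component_singleton)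
    thus ?thesis by (simp add: Z_eq[abs_def])
  qed
  have conv: "weak_conv_m (\<lambda>n. distr (P n) borel (Z n k)) std_normal_distribution" if k: "k \<in> K" for k
  proof -
    note s = K(1)[OF k]
    have c: "variance_constant (fst k) M > 0" using s by (intro variance_constant_pos) auto
    \<comment> \<open>Edge deviations are at most 1 in absolute value and
      \<open>\<sigma> n k\<close> grows at least like the square root of \<open>m n\<close>, so the
      normalized summands are uniformly small.\<close>
    have "weak_conv_m (\<lambda>n. distr (P n) borel (\<lambda>H. \<Sum>e\<in>A n k. edge_dev (B (m n)) e H / \<sigma> n k)) std_normal_distribution"
    proof (rule bounded_triangular_array_clt[where b="\<lambda>n. 1 / \<sigma> n k"])
      show "prob_space (P n)" for n unfolding P_def by (rule prob_space_measure_pmf)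
      show "finite (A n k)" for n using A_sub[OF k] finite_layered_hyperedges finite_subset by blast
      show "prob_space.indep_vars (P n) (\<lambda>_. borel) (\<lambda>e H. edge_dev (B (m n)) e H / \<sigma> n k) (A n k)" for n
        unfolding P_def
        by (rule prob_space.indep_vars_compose2[OF prob_space_measure_pmf
              prob_space.indep_vars_subset[OF prob_space_measure_pmf indep_edge_dev A_sub[OF k]]]) auto
      show "(\<integral>H. edge_dev (B (m n)) e H / \<sigma> n k \<partial>P n) = 0" if "e \<in> A n k" for n e
        using A_sub[OF k] that unfolding P_def by (simp add: expectation_edge_dev(1) subset_iff)
      show "\<bar>edge_dev (B (m n)) e H / \<sigma> n k\<bar> \<le> 1 / \<sigma> n k" for n e H
        using abs_edge_dev_le[of "B (m n)" e H] \<sigma>0[OF k, of n] by (simp add: divide_right_mono)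
      show "1 / \<sigma> n k \<ge> 0" for n using \<sigma>0[OF k, of n] by simp
      show "(\<lambda>n. 1 / \<sigma> n k) \<longlonglongrightarrow> 0"
      proof (rule Lim_null_comparison)
        show "eventually (\<lambda>n. norm (1 / \<sigma> n k) \<le> 1 / sqrt (variance_constant (fst k) M * real (m n))) sequentially"
        proof (intro always_eventually allI)
          fix n
          have "sqrt (variance_constant (fst k) M * real (m n)) > 0" using c m[OF s, of n] by simp
          with \<sigma>_ge[OF k, of n] have "1 / \<sigma> n k \<le> 1 / sqrt (variance_constant (fst k) M * real (m n))"
            by (intro frac_le) auto
          thus "norm (1 / \<sigma> n k) \<le> 1 / sqrt (variance_constant (fst k) M * real (m n))"
            using \<sigma>0[OF k, of n] by simp
        qed
        show "(\<lambda>n. 1 / sqrt (variance_constant (fst k) M * real (m n))) \<longlonglongrightarrow> 0"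
          using c unfolding m_def by real_asymp
      qed
      have sq: "(\<Sum>e\<in>A n k. \<integral>H. (edge_dev (B (m n)) e H / \<sigma> n k)\<^sup>2 \<partial>P n) = (\<integral>H. (Z n k H)\<^sup>2 \<partial>P n)" for n
      proof -
        have "(\<integral>H. (edge_dev (B (m n)) e H / \<sigma> n k)\<^sup>2 \<partial>P n) = logistic_deriv (sum (B (m n) (fst k)) e) / (\<sigma> n k)\<^sup>2"
          if e: "e \<in> A n k" for e
        proof -
          have "card e = fst k" using e by (simp add: A_def private_edges_def hyperedges_def)
          thus ?thesis using A_sub[OF k, of n] e expectation_edge_dev(2)[of e "m n" r "B (m n)"]
            unfolding P_def power_divide by auto
        qed
        thus ?thesis unfolding ZE[OF k] sum_divide_distrib by (rule sum.cong[OF refl])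
      qed
      show "(\<lambda>n. \<Sum>e\<in>A n k. \<integral>H. (edge_dev (B (m n)) e H / \<sigma> n k)\<^sup>2 \<partial>P n) \<longlonglongrightarrow> 1"
        unfolding sq
      proof (rule tendsto_sandwich[OF always_eventually always_eventually])
        show "\<forall>n. 1 - real (a (fst k)) / (variance_constant (fst k) M * real (m n)) \<le> (\<integral>H. (Z n k H)\<^sup>2 \<partial>P n)"
          "\<forall>n. (\<integral>H. (Z n k H)\<^sup>2 \<partial>P n) \<le> 1" using ratio[OF k] by auto
        show "(\<lambda>n. 1 - real (a (fst k)) / (variance_constant (fst k) M * real (m n))) \<longlonglongrightarrow> 1"
          using c unfolding m_def by real_asymp
      qed simp
    qed
    thus ?thesis by (simp add: Z_eq[abs_def])
  qed
  \<comment> \<open>Exact independence makes the joint law the product of its marginals, so the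
    limit theorem for single coordinates suffices.\<close>
  have distrZ: "distr (P n) (PiM K (\<lambda>_. borel)) (\<lambda>H. \<lambda>k\<in>K. Z n k H) = PiM K (\<lambda>k. distr (P n) borel (Z n k))" for n
    using indepZ[of n] neK unfolding P_def
    by (subst (asm) prob_space.indep_vars_iff_distr_eq_PiM'[OF prob_space_measure_pmf]) auto
  have Zconv: "converges_in_distribution K P (\<lambda>n H. \<lambda>k\<in>K. Z n k H) (std_normal_vector K)"
    unfolding converges_in_distribution_def distrZ std_normal_vector_def
  proof (rule weakly_converges_PiM[OF finK _ real_dist_normal_dist conv])
    show "real_distribution (distr (P n) borel (Z n k))" for n k
      unfolding P_def by (rule prob_space.real_distribution_distr[OF prob_space_measure_pmf]) simp
  qed
  have Xconv: "converges_in_distribution K P (\<lambda>n H. \<lambda>k\<in>K. X n k H) (std_normal_vector K)"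
  proof (rule converges_in_distribution_perturb[OF finK _ _ _ Zconv])
    show "prob_space (P n)" for n unfolding P_def by (rule prob_space_measure_pmf)
    show "X n k \<in> borel_measurable (P n)" "Z n k \<in> borel_measurable (P n)" for n k by (simp_all add: P_def)
  next
    fix \<epsilon> :: real assume \<epsilon>: "\<epsilon> > 0"
    \<comment> \<open>Chebyshev's inequality: the second moments are at most 1 uniformly in
      \<open>n\<close>, so \<open>1 / sqrt \<epsilon>\<close> is a sufficient threshold.\<close>
    have "measure (P n) {H \<in> space (P n). \<bar>Z n k H\<bar> > 1 / sqrt \<epsilon>} \<le> \<epsilon>" if k: "k \<in> K" for n k
    proof -
      have "measure (P n) {H \<in> space (P n). \<bar>Z n k H\<bar> > 1 / sqrt \<epsilon>} \<le> measure (P n) {H \<in> space (P n). (Z n k H)\<^sup>2 \<ge> 1 / \<epsilon>}"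
        unfolding P_def
      proof (rule measure_pmf.finite_measure_mono, safe)
        fix H assume "\<bar>Z n k H\<bar> > 1 / sqrt \<epsilon>"
        hence "(1 / sqrt \<epsilon>)\<^sup>2 \<le> \<bar>Z n k H\<bar>\<^sup>2" using \<epsilon> by (intro power_mono) auto
        thus "(Z n k H)\<^sup>2 \<ge> 1 / \<epsilon>" using \<epsilon> by (simp add: power_divide)
      qed auto
      also have "\<dots> \<le> (\<integral>H. (Z n k H)\<^sup>2 \<partial>P n) / (1 / \<epsilon>)"
        using \<epsilon> unfolding P_def by (intro integral_Markov_inequality_measure[where A="{}"]) auto
      also have "\<dots> \<le> 1 / (1 / \<epsilon>)"
        using ratio(1)[OF k, of n] \<epsilon> by (intro divide_right_mono) auto
      finally show ?thesis by simp
    qed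
    thus "\<exists>C. \<forall>k\<in>K. eventually (\<lambda>n. measure (P n) {H \<in> space (P n). \<bar>Z n k H\<bar> > C} \<le> \<epsilon>) sequentially"
      by (intro exI[of _ "1 / sqrt \<epsilon>"]) simp
  next
    fix k and \<delta> :: real assume k: "k \<in> K" and \<delta>: "\<delta> > 0"
    note s = K(1)[OF k]
    obtain \<epsilon> C where \<epsilon>: "\<epsilon> > 0" and bound:
      "\<And>n B est J v \<delta>. n \<ge> fst k + 2 \<Longrightarrow> (\<And>u. u \<in> {1..n} \<Longrightarrow> \<bar>B (fst k) u\<bar> \<le> M) \<Longrightarrow> ml_estimator n r (fst k) est \<Longrightarrow>
       J \<subseteq> {1..n} \<Longrightarrow> card J \<le> a (fst k) \<Longrightarrow> v \<in> J \<Longrightarrow> \<delta> > 0 \<Longrightarrow>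
       measure_pmf.prob (hypergraph_beta_model n r B)
         {H. \<bar>degree_sd n r B (fst k) v * (est H v - B (fst k) v) - private_degree n (fst k) B J v H / degree_sd n r B (fst k) v\<bar> > \<delta>}
       \<le> 2 * real n * exp (- 2 * \<epsilon>\<^sup>2 * real n) + C / (\<delta> * sqrt (real n))"
      using ml_estimate_linearization[OF s M, of "a (fst k)"] by blast
    show "(\<lambda>n. measure (P n) {H \<in> space (P n). \<bar>X n k H - Z n k H\<bar> > \<delta>}) \<longlonglongrightarrow> 0"
    proof (rule Lim_null_comparison[OF always_eventually[OF allI]])
      fix n
      show "norm (measure (P n) {H \<in> space (P n). \<bar>X n k H - Z n k H\<bar> > \<delta>}) \<le>
          2 * real (m n) * exp (- 2 * \<epsilon>\<^sup>2 * real (m n)) + C / (\<delta> * sqrt (real (m n)))"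
        using bound[where n="m n" and B="B (m n)" and est="est (m n) (fst k)" and J="J (m n) (fst k)" and v="v n k",
            OF m[OF s] Bb[OF s] est[OF s] J(1)[OF s] _ vJ[OF k] \<delta>] J(2)[OF s, of n]
        by (simp add: P_def X_def Z_def \<sigma>_def)
      show "(\<lambda>n. 2 * real (m n) * exp (- 2 * \<epsilon>\<^sup>2 * real (m n)) + C / (\<delta> * sqrt (real (m n)))) \<longlonglongrightarrow> 0"
        using \<epsilon> \<delta> unfolding m_def by real_asymp
    qed
  qed
  have X_eq: "(\<lambda>k\<in>K. X n k H) = stacked_restriction r a (J (m n))
      (\<lambda>s v. degree_sd (m n) r (B (m n)) s v * (est (m n) s H v - B (m n) s v))" for n H
    unfolding stacked_restriction_def K_def[symmetric] by (auto simp: X_def \<sigma>_def v_def fun_eq_iff)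
  show ?thesis
    by (rule converges_in_distribution_offset[where d=n0])
       (rule Xconv[unfolded X_eq, unfolded K_def P_def m_def])
qed

end
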